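(* Let $\alpha>0$ and $\lambda>0$ with $\alpha\notin\mathbb{N}$, and put $\mu=\alpha\lambda$. For $t>0$ let \[ w_{\alpha,\lambda}(t)=\frac{t^{\alpha-1}}{\lambda^\alpha\Gamma(\alpha)}\exp\Big\{-\frac{t}{\lambda}\Big\}. \] Then \[ \sum_{n=1}^\infty \Lambda(n)\, w_{\alpha,\frac{\mu}{\alpha}}(n)=1-\sum_{\rho}\frac{\Gamma(\alpha+\rho-1)}{\Gamma(\alpha)}\Big(\frac{\mu}{\alpha}\Big)^{\rho-1}-R(\mu,\alpha), \] where \[ R(\mu,\alpha)=\sum_{j=1}^\infty\frac{(\alpha/\mu)^{2j+1}}{(\alpha-1)_{2j+1}}-\frac{(\alpha/\mu)^\alpha}{\Gamma(\alpha)}\sum_{j=0}^\infty\frac{(-1)^j}{j!}\Big(\frac{\alpha}{\mu}\Big)^j\frac{\zeta'(1-\alpha-j)}{\zeta(1-\alpha-j)}. \]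
   Context: $\Lambda(n)$ is the von Mangoldt function and $\zeta$ is the Riemann zeta function. The sum over $\rho$ runs over the nontrivial zeros $\rho=\beta+i\gamma$ of $\zeta(s)$, counted with multiplicity. $(x)_n$ denotes the falling factorial $(x)_n=x(x-1)\cdots(x-n+1)$.
   Formalization: The second series in R(μ,α) is taken with a plus sign instead of the printed minus: the residues at s=1−α−j require it, and the printed identity fails, e.g. for α=1/2 and large λ, where that series tends to ζ'(1/2)/ζ(1/2)≠0. *)

theory Defs
  imports "HOL-Complex_Analysis.Complex_Analysis" "HOL-Number_Theory.Prime_Powers"
begin

text \<open>
  The Riemann zeta function: the analytic continuation of \<open>\<Sum>n\<ge>1. n\<^sup>-\<^sup>s\<close> to the plane
  punctured at \<open>1\<close>.  By the identity theorem there is only one such function once its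
  (irrelevant) value at the pole is fixed.
\<close>

definition zeta :: "complex \<Rightarrow> complex" where
  "zeta = (THE f. f holomorphic_on (- {1}) \<and>
                  (\<forall>s. Re s > 1 \<longrightarrow> f s = (\<Sum>n. 1 / of_nat (Suc n) powr s)) \<and>
                  f 1 = 0)"

text \<open>
  The trivial zeros are the negative even integers.  The point \<open>1\<close> is excluded because
  \<open>zeta 1 = 0\<close> is only the convention made above at the pole.
\<close>

definition nontrivial_zeros :: "complex set" where
  "nontrivial_zeros = {\<rho>. \<rho> \<noteq> 1 \<and> zeta \<rho> = 0 \<and> (\<forall>k::nat. k \<ge> 1 \<longrightarrow> \<rho> \<noteq> - 2 * of_nat k)}"

definition falling_factorial :: "'a::comm_ring_1 \<Rightarrow> nat \<Rightarrow> 'a" where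
  "falling_factorial x n = (\<Prod>i<n. x - of_nat i)"

definition gamma_weight :: "real \<Rightarrow> real \<Rightarrow> real \<Rightarrow> real" where
  "gamma_weight \<alpha> lam t = t powr (\<alpha> - 1) / (lam powr \<alpha> * Gamma \<alpha>) * exp (- t / lam)"

text \<open>Multiplicity of a zero is expressed by the factor \<open>zorder zeta \<rho>\<close>.\<close>

definition zero_term :: "real \<Rightarrow> real \<Rightarrow> complex \<Rightarrow> complex" where
  "zero_term \<mu> \<alpha> \<rho> = of_int (zorder zeta \<rho>) *
     (Gamma (of_real \<alpha> + \<rho> - 1) / Gamma (of_real \<alpha>) * of_real (\<mu> / \<alpha>) powr (\<rho> - 1))"

definition R_falling_term :: "real \<Rightarrow> real \<Rightarrow> nat \<Rightarrow> real" where
  "R_falling_term \<mu> \<alpha> j = (\<alpha> / \<mu>) ^ (2 * j + 1) / falling_factorial (\<alpha> - 1) (2 * j + 1)"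

definition R_zeta_term :: "real \<Rightarrow> real \<Rightarrow> nat \<Rightarrow> complex" where
  "R_zeta_term \<mu> \<alpha> j = (- 1) ^ j / fact j * of_real (\<alpha> / \<mu>) ^ j *
     (deriv zeta (of_real (1 - \<alpha> - real j)) / zeta (of_real (1 - \<alpha> - real j)))"

text \<open>
  Sign of the second series: with \<open>\<lambda> = \<mu> / \<alpha>\<close>, the residue of
  \<open>- \<zeta>'(s) / \<zeta>(s) * \<lambda>\<^sup>s\<^sup>-\<^sup>1 * \<Gamma>(\<alpha> + s - 1) / \<Gamma>(\<alpha>)\<close> at the Gamma pole \<open>s = 1 - \<alpha> - j\<close> is
  \<open>- \<lambda>\<^sup>-\<^sup>\<alpha> / \<Gamma>(\<alpha>) * (-1)\<^sup>j / j! * \<lambda>\<^sup>-\<^sup>j * \<zeta>'(s) / \<zeta>(s)\<close>, and \<open>R\<close> is subtracted in the explicit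
  formula; hence the series enters \<open>R\<close> with a plus sign.  The source prints a minus sign
  here, with which the explicit formula is false (for \<open>\<alpha> = 5 / 2\<close>, \<open>\<mu> = 5\<close> the left-hand side is
  about 0.870, and the right-hand side about 1.842 with minus and 0.870 with plus).
\<close>

definition R_remainder :: "real \<Rightarrow> real \<Rightarrow> complex" where
  "R_remainder \<mu> \<alpha> = of_real (\<Sum>j. R_falling_term \<mu> \<alpha> (Suc j)) +
     of_real ((\<alpha> / \<mu>) powr \<alpha> / Gamma \<alpha>) * (\<Sum>j. R_zeta_term \<mu> \<alpha> j)"

end

(*
  With lambda = mu / alpha, the weight w(n) is the inverse Mellin transform of the kernel
  lambda^(s-1) Gamma(alpha+s-1) / Gamma(alpha), so the left-hand side is the integral over Re s = 2 of
  -zeta'/zeta times this kernel, and shifting the line of integration to -infinity collects the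
  residues at 1, at the zeros of zeta and at the poles of Gamma.  By Gamma(s+1) = s Gamma(s) the
  kernel decays faster than any power of |s|, uniformly to the left; hence polynomial bounds for
  zeta'/zeta suffice.  They come from Landau's lemma near the critical strip, on horizontal lines
  that avoid the zeros, and from the functional equation further to the left.
*)
theory Submission
  imports Defs "HOL-Real_Asymp.Real_Asymp"
begin

section \<open>Decay of the Gamma function\<close>

text \<open>Since \<open>zeta\<close> is a definite description, its existence has to be established
  too: the trapezoidal rule continues the Dirichlet series to Re s > -1, and a real-variable
  computation on -1 < s < 0 gives the functional equation, hence the rest of the plane. The growth
  bound obtained for zeta is as crude as exp (2 |Im s|). This is harmless, because Landau's lemma
  takes its logarithm: it yields O(T) instead of O(log T) zeros per unit of height, and so O(|s|^2)
  for zeta'/zeta on good horizontals. No integral runs over an infinite line. Every contour is a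
  rectangle, and one residue lemma serves twice, for the Mellin inversion (Gamma poles only) and for
  the explicit formula. As the sum over the zeros converges absolutely, its order need not be tied
  to the heights of the rectangles. That \<alpha> is not a natural number keeps the pole at 1, the
  trivial zeros and the Gamma poles 1 - \<alpha> - j apart; a nontrivial zero at a Gamma pole could
  only lie in (0, 1), where zeta is shown not to vanish.\<close>

lemma Gamma_integral_real':
  assumes "x > (0 :: real)"
  shows "((\<lambda>t. t powr (x - 1) / exp t) has_integral Gamma x) {0<..}"
proof -
  have "((\<lambda>t. complex_of_real t powr (complex_of_real x - 1) / of_real (exp t))
          has_integral of_real (Gamma x)) {0<..}"
    using Gamma_integral_complex'[of "of_real x"] assms by (simp add: Gamma_complex_of_real)
  hence "((\<lambda>t. complex_of_real (t powr (x - 1) / exp t)) has_integral of_real (Gamma x)) {0<..}"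
    by (rule has_integral_eq[rotated]) (simp add: powr_of_real [symmetric])
  from has_integral_linear[OF this bounded_linear_Re] show ?thesis by (simp add: o_def)
qed

lemma norm_Gamma_le_Gamma_Re:
  assumes "Re z > 0"
  shows "norm (Gamma z) \<le> Gamma (Re z)"
proof -
  note I = Gamma_integral_complex'[OF assms] Gamma_integral_real'[OF assms]
  have "norm (integral {0<..} (\<lambda>t. complex_of_real t powr (z - 1) / of_real (exp t)))
          \<le> integral {0<..} (\<lambda>t. t powr (Re z - 1) / exp t)"
  proof (rule integral_norm_bound_integral)
    fix t :: real assume "t \<in> {0<..}"
    thus "norm (complex_of_real t powr (z - 1) / of_real (exp t)) \<le> t powr (Re z - 1) / exp t"
      by (simp add: norm_divide norm_powr_real_powr)
  qed (use I in \<open>blast+\<close>)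
  thus ?thesis using I[THEN integral_unique] by simp
qed

text \<open>The product grows like a factorial, because its factors eventually exceed any constant,
  and so it beats an exponential times a polynomial. Cutting the factors off below at d keeps the
  early ones positive.\<close>

lemma power_times_poly_over_prod_bounded:
  fixes d c L :: real and m :: nat
  assumes "d > 0" "L \<ge> 0"
  shows "\<exists>C. \<forall>M. L ^ M * (1 + real M) ^ m \<le> C * (\<Prod>j=1..M. max d (real j - c))"
proof -
  define D where "D = (\<lambda>M. \<Prod>j=1..M. max d (real j - c))"
  have Dpos: "D M > 0" for M
    unfolding D_def using assms by (intro prod_pos) auto
  define b where "b = (\<lambda>M. L ^ M * (1 + real M) ^ m / D M)"
  have b_nonneg: "b M \<ge> 0" for M
    unfolding b_def using assms Dpos[of M] by auto
  \<comment> \<open>From N on the next factor is at least 2 * L * 2 ^ m, while passing from n to n +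
    1 costs at most L * 2 ^ m; hence ratio 1/2.\<close>
  obtain N :: nat where N: "real N \<ge> max 0 c + 2 * L * 2 ^ m + 1"
    using real_arch_simple by blast
  have "summable b"
  proof (rule summable_ratio_test[of "1/2" N])
    fix n assume n: "n \<ge> N"
    have DS: "D (Suc n) = D n * max d (real (Suc n) - c)"
      unfolding D_def by simp
    have large: "max d (real (Suc n) - c) \<ge> 2 * L * 2 ^ m"
      using N n by auto
    have large0: "max d (real (Suc n) - c) > 0"
      using assms by auto
    have "(1 + real (Suc n)) ^ m \<le> (2 * (1 + real n)) ^ m"
      by (intro power_mono) auto
    also have "\<dots> = 2 ^ m * (1 + real n) ^ m"
      by (simp only: power_mult_distrib)
    finally have p: "(1 + real (Suc n)) ^ m \<le> 2 ^ m * (1 + real n) ^ m" .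
    have "b (Suc n) = L * L ^ n * (1 + real (Suc n)) ^ m / (D n * max d (real (Suc n) - c))"
      by (simp add: b_def DS)
    also have "\<dots> \<le> L * L ^ n * (2 ^ m * (1 + real n) ^ m) / (D n * max d (real (Suc n) - c))"
      using assms Dpos[of n] large0 p by (intro divide_right_mono mult_left_mono) auto
    also have "\<dots> = b n * (L * 2 ^ m / max d (real (Suc n) - c))"
      by (simp add: b_def)
    also have "\<dots> \<le> b n * (1/2)"
      using b_nonneg[of n] large large0 by (intro mult_left_mono) (auto simp: field_simps)
    finally show "norm (b (Suc n)) \<le> 1/2 * norm (b n)"
      using b_nonneg[of n] b_nonneg[of "Suc n"] by simp
  qed auto
  hence "Bseq b"
    by (intro convergent_imp_Bseq summable_LIMSEQ_zero[THEN convergentI])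
  then obtain C where C: "\<And>M. norm (b M) \<le> C"
    by (auto simp: Bseq_def)
  have "L ^ M * (1 + real M) ^ m \<le> C * D M" for M
    using C[of M] b_nonneg[of M] Dpos[of M] by (auto simp: b_def field_simps)
  thus ?thesis by (auto simp: D_def)
qed

text \<open>
  Repeated use of \<open>\<Gamma>(s) = \<Gamma>(s + 1) / s\<close> already yields any power of decay, uniformly down to
  \<open>Re s \<rightarrow> -\<infinity>\<close>; Stirling's formula is not needed.
\<close>
lemma Gamma_decay:
  fixes c d l :: real and m :: nat
  assumes "d > 0"
  obtains C where "C > 0"
    "\<And>s. Re s \<le> c \<Longrightarrow> (\<And>n::nat. norm (s + of_nat n) \<ge> d) \<Longrightarrow>
            norm (Gamma s) * exp (l * Re s) \<le> C / (1 + norm s) ^ m"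
proof -
  define c' where "c' = max c 1"
  have c': "c' \<ge> 1" "c' \<ge> c" by (auto simp: c'_def)
  define d' where "d' = min d 1"
  have d': "d' > 0" "d' \<le> d" "d' \<le> 1" using assms by (auto simp: d'_def)
  have "compact (Gamma ` {c' + real m..c' + real m + 1})"
    using c' by (intro compact_continuous_image continuous_on_Gamma)
                (auto elim!: nonpos_Ints_cases)
  then obtain G where G: "\<And>x. x \<in> {c' + real m..c' + real m + 1} \<Longrightarrow> Gamma x \<le> G"
    using compact_imp_bounded bounded_real by (metis (mono_tags, lifting) abs_le_D1 imageI)
  have "0 < Gamma (c' + real m)" using c' by (intro Gamma_real_pos) auto
  with G[of "c' + real m"] have "G > 0" by auto
  obtain C0 where C0: "\<And>M. exp \<bar>l\<bar> ^ M * (1 + real M) ^ m \<le> C0 * (\<Prod>j=1..M. max d' (real j - (c' + 1)))"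
    using power_times_poly_over_prod_bounded[OF d'(1), of "exp \<bar>l\<bar>" m "c' + 1"] by auto
  have "C0 > 0" using C0[of 0] by auto
  define C where "C = G * C0 * exp (\<bar>l\<bar> * (c' + 1)) * (c' + 3) ^ m"
  have "C > 0" unfolding C_def using \<open>G > 0\<close> \<open>C0 > 0\<close> c' by auto
  show ?thesis
  proof (rule that[OF \<open>C > 0\<close>])
    fix s assume s: "Re s \<le> c" "\<And>n::nat. norm (s + of_nat n) \<ge> d"
    \<comment> \<open>M steps move Re s into [c', c' + 1], and m more into the compact interval
      where G bounds Gamma. The first M factors of the Pochhammer symbol pay for exp (l * Re s) and
      for the powers of |Re s|, the last m for the powers of |Im s|.\<close>
    define M where "M = nat \<lceil>c' - Re s\<rceil>"
    have M: "real M \<ge> c' - Re s" "real M \<le> c' - Re s + 1"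
      using s c' unfolding M_def by linarith+
    have "s \<notin> \<int>\<^sub>\<le>\<^sub>0"
    proof
      assume "s \<in> \<int>\<^sub>\<le>\<^sub>0"
      then obtain n where "s = - of_nat n" by (elim nonpos_Ints_cases')
      thus False using s(2)[of n] assms by auto
    qed
    define w where "w = max 1 \<bar>Im s\<bar>"
    have w: "w \<ge> 1" "w \<ge> \<bar>Im s\<bar>" by (auto simp: w_def)
    have G1: "Gamma s * pochhammer s (M + m) = Gamma (s + of_nat (M + m))"
      using pochhammer_Gamma[OF \<open>s \<notin> \<int>\<^sub>\<le>\<^sub>0\<close>, of "M+m"] Gamma_nonzero[OF \<open>s \<notin> \<int>\<^sub>\<le>\<^sub>0\<close>] by simp
    have "norm (Gamma (s + of_nat (M + m))) \<le> Gamma (Re (s + of_nat (M + m)))"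
      using M c' by (intro norm_Gamma_le_Gamma_Re) auto
    also have "\<dots> \<le> G"
      using M by (intro G) auto
    finally have G2: "norm (Gamma (s + of_nat (M + m))) \<le> G" .
    have P: "pochhammer s (M + m) = pochhammer s M * pochhammer (s + of_nat M) m"
      by (rule pochhammer_product')
    have "(\<Prod>i<m. w) \<le> (\<Prod>i<m. norm (s + of_nat M + of_nat i))"
    proof (rule prod_mono)
      fix i assume "i \<in> {..<m}"
      have "\<bar>Re (s + of_nat M + of_nat i)\<bar> \<ge> 1" using M c' by auto
      hence "norm (s + of_nat M + of_nat i) \<ge> 1"
        using abs_Re_le_cmod order_trans by blast
      moreover have "norm (s + of_nat M + of_nat i) \<ge> \<bar>Im s\<bar>"
        using abs_Im_le_cmod[of "s + of_nat M + of_nat i"] by simp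
      ultimately show "0 \<le> w \<and> w \<le> norm (s + of_nat M + of_nat i)" using w(1) by (auto simp: w_def)
    qed
    hence P1: "w ^ m \<le> norm (pochhammer (s + of_nat M) m)"
      by (simp add: pochhammer_prod prod_norm atLeast0LessThan)
    \<comment> \<open>Since Re s \<le> c' + 1 - M, factor number i has norm at least M - i - (c' +
      1). Where this is useless, the distance of s from the poles supplies d'.\<close>
    have "(\<Prod>j=1..M. max d' (real j - (c' + 1))) = (\<Prod>i<M. max d' (real (M - i) - (c' + 1)))"
      by (rule prod.reindex_bij_witness[of _ "\<lambda>i. M - i" "\<lambda>j. M - j"]) auto
    also have "\<dots> \<le> (\<Prod>i<M. norm (s + of_nat i))"
    proof (rule prod_mono)
      fix i assume i: "i \<in> {..<M}"
      have "\<bar>Re (s + of_nat i)\<bar> \<ge> real (M - i) - (c' + 1)" using M i c' by auto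
      hence "norm (s + of_nat i) \<ge> real (M - i) - (c' + 1)"
        using abs_Re_le_cmod order_trans by blast
      thus "0 \<le> max d' (real (M - i) - (c' + 1)) \<and>
            max d' (real (M - i) - (c' + 1)) \<le> norm (s + of_nat i)"
        using s(2)[of i] d' by auto
    qed
    finally have P2: "(\<Prod>j=1..M. max d' (real j - (c' + 1))) \<le> norm (pochhammer s M)"
      by (simp add: pochhammer_prod prod_norm atLeast0LessThan)
    have "exp (l * Re s) \<le> exp (\<bar>l\<bar> * (c' + 1) + real M * \<bar>l\<bar>)"
    proof -
      have "l * Re s \<le> \<bar>l\<bar> * \<bar>Re s\<bar>" by (metis abs_ge_self abs_mult)
      also have "\<dots> \<le> \<bar>l\<bar> * (c' + 1 + real M)"
        using M s c' by (intro mult_left_mono) auto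
      finally show ?thesis by (simp add: algebra_simps)
    qed
    also have "\<dots> = exp (\<bar>l\<bar> * (c' + 1)) * exp \<bar>l\<bar> ^ M"
      by (simp add: exp_add exp_of_nat_mult)
    finally have E: "exp (l * Re s) \<le> exp (\<bar>l\<bar> * (c' + 1)) * exp \<bar>l\<bar> ^ M" .
    have "1 + norm s \<le> 1 + \<bar>Re s\<bar> + \<bar>Im s\<bar>" using cmod_le[of s] by simp
    also have "\<dots> \<le> (c' + 2 + real M) + w" using M s c' w by auto
    also have "\<dots> \<le> (c' + 2 + real M) * w + w"
      using mult_left_mono[OF w(1), of "c' + 2 + real M"] c' by simp
    also have "\<dots> = (c' + 3 + real M) * w" by (simp add: algebra_simps)
    also have "\<dots> \<le> ((c' + 3) * (1 + real M)) * w"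
      using c' w by (intro mult_right_mono) (auto simp: algebra_simps)
    finally have "(1 + norm s) ^ m \<le> (((c' + 3) * (1 + real M)) * w) ^ m"
      by (intro power_mono) auto
    hence N: "(1 + norm s) ^ m \<le> (c' + 3) ^ m * (1 + real M) ^ m * w ^ m"
      by (simp add: power_mult_distrib)
    define Q where "Q = norm (pochhammer s (M + m))"
    have Qpos: "Q > 0"
    proof -
      have "w ^ m > 0" using w by auto
      moreover have "(\<Prod>j=1..M. max d' (real j - (c' + 1))) > 0"
        using d' by (intro prod_pos) auto
      ultimately show ?thesis using P1 P2 unfolding Q_def P norm_mult
        by (smt (verit) mult_pos_pos)
    qed
    have "exp \<bar>l\<bar> ^ M * (1 + real M) ^ m \<le> C0 * (\<Prod>j=1..M. max d' (real j - (c' + 1)))"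
      by (rule C0)
    also have "\<dots> \<le> C0 * norm (pochhammer s M)"
      using P2 \<open>C0 > 0\<close> by (intro mult_left_mono) auto
    finally have CC: "exp \<bar>l\<bar> ^ M * (1 + real M) ^ m \<le> C0 * norm (pochhammer s M)" .
    have "exp (l * Re s) * (1 + norm s) ^ m \<le>
            (exp (\<bar>l\<bar> * (c' + 1)) * exp \<bar>l\<bar> ^ M) * ((c' + 3) ^ m * (1 + real M) ^ m * w ^ m)"
      using E N by (intro mult_mono) auto
    also have "\<dots> = (exp (\<bar>l\<bar> * (c' + 1)) * (c' + 3) ^ m) * (exp \<bar>l\<bar> ^ M * (1 + real M) ^ m) * w ^ m"
      by (simp add: mult_ac)
    also have "\<dots> \<le> (exp (\<bar>l\<bar> * (c' + 1)) * (c' + 3) ^ m) * (C0 * norm (pochhammer s M)) *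
                      norm (pochhammer (s + of_nat M) m)"
      by (rule mult_mono[OF mult_left_mono[OF CC] P1]) (use c' w \<open>C0 > 0\<close> in auto)
    also have "\<dots> = (exp (\<bar>l\<bar> * (c' + 1)) * (c' + 3) ^ m * C0) * Q"
      unfolding Q_def P norm_mult by (simp add: mult_ac)
    finally have F: "exp (l * Re s) * (1 + norm s) ^ m \<le> (exp (\<bar>l\<bar> * (c' + 1)) * (c' + 3) ^ m * C0) * Q" .
    have "norm (Gamma s) * Q \<le> G"
      using G1 G2 unfolding Q_def by (metis norm_mult)
    have "norm (Gamma s) * (exp (l * Re s) * (1 + norm s) ^ m) \<le>
            norm (Gamma s) * ((exp (\<bar>l\<bar> * (c' + 1)) * (c' + 3) ^ m * C0) * Q)"
      using F by (intro mult_left_mono) auto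
    also have "\<dots> = (exp (\<bar>l\<bar> * (c' + 1)) * (c' + 3) ^ m * C0) * (norm (Gamma s) * Q)"
      by (simp add: mult_ac)
    also have "\<dots> \<le> (exp (\<bar>l\<bar> * (c' + 1)) * (c' + 3) ^ m * C0) * G"
      using \<open>norm (Gamma s) * Q \<le> G\<close> \<open>C0 > 0\<close> c' by (intro mult_left_mono) auto
    also have "\<dots> = C" by (simp add: C_def)
    finally have "norm (Gamma s) * exp (l * Re s) * (1 + norm s) ^ m \<le> C" by (simp add: mult_ac)
    moreover have "(1 + norm s) ^ m > 0"
      by (intro zero_less_power) (smt (verit) norm_ge_zero)
    ultimately show "norm (Gamma s) * exp (l * Re s) \<le> C / (1 + norm s) ^ m"
      by (simp add: pos_le_divide_eq)
  qed
qed

section \<open>Zeros and logarithmic derivatives in a disc\<close>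

text \<open>Away from Z, g is the plain quotient. At a zero in Z that quotient is 0 / 0, so the
  value is taken from the local factorization through \<open>zor_poly\<close>; the two descriptions
  agree on a punctured disc, which makes g holomorphic. The point w0 excludes that f vanishes
  identically.\<close>

lemma holomorphic_factor_finite_zeros:
  assumes "f holomorphic_on S" "open S" "connected S" "finite Z" "Z \<subseteq> S"
    and "w0 \<in> S" "f w0 \<noteq> 0"
  obtains g where "g holomorphic_on S" "\<And>\<rho>. \<rho> \<in> Z \<Longrightarrow> g \<rho> \<noteq> 0"
    "\<And>s. s \<in> S \<Longrightarrow> f s = g s * (\<Prod>\<rho>\<in>Z. (s - \<rho>) ^ nat (zorder f \<rho>))"
proof -
  define g where "g = (\<lambda>s. if s \<in> Z
      then zor_poly f s s / (\<Prod>\<rho>\<in>Z - {s}. (s - \<rho>) ^ nat (zorder f \<rho>))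
      else f s / (\<Prod>\<rho>\<in>Z. (s - \<rho>) ^ nat (zorder f \<rho>)))"
  have loc: "\<exists>e>0. ball a e \<subseteq> S \<and> g holomorphic_on ball a e \<and> g a \<noteq> 0 \<and>
      f a = g a * (\<Prod>\<rho>\<in>Z. (a - \<rho>) ^ nat (zorder f \<rho>))" if "a \<in> Z" for a
  proof -
    have "a \<in> S" using that assms by auto
    from zorder_exist_zero[OF assms(1-3) this] assms(6,7) obtain r where r: "r > 0" "cball a r \<subseteq> S"
      "zor_poly f a holomorphic_on cball a r"
      "\<And>w. w \<in> cball a r \<Longrightarrow> f w = zor_poly f a w * (w - a) ^ nat (zorder f a) \<and> zor_poly f a w \<noteq> 0"
      by blast
    have "open (- (Z - {a}))" using assms by (intro open_Compl finite_imp_closed) auto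
    moreover have "a \<in> - (Z - {a})" by auto
    ultimately obtain e where e: "e > 0" "ball a e \<subseteq> - (Z - {a})"
      by (meson open_contains_ball)
    define d where "d = min e r"
    have d: "d > 0" "ball a d \<subseteq> S" "ball a d \<subseteq> cball a r" "ball a d \<inter> Z \<subseteq> {a}"
      using r e by (auto simp: d_def)
    have eq: "g w = zor_poly f a w / (\<Prod>\<rho>\<in>Z - {a}. (w - \<rho>) ^ nat (zorder f \<rho>))" if "w \<in> ball a d" for w
    proof (cases "w = a")
      case True thus ?thesis using \<open>a \<in> Z\<close> by (simp add: g_def)
    next
      case False
      hence "w \<notin> Z" using that d by auto
      hence "g w = f w / (\<Prod>\<rho>\<in>Z. (w - \<rho>) ^ nat (zorder f \<rho>))" by (simp add: g_def)
      also have "(\<Prod>\<rho>\<in>Z. (w - \<rho>) ^ nat (zorder f \<rho>)) =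
          (w - a) ^ nat (zorder f a) * (\<Prod>\<rho>\<in>Z - {a}. (w - \<rho>) ^ nat (zorder f \<rho>))"
        using \<open>a \<in> Z\<close> assms by (simp add: prod.remove)
      also have "f w = zor_poly f a w * (w - a) ^ nat (zorder f a)"
        using r(4)[of w] that d by blast
      finally show ?thesis using False by (simp add: field_simps)
    qed
    have nz: "(\<Prod>\<rho>\<in>Z - {a}. (w - \<rho>) ^ nat (zorder f \<rho>)) \<noteq> 0" if "w \<in> ball a d" for w
      using that d assms by (subst prod_zero_iff) auto
    have "(\<lambda>w. zor_poly f a w / (\<Prod>\<rho>\<in>Z - {a}. (w - \<rho>) ^ nat (zorder f \<rho>))) holomorphic_on ball a d"
      using nz holomorphic_on_subset[OF r(3) d(3)] by (intro holomorphic_intros) auto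
    hence "g holomorphic_on ball a d"
      using eq by (subst holomorphic_cong[OF refl eq]) auto
    moreover have ga: "g a = zor_poly f a a / (\<Prod>\<rho>\<in>Z - {a}. (a - \<rho>) ^ nat (zorder f \<rho>))"
      using eq[of a] d by auto
    moreover have "zor_poly f a a \<noteq> 0" "f a = zor_poly f a a * 0 ^ nat (zorder f a)"
      using r(4)[of a] r(1) by auto
    moreover have "(\<Prod>\<rho>\<in>Z. (a - \<rho>) ^ nat (zorder f \<rho>)) =
          0 ^ nat (zorder f a) * (\<Prod>\<rho>\<in>Z - {a}. (a - \<rho>) ^ nat (zorder f \<rho>))"
      using \<open>a \<in> Z\<close> assms by (simp add: prod.remove)
    ultimately show ?thesis using d nz[of a]
      by (intro exI[of _ d] conjI) (auto simp: divide_simps)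
  qed
  have "g field_differentiable at s" if "s \<in> S" for s
  proof (cases "s \<in> Z")
    case True
    with loc[OF True] show ?thesis
      by (metis centre_in_ball holomorphic_on_imp_differentiable_at open_ball)
  next
    case False
    have op: "open (S - Z)" using assms by (intro open_Diff finite_imp_closed)
    have "(\<lambda>s. f s / (\<Prod>\<rho>\<in>Z. (s - \<rho>) ^ nat (zorder f \<rho>))) holomorphic_on (S - Z)"
      using assms by (intro holomorphic_intros holomorphic_on_subset[OF assms(1)]) auto
    also have "?this \<longleftrightarrow> g holomorphic_on (S - Z)"
      by (intro holomorphic_cong) (auto simp: g_def)
    finally show ?thesis using op False that
      by (meson DiffI holomorphic_on_imp_differentiable_at)
  qed
  hence "g holomorphic_on S"
    using field_differentiable_at_within holomorphic_on_def by blast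
  moreover have "f s = g s * (\<Prod>\<rho>\<in>Z. (s - \<rho>) ^ nat (zorder f \<rho>))" for s
  proof (cases "s \<in> Z")
    case True thus ?thesis using loc by blast
  next
    case False
    hence "(\<Prod>\<rho>\<in>Z. (s - \<rho>) ^ nat (zorder f \<rho>)) \<noteq> 0"
      using assms by (subst prod_zero_iff) auto
    thus ?thesis using False by (simp add: g_def)
  qed
  ultimately show ?thesis using loc that[of g] by blast
qed

lemma has_field_derivative_prod_powers:
  fixes m :: "complex \<Rightarrow> nat"
  assumes "finite Z" "s \<notin> Z"
  shows "((\<lambda>s. \<Prod>\<rho>\<in>Z. (s - \<rho>) ^ m \<rho>) has_field_derivative
           (\<Prod>\<rho>\<in>Z. (s - \<rho>) ^ m \<rho>) * (\<Sum>\<rho>\<in>Z. of_nat (m \<rho>) / (s - \<rho>))) (at s)"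
  using assms
proof (induction rule: finite_induct)
  case (insert a Z)
  have D: "((\<lambda>s. (s - a) ^ m a) has_field_derivative (s - a) ^ m a * (of_nat (m a) / (s - a))) (at s)"
  proof -
    have "((\<lambda>s. (s - a) ^ m a) has_field_derivative of_nat (m a) * (s - a) ^ (m a - 1)) (at s)"
      by (auto intro!: derivative_eq_intros)
    moreover have "of_nat (m a) * (s - a) ^ (m a - 1) = (s - a) ^ m a * (of_nat (m a) / (s - a))"
      using insert.prems by (cases "m a") auto
    ultimately show ?thesis by simp
  qed
  show ?case
    using insert.hyps insert.prems DERIV_mult[OF D insert.IH]
    by (simp add: algebra_simps)
qed auto

text \<open>Borel-Caratheodory for the derivative. The map w \<mapsto> w / (4 A - w) fixes 0 and
  sends the half-plane Re w \<le> A into the unit disc, so the Schwarz lemma applies to q, and its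
  conclusion is solved for h. Cauchy's inequality then passes to the derivative; the radius r'
  halfway between r and R is what produces the square of R - r.\<close>

lemma norm_deriv_le_of_Re_le:
  assumes h: "h holomorphic_on ball z0 R" and h0: "h z0 = 0"
    and Re: "\<And>z. z \<in> ball z0 R \<Longrightarrow> Re (h z) \<le> A"
    and A: "A > 0" and r: "0 \<le> r" "r < R" and s: "s \<in> cball z0 r"
  shows "norm (deriv h s) \<le> 16 * R / (R - r)\<^sup>2 * A"
proof -
  define r' where "r' = (r + R) / 2"
  have r': "r < r'" "r' < R" "r' > 0" "r' - r = (R - r) / 2" "R - r' = (R - r) / 2"
    using r by (auto simp: r'_def field_simps)
  \<comment> \<open>With the customary 2 A one would only get norm \<le> 1; 4 A yields the strict
    inequality that the Schwarz lemma asks for.\<close>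
  define q where "q = (\<lambda>z. h (z0 + of_real R * z) / (4 * of_real A - h (z0 + of_real R * z)))"
  have inb: "z0 + of_real R * z \<in> ball z0 R" if "norm z < 1" for z
    using that r by (auto simp: dist_norm norm_mult)
  have lt: "norm (h z) < norm (4 * of_real A - h z)" if "z \<in> ball z0 R" for z
  proof -
    have "(4 * A - Re (h z))\<^sup>2 - (Re (h z))\<^sup>2 = 8 * A * (2 * A - Re (h z))"
      by (simp add: power2_eq_square algebra_simps)
    moreover have "8 * A * (2 * A - Re (h z)) > 0"
      using Re[OF that] A by (intro mult_pos_pos) auto
    ultimately have "(Re (h z))\<^sup>2 < (4 * A - Re (h z))\<^sup>2" by linarith
    thus ?thesis by (simp add: cmod_def)
  qed
  have nz: "4 * of_real A - h z \<noteq> 0" if "z \<in> ball z0 R" for z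
    using lt[OF that] norm_ge_zero[of "h z"] by (metis norm_zero not_less)
  have "q holomorphic_on ball 0 1"
  proof -
    have "(\<lambda>z. h (z0 + of_real R * z)) holomorphic_on ball 0 1"
      using inb by (intro holomorphic_on_compose_gen[OF _ h, unfolded o_def] holomorphic_intros) auto
    thus ?thesis unfolding q_def using nz inb by (intro holomorphic_intros) auto
  qed
  moreover have "q 0 = 0" by (simp add: q_def h0)
  moreover have "norm (q z) < 1" if "norm z < 1" for z
    using lt[OF inb[OF that]] nz[OF inb[OF that]] by (simp add: q_def norm_divide divide_simps)
  ultimately have q_le: "norm (q z) \<le> norm z" if "norm z < 1" for z
    using Schwarz_Lemma(1)[of q z] that by blast
  have h_le: "norm (h z) \<le> 8 * R / (R - r) * A" if z: "z \<in> cball z0 r'" for z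
  proof -
    define t where "t = norm (z - z0) / R"
    have t: "t \<le> r' / R" "t < 1" "t \<ge> 0"
      using z r r' by (auto simp: t_def dist_norm norm_minus_commute divide_simps)
    have zb: "z \<in> ball z0 R" using z r' by auto
    have "norm (q ((z - z0) / of_real R)) \<le> norm ((z - z0) / of_real R)"
      using t r by (intro q_le) (simp add: t_def norm_divide)
    hence "norm (h z) / norm (4 * of_real A - h z) \<le> t"
      using r by (simp add: q_def norm_divide t_def)
    hence "norm (h z) \<le> t * norm (4 * of_real A - h z)"
      using nz[OF zb] by (simp add: divide_simps)
    also have "\<dots> \<le> t * (4 * A + norm (h z))"
      using A t norm_triangle_ineq4[of "4 * of_real A" "h z"] by (intro mult_left_mono) (auto simp: norm_mult)
    finally have "norm (h z) * (1 - t) \<le> 4 * A * t" by (simp add: algebra_simps)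
    also have "\<dots> \<le> 4 * A" using t A by simp
    finally have *: "norm (h z) * (1 - t) \<le> 4 * A" .
    have "1 - t \<ge> (R - r) / (2 * R)"
      using t r' r by (auto simp: field_simps)
    hence "norm (h z) * ((R - r) / (2 * R)) \<le> norm (h z) * (1 - t)"
      by (intro mult_left_mono) auto
    with * have "norm (h z) * ((R - r) / (2 * R)) \<le> 4 * A" by linarith
    thus ?thesis using r by (simp add: field_simps)
  qed
  have "norm ((deriv ^^ 1) h s) \<le> fact 1 * (8 * R / (R - r) * A) / (r' - r) ^ 1"
  proof (rule Cauchy_inequality)
    have sub: "cball s (r' - r) \<subseteq> cball z0 r'"
    proof
      fix x assume "x \<in> cball s (r' - r)"
      thus "x \<in> cball z0 r'" using s dist_triangle[of z0 x s] by auto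
    qed
    moreover have "cball z0 r' \<subseteq> ball z0 R" using r' by auto
    ultimately have sub': "cball s (r' - r) \<subseteq> ball z0 R" by blast
    show "h holomorphic_on ball s (r' - r)"
      using sub' by (intro holomorphic_on_subset[OF h]) auto
    show "continuous_on (cball s (r' - r)) h"
      using sub' by (intro holomorphic_on_imp_continuous_on holomorphic_on_subset[OF h])
    show "norm (h x) \<le> 8 * R / (R - r) * A" if "norm (s - x) = r' - r" for x
      using that sub by (intro h_le) (auto simp only: subset_iff mem_cball dist_norm order_refl)
  qed (use r' in auto)
  also have "\<dots> = 16 * R / (R - r)\<^sup>2 * A"
    using r by (simp add: r'(4) power2_eq_square)
  finally show ?thesis by simp
qed

text \<open>
  Landau's lemma: dividing out the zeros in the small disc leaves a function without zeros there
  whose size on the large circle has dropped by a factor \<open>2\<close> per zero.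
\<close>
lemma Landau_log_deriv:
  assumes f: "f holomorphic_on S" and S: "open S" "connected S" and sub: "cball z0 R \<subseteq> S"
    and M: "\<And>z. z \<in> cball z0 R \<Longrightarrow> norm (f z) \<le> M"
    and f0: "f z0 \<noteq> 0" and r1: "r1 > 0" "3 * r1 \<le> R" and r: "0 \<le> r" "r < r1"
  defines "Z \<equiv> {\<rho> \<in> cball z0 r1. f \<rho> = 0}"
  defines "A \<equiv> ln (M / norm (f z0))"
  shows "finite Z"
    and "(\<Sum>\<rho>\<in>Z. real (nat (zorder f \<rho>))) * ln 2 \<le> A"
    and "\<And>s. s \<in> cball z0 r \<Longrightarrow> f s \<noteq> 0 \<Longrightarrow>
           norm (deriv f s / f s - (\<Sum>\<rho>\<in>Z. of_nat (nat (zorder f \<rho>)) / (s - \<rho>)))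
             \<le> 16 * r1 / (r1 - r)\<^sup>2 * (A + 1)"
proof -
  have z0: "z0 \<in> S" using sub r1 by auto
  have R: "R > 0" using r1 by linarith
  have sub1: "cball z0 r1 \<subseteq> S" using sub r1 by (auto simp: subset_iff)
  show fin: "finite Z"
  proof (cases "f constant_on S")
    case True
    hence "f z \<noteq> 0" if "z \<in> S" for z
      using f0 z0 that unfolding constant_on_def by auto
    hence "Z = {}" using sub1 by (auto simp: Z_def)
    thus ?thesis by simp
  next
    case False
    thus ?thesis unfolding Z_def
      by (intro holomorphic_compact_finite_zeros[OF f S _ sub1]) auto
  qed
  have ZS: "Z \<subseteq> S" using sub r1 by (auto simp: Z_def)
  define m where "m = (\<lambda>\<rho>. nat (zorder f \<rho>))"
  obtain g where g: "g holomorphic_on S" "\<And>\<rho>. \<rho> \<in> Z \<Longrightarrow> g \<rho> \<noteq> 0"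
    "\<And>s. s \<in> S \<Longrightarrow> f s = g s * (\<Prod>\<rho>\<in>Z. (s - \<rho>) ^ m \<rho>)"
    using holomorphic_factor_finite_zeros[OF f S fin ZS z0 f0] unfolding m_def by blast
  have z0Z: "z0 \<notin> Z" using f0 by (auto simp: Z_def)
  define c where "c = (\<Prod>\<rho>\<in>Z. (z0 - \<rho>) ^ m \<rho>)"
  have c: "c \<noteq> 0" using z0Z fin by (auto simp: c_def)
  \<comment> \<open>The factor c restores the value at the centre, so that G z0 = f z0.\<close>
  define G where "G = (\<lambda>s. g s * c)"
  have G: "G holomorphic_on S" unfolding G_def by (intro holomorphic_intros g)
  have Gz0: "G z0 = f z0" using g(3)[OF z0] by (simp add: G_def c_def)
  define N where "N = (\<Sum>\<rho>\<in>Z. m \<rho>)"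
  \<comment> \<open>On the circle of radius R \<ge> 3 r1 each zero in Z satisfies |s - \<rho>| \<ge>
    2 r1 \<ge> 2 |z0 - \<rho>|, so every zero, with multiplicity, halves the bound.\<close>
  have Gb: "norm (G s) * 2 ^ N \<le> M" if "dist z0 s = R" for s
  proof -
    have s: "s \<in> cball z0 R" using that by auto
    have "2 ^ N * norm c = (\<Prod>\<rho>\<in>Z. (2 * norm (z0 - \<rho>)) ^ m \<rho>)"
      by (simp add: N_def c_def power_sum prod_norm[symmetric] norm_power power_mult_distrib prod.distrib)
    also have "\<dots> \<le> (\<Prod>\<rho>\<in>Z. norm (s - \<rho>) ^ m \<rho>)"
    proof (rule prod_mono)
      fix \<rho> assume "\<rho> \<in> Z"
      hence "dist z0 \<rho> \<le> r1" by (auto simp: Z_def)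
      moreover have "dist z0 s \<le> dist z0 \<rho> + dist \<rho> s" by (rule dist_triangle)
      ultimately have "2 * norm (z0 - \<rho>) \<le> norm (s - \<rho>)"
        using that r1 by (simp add: dist_norm norm_minus_commute)
      thus "0 \<le> (2 * norm (z0 - \<rho>)) ^ m \<rho> \<and> (2 * norm (z0 - \<rho>)) ^ m \<rho> \<le> norm (s - \<rho>) ^ m \<rho>"
        by (metis norm_ge_zero mult_nonneg_nonneg power_mono zero_le_numeral zero_le_power)
    qed
    also have "\<dots> = norm (\<Prod>\<rho>\<in>Z. (s - \<rho>) ^ m \<rho>)"
      by (simp add: prod_norm[symmetric] norm_power)
    finally have "norm (g s) * (2 ^ N * norm c) \<le> norm (g s) * norm (\<Prod>\<rho>\<in>Z. (s - \<rho>) ^ m \<rho>)"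
      by (intro mult_left_mono) auto
    also have "\<dots> = norm (f s)" using g(3)[of s] s sub by (auto simp: norm_mult)
    also have "\<dots> \<le> M" using M[OF s] .
    finally show ?thesis by (simp add: G_def norm_mult mult_ac)
  qed
  have Gle: "norm (G s) \<le> M / 2 ^ N" if "s \<in> cball z0 R" for s
  proof (rule maximum_modulus_frontier[of G "cball z0 R"])
    show "G holomorphic_on interior (cball z0 R)"
      using sub interior_subset by (intro holomorphic_on_subset[OF G]) auto
    show "continuous_on (closure (cball z0 R)) G"
      using sub by (intro holomorphic_on_imp_continuous_on holomorphic_on_subset[OF G]) auto
    show "norm (G z) \<le> M / 2 ^ N" if "z \<in> frontier (cball z0 R)" for z
    proof -
      have "dist z0 z = R" using that R by simp
      from Gb[OF this] show ?thesis by (simp add: field_simps)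
    qed
  qed (use that in auto)
  have fz0: "norm (f z0) > 0" using f0 by simp
  have Mge: "norm (f z0) * 2 ^ N \<le> M"
    using Gle[of z0] R Gz0 by (simp add: field_simps)
  have Mpos: "M > 0" using fz0 Mge
    by (smt (verit, best) mult_pos_pos zero_less_power)
  have "real N * ln 2 = ln (2 ^ N)" by (simp add: ln_realpow)
  also have "\<dots> \<le> A" unfolding A_def using Mge fz0 Mpos
    by (subst ln_le_cancel_iff) (auto simp: field_simps)
  finally have NA: "real N * ln 2 \<le> A" .
  thus "(\<Sum>\<rho>\<in>Z. real (nat (zorder f \<rho>))) * ln 2 \<le> A" by (simp add: N_def m_def)
  have A0: "A \<ge> 0" using NA order_trans[of 0 "real N * ln 2" A] by simp
  show "norm (deriv f s / f s - (\<Sum>\<rho>\<in>Z. of_nat (nat (zorder f \<rho>)) / (s - \<rho>)))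
             \<le> 16 * r1 / (r1 - r)\<^sup>2 * (A + 1)" if s: "s \<in> cball z0 r" and fs: "f s \<noteq> 0" for s
  proof -
    have subb: "ball z0 r1 \<subseteq> S" using sub r1 by (auto simp: subset_iff)
    have Gnz: "G z \<noteq> 0" if "z \<in> ball z0 r1" for z
    proof (cases "z \<in> Z")
      case True thus ?thesis using g(2) c by (simp add: G_def)
    next
      case False
      hence "f z \<noteq> 0" using that by (auto simp: Z_def)
      thus ?thesis using g(3)[of z] subb that c by (auto simp: G_def)
    qed
    obtain h where h: "h holomorphic_on ball z0 r1" "\<And>z. z \<in> ball z0 r1 \<Longrightarrow> G z = exp (h z)"
      using contractible_imp_holomorphic_log[OF holomorphic_on_subset[OF G subb]
              convex_imp_contractible[OF convex_ball] Gnz] by blast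
    define h1 where "h1 = (\<lambda>z. h z - h z0)"
    have h1: "h1 holomorphic_on ball z0 r1" unfolding h1_def by (intro holomorphic_intros h)
    have sb: "s \<in> ball z0 r1" using s r by auto
    \<comment> \<open>A may be 0, whereas the bound on the real part has to be positive; hence A +
      1.\<close>
    have "norm (deriv h1 s) \<le> 16 * r1 / (r1 - r)\<^sup>2 * (A + 1)"
    proof (rule norm_deriv_le_of_Re_le[OF h1])
      fix z assume z: "z \<in> ball z0 r1"
      have "z \<in> cball z0 R" using z r1 by auto
      have "exp (Re (h1 z)) = norm (exp (h1 z))" by (simp add: norm_exp_eq_Re)
      also have "\<dots> = norm (G z) / norm (G z0)"
        using h(2)[OF z] h(2)[of z0] r1 by (simp add: h1_def exp_diff norm_divide)
      also have "\<dots> \<le> M / norm (f z0)"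
      proof -
        have "norm (G z) \<le> M / 2 ^ N" using Gle[OF \<open>z \<in> cball z0 R\<close>] .
        also have "\<dots> \<le> M / 1" using Mpos by (intro divide_left_mono) auto
        finally show ?thesis using fz0 by (simp add: Gz0 divide_right_mono)
      qed
      also have "\<dots> = exp A" using Mpos fz0 by (simp add: A_def)
      finally show "Re (h1 z) \<le> A + 1" by simp
    qed (use A0 r s in \<open>auto simp: h1_def\<close>)
    moreover have "deriv f s / f s - (\<Sum>\<rho>\<in>Z. of_nat (m \<rho>) / (s - \<rho>)) = deriv h1 s"
    proof -
      have sZ: "s \<notin> Z" using fs by (auto simp: Z_def)
      let ?P = "\<lambda>s. \<Prod>\<rho>\<in>Z. (s - \<rho>) ^ m \<rho>"
      have "(h1 has_field_derivative deriv h1 s) (at s)"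
        using h1 sb by (simp add: holomorphic_derivI)
      hence E1: "((\<lambda>s. exp (h1 s)) has_field_derivative exp (h1 s) * deriv h1 s) (at s)"
        by (auto intro!: derivative_eq_intros)
      have D: "((\<lambda>s. exp (h z0) / c * exp (h1 s) * ?P s) has_field_derivative
               exp (h z0) / c * exp (h1 s) * ?P s * (deriv h1 s + (\<Sum>\<rho>\<in>Z. of_nat (m \<rho>) / (s - \<rho>)))) (at s)"
        using DERIV_mult[OF DERIV_cmult[OF E1, of "exp (h z0) / c"]
                            has_field_derivative_prod_powers[OF fin sZ, of m]]
        by (simp add: algebra_simps add_divide_distrib)
      have ev: "exp (h z0) / c * exp (h1 z) * ?P z = f z" if "z \<in> ball z0 r1" for z
      proof -
        have "exp (h z0) / c * exp (h1 z) * ?P z = exp (h z) / c * ?P z"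
          by (simp add: h1_def exp_diff)
        also have "exp (h z) = g z * c" using h(2)[OF that] by (simp add: G_def)
        also have "g z * c / c * ?P z = f z" using c g(3)[of z] that subb by auto
        finally show ?thesis .
      qed
      have "(f has_field_derivative
               exp (h z0) / c * exp (h1 s) * ?P s * (deriv h1 s + (\<Sum>\<rho>\<in>Z. of_nat (m \<rho>) / (s - \<rho>)))) (at s)"
        by (rule has_field_derivative_transform_within_open[OF D open_ball sb ev])
      hence "(f has_field_derivative
               f s * (deriv h1 s + (\<Sum>\<rho>\<in>Z. of_nat (m \<rho>) / (s - \<rho>)))) (at s)"
        by (simp only: ev[OF sb])
      thus ?thesis using fs by (simp add: DERIV_imp_deriv)
    qed
    ultimately show ?thesis by (simp add: m_def)
  qed
qed

section \<open>Continuation of the zeta function by the trapezoidal rule\<close>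

text \<open>
  The error of the trapezoidal rule for \<open>x\<^sup>-\<^sup>s\<close> on \<open>[n, n + 1]\<close>, integrated by parts twice.  In this form
  it is entire in \<open>s\<close> and so small that summation over \<open>n\<close> continues \<open>\<zeta>\<close> to \<open>Re s > -1\<close>.
\<close>
definition trap_err :: "nat \<Rightarrow> complex \<Rightarrow> complex" where
  "trap_err n s = s * (s + 1) / 2 *
     integral {0..1} (\<lambda>u. of_real (u * (1 - u)) * of_real (real n + u) powr (- s - 2))"

lemma powr_of_real_exp: "x > 0 \<Longrightarrow> complex_of_real x powr s = exp (s * of_real (ln x))"
  by (simp add: powr_def Ln_of_real)

lemma continuous_on_trap_integrand:
  assumes "n > 0"
  shows "continuous_on {0..1} (\<lambda>u. of_real (u * (1 - u)) * complex_of_real (real n + u) powr (- s - 2))"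
proof -
  have "continuous_on {0..1} (\<lambda>u. of_real (u * (1 - u)) * exp ((- s - 2) * complex_of_real (ln (real n + u))))"
    using assms by (intro continuous_intros) auto
  also have "?this \<longleftrightarrow> ?thesis"
    using assms by (intro continuous_on_cong) (auto simp: powr_of_real_exp simp del: of_real_add)
  finally show ?thesis .
qed

text \<open>Differentiation under the integral sign. Writing powr as exp makes the derivative in s
  jointly continuous; n > 0 keeps the logarithm finite at u = 0.\<close>

lemma holomorphic_trap_err:
  assumes "n > 0"
  shows "trap_err n holomorphic_on A"
proof -
  have eq: "integral {0..1} (\<lambda>u. of_real (u * (1 - u)) * complex_of_real (real n + u) powr (- s - 2)) =
        integral (cbox 0 1) (\<lambda>u. of_real (u * (1 - u)) * exp ((- s - 2) * of_real (ln (real n + u))))" for s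
    unfolding cbox_interval using assms
    by (intro integral_cong) (auto simp: powr_of_real_exp simp del: of_real_add)
  have "(\<lambda>s. integral (cbox 0 1) (\<lambda>u. of_real (u * (1 - u)) *
           exp ((- s - 2) * complex_of_real (ln (real n + u))))) holomorphic_on UNIV"
  proof (rule leibniz_rule_holomorphic)
    fix s :: complex and t :: real
    show "((\<lambda>s. of_real (t * (1 - t)) * exp ((- s - 2) * complex_of_real (ln (real n + t))))
            has_field_derivative of_real (t * (1 - t)) *
              (exp ((- s - 2) * of_real (ln (real n + t))) * (- of_real (ln (real n + t))))) (at s within UNIV)"
      by (auto intro!: derivative_eq_intros)
  next
    fix s :: complex
    show "(\<lambda>u. of_real (u * (1 - u)) * exp ((- s - 2) * complex_of_real (ln (real n + u)))) integrable_on cbox 0 1"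
      using assms by (intro integrable_continuous continuous_intros) auto
  next
    show "continuous_on (UNIV \<times> cbox 0 1) (\<lambda>(s, t). of_real (t * (1 - t)) *
              (exp ((- s - 2) * of_real (ln (real n + t))) * (- complex_of_real (ln (real n + t)))))"
      unfolding split_beta using assms by (intro continuous_intros) auto
  qed auto
  hence "trap_err n holomorphic_on UNIV"
    unfolding trap_err_def[abs_def] eq by (intro holomorphic_intros) auto
  thus ?thesis using holomorphic_on_subset by blast
qed

lemma norm_trap_err_le:
  assumes "n > 0" "Re s \<ge> -2"
  shows "norm (trap_err n s) \<le> norm s * norm (s + 1) / 8 * real n powr (- Re s - 2)"
proof -
  have "norm (integral {0..1} (\<lambda>u. of_real (u * (1 - u)) * complex_of_real (real n + u) powr (- s - 2)))
          \<le> integral {0..1} (\<lambda>u::real. real n powr (- Re s - 2) / 4)"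
  proof (rule integral_norm_bound_integral)
    show "(\<lambda>u. of_real (u * (1 - u)) * complex_of_real (real n + u) powr (- s - 2)) integrable_on {0..1}"
      by (intro integrable_continuous_real continuous_on_trap_integrand assms)
    fix u :: real assume u: "u \<in> {0..1}"
    have "norm (of_real (u * (1 - u)) * complex_of_real (real n + u) powr (- s - 2)) =
            \<bar>u * (1 - u)\<bar> * (real n + u) powr (- Re s - 2)"
      using u assms by (subst norm_mult, subst norm_powr_real_powr) (auto simp del: of_real_mult)
    also have "\<dots> = u * (1 - u) * (real n + u) powr (- Re s - 2)"
      using u by (simp add: abs_mult)
    also have "\<dots> \<le> (1/4) * real n powr (- Re s - 2)"
    proof (intro mult_mono)
      have "0 \<le> (u - 1/2)\<^sup>2" by simp
      thus "u * (1 - u) \<le> 1/4" by (simp add: power2_eq_square algebra_simps)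
      show "(real n + u) powr (- Re s - 2) \<le> real n powr (- Re s - 2)"
        using u assms by (intro powr_mono2') auto
    qed auto
    finally show "norm (of_real (u * (1 - u)) * complex_of_real (real n + u) powr (- s - 2))
            \<le> real n powr (- Re s - 2) / 4" by simp
  qed auto
  also have "\<dots> = real n powr (- Re s - 2) / 4" by simp
  finally have "norm (s * (s + 1) / 2) * norm (integral {0..1} (\<lambda>u. of_real (u * (1 - u)) *
          complex_of_real (real n + u) powr (- s - 2))) \<le> norm (s * (s + 1) / 2) * (real n powr (- Re s - 2) / 4)"
    by (rule mult_left_mono) auto
  thus ?thesis unfolding trap_err_def norm_mult[symmetric] by (simp add: norm_mult norm_divide)
qed

lemma trap_err_eq:
  assumes "n > 0" "s \<noteq> 1"
  shows "trap_err n s = (of_nat n powr (- s) + of_nat (Suc n) powr (- s)) / 2 -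
           (of_nat (Suc n) powr (1 - s) - of_nat n powr (1 - s)) / (1 - s)"
proof -
  define f where "f = (\<lambda>u::real. complex_of_real (real n + u) powr (- s))"
  define f1 where "f1 = (\<lambda>u::real. - s * complex_of_real (real n + u) powr (- s - 1))"
  define f2 where "f2 = (\<lambda>u::real. s * (s + 1) * complex_of_real (real n + u) powr (- s - 2))"
  define F where "F = (\<lambda>u::real. complex_of_real (real n + u) powr (1 - s) / (1 - s))"
  have gen: "((\<lambda>u::real. complex_of_real (real n + u) powr w) has_vector_derivative
              (w * complex_of_real (real n + u) powr (w - 1))) (at u within {0..1})" if "u \<in> {0..1}" for u w
  proof -
    have "((\<lambda>z. z powr w) has_field_derivative (w * complex_of_real (real n + u) powr (w - 1)))
            (at (complex_of_real (real n + u)))"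
      using that assms by (intro has_field_derivative_powr) (auto simp: complex_nonpos_Reals_iff)
    moreover have "((\<lambda>u. complex_of_real (real n + u)) has_vector_derivative 1) (at u within {0..1})"
      by (auto intro!: derivative_eq_intros simp: has_vector_derivative_def scaleR_conv_of_real)
    ultimately show ?thesis
      using field_vector_diff_chain_within[of "\<lambda>u. complex_of_real (real n + u)" 1 u "{0..1}"
         "\<lambda>z. z powr w" "w * complex_of_real (real n + u) powr (w - 1)"]
      by (auto simp: o_def intro: has_field_derivative_at_within)
  qed
  have df: "(f has_vector_derivative f1 u) (at u within {0..1})" if "u \<in> {0..1}" for u
    using gen[OF that, of "- s"] by (simp add: f_def f1_def)
  have df1: "(f1 has_vector_derivative f2 u) (at u within {0..1})" if "u \<in> {0..1}" for u
  proof -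
    have "((\<lambda>u. - s * complex_of_real (real n + u) powr (- s - 1)) has_vector_derivative
            (- s * ((- s - 1) * complex_of_real (real n + u) powr (- s - 1 - 1)))) (at u within {0..1})"
      by (intro has_vector_derivative_mult_right gen that)
    moreover have "- s * ((- s - 1) * complex_of_real (real n + u) powr (- s - 1 - 1)) = f2 u"
      by (simp add: f2_def algebra_simps)
    ultimately show ?thesis by (simp add: f1_def)
  qed
  have dF: "(F has_vector_derivative f u) (at u within {0..1})" if "u \<in> {0..1}" for u
  proof -
    have "((\<lambda>u. inverse (1 - s) * complex_of_real (real n + u) powr (1 - s)) has_vector_derivative
            (inverse (1 - s) * ((1 - s) * complex_of_real (real n + u) powr (1 - s - 1)))) (at u within {0..1})"
      by (intro has_vector_derivative_mult_right gen that)
    moreover have "inverse (1 - s) * ((1 - s) * complex_of_real (real n + u) powr (1 - s - 1)) = f u"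
      using assms by (simp add: f_def)
    ultimately show ?thesis by (simp add: F_def divide_inverse mult.commute)
  qed
  \<comment> \<open>This antiderivative carries out both integrations by parts at once. The boundary
    terms with f1 vanish because u * (1 - u) does at both ends.\<close>
  have "((\<lambda>u. of_real (u * (1 - u)) * f2 u) has_integral
           ((of_real (1 * (1 - 1)) * f1 1 + of_real (2 * 1 - 1) * f 1 - 2 * F 1) -
            (of_real (0 * (1 - 0)) * f1 0 + of_real (2 * 0 - 1) * f 0 - 2 * F 0))) {0..1}"
  proof (rule fundamental_theorem_of_calculus)
    fix u :: real assume u: "u \<in> {0..1}"
    have p: "((\<lambda>u. complex_of_real (u * (1 - u))) has_vector_derivative of_real (1 - 2 * u)) (at u within {0..1})"
      by (rule has_vector_derivative_of_real)
         (auto intro!: derivative_eq_intros simp: has_real_derivative_iff_has_vector_derivative[symmetric])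
    have q: "((\<lambda>u. complex_of_real (2 * u - 1)) has_vector_derivative of_real 2) (at u within {0..1})"
      by (rule has_vector_derivative_of_real)
         (auto intro!: derivative_eq_intros simp: has_real_derivative_iff_has_vector_derivative[symmetric])
    have "((\<lambda>u. of_real (u * (1 - u)) * f1 u + of_real (2 * u - 1) * f u - 2 * F u) has_vector_derivative
            ((of_real (u * (1 - u)) * f2 u + of_real (1 - 2 * u) * f1 u) +
             (of_real (2 * u - 1) * f1 u + of_real 2 * f u) - 2 * f u)) (at u within {0..1})"
      by (intro has_vector_derivative_add has_vector_derivative_diff has_vector_derivative_mult
                has_vector_derivative_mult_right p q df[OF u] df1[OF u] dF[OF u])
    thus "((\<lambda>u. of_real (u * (1 - u)) * f1 u + of_real (2 * u - 1) * f u - 2 * F u) has_vector_derivative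
            of_real (u * (1 - u)) * f2 u) (at u within {0..1})"
      by (simp add: algebra_simps)
  qed auto
  hence "integral {0..1} (\<lambda>u. of_real (u * (1 - u)) * f2 u) = f 1 + f 0 - 2 * (F 1 - F 0)"
    by (subst integral_unique) (auto simp: algebra_simps)
  moreover have "(\<lambda>u. of_real (u * (1 - u)) * f2 u) =
      (\<lambda>u. s * (s + 1) * (of_real (u * (1 - u)) * of_real (real n + u) powr (- s - 2)))"
    by (auto simp: f2_def)
  ultimately have "2 * trap_err n s = f 1 + f 0 - 2 * (F 1 - F 0)"
    by (simp add: trap_err_def)
  hence "trap_err n s = (f 1 + f 0 - 2 * (F 1 - F 0)) / 2" by (simp add: field_simps)
  also have "\<dots> = (f 0 + f 1) / 2 - (F 1 - F 0)" by (simp add: field_simps)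
  finally show ?thesis by (simp add: f_def F_def diff_divide_distrib add_ac)
qed

lemma summable_powr_minus:
  assumes "c > 1"
  shows "summable (\<lambda>n. real (Suc n) powr (- c))"
  using assms by (subst summable_Suc_iff) (simp add: summable_real_powr_iff)

section \<open>Summation of the trapezoidal errors\<close>

definition trap_sum :: "complex \<Rightarrow> complex" where
  "trap_sum s = (\<Sum>n. trap_err (Suc n) s)"

lemma norm_trap_err_le':
  assumes "Re s \<ge> c" "c \<ge> -2"
  shows "norm (trap_err (Suc n) s) \<le> norm s * norm (s + 1) / 8 * real (Suc n) powr (- (c + 2))"
proof -
  have "norm (trap_err (Suc n) s) \<le> norm s * norm (s + 1) / 8 * real (Suc n) powr (- Re s - 2)"
    using assms by (intro norm_trap_err_le) auto
  also have "\<dots> \<le> norm s * norm (s + 1) / 8 * real (Suc n) powr (- (c + 2))"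
    using assms by (intro mult_left_mono powr_mono) auto
  finally show ?thesis .
qed

lemma summable_norm_trap_err:
  assumes "Re s > -1"
  shows "summable (\<lambda>n. norm (trap_err (Suc n) s))"
proof (rule summable_comparison_test_ev)
  show "eventually (\<lambda>n. norm (norm (trap_err (Suc n) s)) \<le>
          norm s * norm (s + 1) / 8 * real (Suc n) powr (- (Re s + 2))) sequentially"
    using norm_trap_err_le'[of "Re s" s] assms by (intro always_eventually) auto
  show "summable (\<lambda>n. norm s * norm (s + 1) / 8 * real (Suc n) powr (- (Re s + 2)))"
    using assms by (intro summable_mult summable_powr_minus) auto
qed

lemma norm_trap_sum_le:
  assumes "Re s \<ge> c" "c > -1"
  shows "norm (trap_sum s) \<le> norm s * norm (s + 1) / 8 * (\<Sum>n. real (Suc n) powr (- (c + 2)))"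
proof -
  have "norm (trap_sum s) \<le> (\<Sum>n. norm (trap_err (Suc n) s))"
    unfolding trap_sum_def using assms by (intro summable_norm summable_norm_trap_err) auto
  also have "\<dots> \<le> (\<Sum>n. norm s * norm (s + 1) / 8 * real (Suc n) powr (- (c + 2)))"
    using assms by (intro suminf_le norm_trap_err_le' summable_norm_trap_err summable_mult summable_powr_minus) auto
  also have "\<dots> = norm s * norm (s + 1) / 8 * (\<Sum>n. real (Suc n) powr (- (c + 2)))"
    using assms by (intro suminf_mult summable_powr_minus) auto
  finally show ?thesis .
qed

lemma holomorphic_trap_sum: "trap_sum holomorphic_on {s. Re s > -1}"
proof (rule holomorphic_uniform_sequence)
  show "open {s. Re s > -1}" by (simp add: open_halfspace_Re_gt)
  show "(\<lambda>s. \<Sum>n<N. trap_err (Suc n) s) holomorphic_on {s. Re s > -1}" for N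
    by (intro holomorphic_intros holomorphic_trap_err) auto
next
  fix x assume x: "x \<in> {s. Re s > -1}"
  define d where "d = (Re x + 1) / 2"
  have d: "d > 0" "Re x - d > -1" using x by (auto simp: d_def field_simps)
  have Re: "Re s \<ge> Re x - d" if "s \<in> cball x d" for s
  proof -
    have "\<bar>Re (x - s)\<bar> \<le> d" using that abs_Re_le_cmod[of "x - s"] by (simp add: dist_norm)
    thus ?thesis by simp
  qed
  have "uniform_limit (cball x d) (\<lambda>N s. \<Sum>n<N. trap_err (Suc n) s) trap_sum sequentially"
    unfolding trap_sum_def
  proof (rule Weierstrass_m_test)
    fix n s assume s: "s \<in> cball x d"
    have ns: "norm s \<le> norm x + d" "norm (s + 1) \<le> norm x + d + 1"
    proof -
      show "norm s \<le> norm x + d"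
        using s norm_triangle_ineq2[of s x] by (simp add: dist_norm norm_minus_commute)
      thus "norm (s + 1) \<le> norm x + d + 1" using norm_triangle_ineq[of s 1] by simp
    qed
    have "norm (trap_err (Suc n) s) \<le> norm s * norm (s + 1) / 8 * real (Suc n) powr (- ((Re x - d) + 2))"
      using Re[OF s] d by (intro norm_trap_err_le') auto
    also have "\<dots> \<le> (norm x + d) * (norm x + d + 1) / 8 * real (Suc n) powr (- ((Re x - d) + 2))"
      using ns d by (intro mult_right_mono divide_right_mono mult_mono) auto
    finally show "norm (trap_err (Suc n) s) \<le> (norm x + d) * (norm x + d + 1) / 8 * real (Suc n) powr (- ((Re x - d) + 2))" .
  next
    show "summable (\<lambda>n. (norm x + d) * (norm x + d + 1) / 8 * real (Suc n) powr (- ((Re x - d) + 2)))"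
      using d by (intro summable_mult summable_powr_minus) auto
  qed
  moreover have "cball x d \<subseteq> {s. Re s > -1}" using Re d by force
  ultimately show "\<exists>d>0. cball x d \<subseteq> {s. Re s > -1} \<and>
       uniform_limit (cball x d) (\<lambda>N s. \<Sum>n<N. trap_err (Suc n) s) trap_sum sequentially"
    using d by blast
qed

text \<open>The Euler-Maclaurin formula: summed over n \<ge> 1, the trapezoids give the Dirichlet
  series minus half of its first term, and the integrals add up to 1 / (s - 1).\<close>

definition zeta_right :: "complex \<Rightarrow> complex" where
  "zeta_right s = 1 / (s - 1) + 1 / 2 + trap_sum s"

lemma tendsto_powr_minus_complex:
  assumes "Re w < 0"
  shows "(\<lambda>n. complex_of_nat (Suc n) powr w) \<longlonglongrightarrow> 0"
proof (rule tendsto_norm_zero_cancel)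
  have "(\<lambda>n. real (Suc n) powr Re w) \<longlonglongrightarrow> 0"
    using assms by (intro LIMSEQ_Suc tendsto_neg_powr filterlim_real_sequentially)
  thus "(\<lambda>n. norm (complex_of_nat (Suc n) powr w)) \<longlonglongrightarrow> 0"
    by (simp add: norm_powr_real_powr)
qed

lemma norm_of_nat_powr: "norm (complex_of_nat (Suc n) powr w) = real (Suc n) powr Re w"
  using norm_powr_real_powr[of "complex_of_nat (Suc n)" w] by (simp del: of_nat_Suc)

lemma zeta_right_sums:
  assumes s: "Re s > 1"
  shows "(\<lambda>n. 1 / of_nat (Suc n) powr s) sums zeta_right s"
proof -
  let ?a = "\<lambda>n. complex_of_nat (Suc n) powr (- s)"
  have "s \<noteq> 1" using s by auto
  \<comment> \<open>Telescoping; both boundary terms at N tend to 0 for Re s > 1.\<close>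
  have fin: "(\<Sum>n<N. trap_err (Suc n) s) = (\<Sum>n<N. ?a n) - 1 / 2 + ?a N / 2 -
           (of_nat (Suc N) powr (1 - s) - 1) / (1 - s)" for N
  proof (induction N)
    case (Suc N)
    have "(\<Sum>n<Suc N. trap_err (Suc n) s) = ((\<Sum>n<N. ?a n) - 1 / 2 + ?a N / 2 -
           (of_nat (Suc N) powr (1 - s) - 1) / (1 - s)) + ((?a N + ?a (Suc N)) / 2 -
           (of_nat (Suc (Suc N)) powr (1 - s) - of_nat (Suc N) powr (1 - s)) / (1 - s))"
      using Suc.IH trap_err_eq[of "Suc N" s] \<open>s \<noteq> 1\<close> by (simp only: sum.lessThan_Suc) simp
    also have "\<dots> = ((\<Sum>n<N. ?a n) + ?a N) - 1 / 2 + ?a (Suc N) / 2 -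
           (of_nat (Suc (Suc N)) powr (1 - s) - 1) / (1 - s)"
      by (simp add: add_divide_distrib diff_divide_distrib del: of_nat_Suc)
    finally show ?case by (simp only: sum.lessThan_Suc)
  qed (use \<open>s \<noteq> 1\<close> in auto)
  have "(\<lambda>N. (\<Sum>n<N. trap_err (Suc n) s) + 1 / 2 - ?a N / 2 +
           (of_nat (Suc N) powr (1 - s) - 1) / (1 - s)) \<longlonglongrightarrow> trap_sum s + 1 / 2 - 0 / 2 + (0 - 1) / (1 - s)"
    unfolding trap_sum_def using s summable_norm_cancel[OF summable_norm_trap_err[of s]] \<open>s \<noteq> 1\<close>
    by (intro tendsto_intros summable_LIMSEQ tendsto_powr_minus_complex) auto
  moreover have "trap_sum s + 1 / 2 - 0 / 2 + (0 - 1) / (1 - s) = zeta_right s"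
    using \<open>s \<noteq> 1\<close> by (simp add: zeta_right_def field_simps)
  ultimately have "?a sums zeta_right s"
    unfolding sums_def fin by simp
  thus ?thesis by (simp add: powr_minus inverse_eq_divide)
qed

lemma holomorphic_zeta_right: "zeta_right holomorphic_on {s. Re s > -1} - {1}"
  unfolding zeta_right_def[abs_def]
  by (intro holomorphic_intros holomorphic_on_subset[OF holomorphic_trap_sum]) auto

text \<open>For 0 < \<alpha> < 1 the first Gamma pole 1 - \<alpha> lies in (0, 1), and zeta'/zeta
  has to be regular there. A zero x would force trap_sum x to have norm (1 + x) / (2 (1 - x)), which
  exceeds the available bound x (1 + x) / 8 * pi^2 / 6.\<close>

lemma zeta_right_real_neq_0:
  assumes "0 < x" "x < 1"
  shows "zeta_right (of_real x) \<noteq> 0"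
proof
  assume "zeta_right (of_real x) = 0"
  hence "trap_sum (of_real x) = - (1 / (of_real x - 1) + 1 / 2)"
    by (simp add: zeta_right_def add_eq_0_iff2)
  also have "\<dots> = complex_of_real ((1 + x) / (2 * (1 - x)))"
    using assms by (simp add: field_simps complex_eq_iff)
  finally have eq: "norm (trap_sum (of_real x)) = (1 + x) / (2 * (1 - x))"
    using assms by (simp del: of_real_divide of_real_mult of_real_add)
  have "norm (trap_sum (of_real x)) \<le> norm (complex_of_real x) * norm (complex_of_real x + 1) / 8 *
           (\<Sum>n. real (Suc n) powr (- (0 + 2)))"
    using assms by (intro norm_trap_sum_le) auto
  also have "(\<Sum>n. real (Suc n) powr (- (0 + 2))) = (\<Sum>n. 1 / (real n + 1)\<^sup>2)"
    by (intro suminf_cong) (simp add: powr_minus inverse_eq_divide add_ac)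
  also have "\<dots> = pi\<^sup>2 / 6" using inverse_squares_sums by (simp add: sums_iff add_ac)
  also have "norm (complex_of_real x) * norm (complex_of_real x + 1) = x * (1 + x)"
    using assms by (metis abs_of_pos add.commute add_pos_pos norm_of_real of_real_1 of_real_add zero_less_one)
  also have "x * (1 + x) / 8 * (pi\<^sup>2 / 6) < (1 + x) / (2 * (1 - x))"
  proof -
    have "pi\<^sup>2 \<le> 4\<^sup>2" using pi_less_4 pi_gt_zero by (intro power_mono) auto
    hence "x * (1 + x) / 8 * (pi\<^sup>2 / 6) \<le> x * (1 + x) / 8 * (16 / 6)"
      using assms by (intro mult_left_mono) auto
    also have "\<dots> = (1 + x) * (x / 3)" by simp
    also have "\<dots> < (1 + x) * (1 / 2)"
      using assms by (intro mult_strict_left_mono) auto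
    also have "\<dots> = (1 + x) / 2" by simp
    also have "\<dots> \<le> (1 + x) / (2 * (1 - x))"
      using assms by (intro divide_left_mono) auto
    finally show ?thesis .
  qed
  finally show False using eq by simp
qed

section \<open>The functional equation\<close>

lemma has_integral_substitution_Ioi:
  fixes f g g' :: "real \<Rightarrow> real"
  assumes "(f has_integral I) {0<..}" "\<And>x. x > 0 \<Longrightarrow> f x \<ge> 0"
    and "\<And>x. x > 0 \<Longrightarrow> (g has_real_derivative g' x) (at x)" "\<And>x. x > 0 \<Longrightarrow> g' x \<ge> 0"
    and "bij_betw g {0<..} {0<..}"
  shows "((\<lambda>x. g' x * f (g x)) has_integral I) {0<..}"
proof -
  have img: "g ` {0<..} = {0<..}" "inj_on g {0<..}" using assms(5) by (auto simp: bij_betw_def)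
  have "f absolutely_integrable_on (g ` {0<..})" "integral (g ` {0<..}) f = I"
    unfolding img using assms(1,2)
    by (auto intro!: nonnegative_absolutely_integrable_1 simp: has_integral_iff)
  hence "(\<lambda>x. \<bar>g' x\<bar> * f (g x)) absolutely_integrable_on {0<..} \<and>
           integral {0<..} (\<lambda>x. \<bar>g' x\<bar> * f (g x)) = I"
    using assms(3) img(2)
    by (subst has_absolute_integral_change_of_variables_1')
       (auto intro: has_field_derivative_at_within)
  hence "((\<lambda>x. \<bar>g' x\<bar> * f (g x)) has_integral I) {0<..}"
    by (auto simp: has_integral_iff absolutely_integrable_on_def)
  thus ?thesis by (rule has_integral_eq[rotated]) (use assms(4) in auto)
qed

lemma has_integral_powr_exp:
  assumes "b > 0" "y > (0::real)"
  shows "((\<lambda>x. x powr (b - 1) * exp (- y * x)) has_integral (Gamma b * y powr (- b))) {0<..}"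
proof -
  have "((\<lambda>x. y * ((y * x) powr (b - 1) / exp (y * x))) has_integral Gamma b) {0<..}"
  proof (rule has_integral_substitution_Ioi[OF Gamma_integral_real'[OF assms(1)]])
    show "bij_betw ((*) y) {0<..} {0<..}"
      by (rule bij_betw_byWitness[of _ "\<lambda>x. x / y"]) (use assms in auto)
  qed (use assms in \<open>auto intro!: derivative_eq_intros\<close>)
  hence "((\<lambda>x. y powr (- b) * (y * ((y * x) powr (b - 1) / exp (y * x)))) has_integral
           (y powr (- b) * Gamma b)) {0<..}"
    by (rule has_integral_mult_right)
  moreover have "y powr (- b) * (y * ((y * x) powr (b - 1) / exp (y * x))) =
      x powr (b - 1) * exp (- y * x)" if "x > 0" for x
  proof -
    have "y powr (- b) * (y * y powr (b - 1)) = 1"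
      using assms by (simp add: powr_diff powr_minus field_simps)
    thus ?thesis using that assms
      by (simp add: powr_mult exp_minus field_simps)
  qed
  ultimately show ?thesis
    by (metis (mono_tags, lifting) greaterThan_iff has_integral_eq mult.commute)
qed

lemma has_integral_powr_gauss:
  assumes "c > 0" "t > (0::real)"
  shows "((\<lambda>x. x powr (2 * c - 1) * exp (- t * x\<^sup>2)) has_integral (Gamma c * t powr (- c) / 2)) {0<..}"
proof -
  have "((\<lambda>x. (2 * x) * ((x\<^sup>2) powr (c - 1) * exp (- t * x\<^sup>2))) has_integral (Gamma c * t powr (- c))) {0<..}"
  proof (rule has_integral_substitution_Ioi[OF has_integral_powr_exp[OF assms]])
    show "bij_betw (\<lambda>x::real. x\<^sup>2) {0<..} {0<..}"
      by (rule bij_betw_byWitness[of _ sqrt]) auto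
  qed (auto intro!: derivative_eq_intros)
  hence "((\<lambda>x. 1/2 * ((2 * x) * ((x\<^sup>2) powr (c - 1) * exp (- t * x\<^sup>2)))) has_integral
           (1/2 * (Gamma c * t powr (- c)))) {0<..}"
    by (rule has_integral_mult_right)
  moreover have "1/2 * ((2 * x) * ((x\<^sup>2) powr (c - 1) * exp (- t * x\<^sup>2))) =
      x powr (2 * c - 1) * exp (- t * x\<^sup>2)" if "x > 0" for x :: real
  proof -
    have "(x\<^sup>2) powr (c - 1) = (x powr 2) powr (c - 1)" using that by simp
    also have "\<dots> = x powr (2 * c - 2)" unfolding powr_powr by (simp add: algebra_simps)
    finally have 1: "(x\<^sup>2) powr (c - 1) = x powr (2 * c - 2)" .
    have "x * x powr (2 * c - 2) = x powr 1 * x powr (2 * c - 2)" using that by simp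
    also have "\<dots> = x powr (2 * c - 1)" unfolding powr_add[symmetric] by simp
    finally have 2: "x * x powr (2 * c - 2) = x powr (2 * c - 1)" .
    show ?thesis unfolding 1 2[symmetric] by simp
  qed
  ultimately show ?thesis
    by (subst (asm) has_integral_cong[where g = "\<lambda>x. x powr (2 * c - 1) * exp (- t * x\<^sup>2)"]) auto
qed

lemma nn_integral_Ioi_eq:
  fixes f :: "real \<Rightarrow> real"
  assumes "(f has_integral I) {0<..}" "\<And>x. x > 0 \<Longrightarrow> f x \<ge> 0"
  shows "(\<integral>\<^sup>+x. ennreal (indicator {0<..} x * f x) \<partial>lborel) = ennreal I"
  using nn_integral_has_integral_lebesgue[OF _ assms(1)] assms(2) by simp

lemma Gamma_reflection_real:
  fixes x :: real
  shows "Gamma x * Gamma (1 - x) = pi / sin (pi * x)"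
proof -
  have "complex_of_real (Gamma x * Gamma (1 - x)) = of_real (pi / sin (pi * x))"
    using Gamma_reflection_complex[of "of_real x"]
    by (simp add: Gamma_complex_of_real[symmetric] sin_of_real[symmetric])
  thus ?thesis by (simp only: of_real_eq_iff)
qed

text \<open>Writing 1 / (x^2 + a^2) as the integral of exp (-(x^2 + a^2) t) over t > 0 and applying
  Tonelli's theorem, the x-integral contributes Gamma c and the t-integral Gamma (1 - c), where c =
  (s + 1) / 2; the reflection formula turns their product into the cosine.\<close>

lemma nn_integral_powr_over_sum_squares:
  assumes "-1 < s" "s < 1" "a > (0::real)"
  shows "(\<integral>\<^sup>+x. ennreal (indicator {0<..} x * (x powr s / (x\<^sup>2 + a\<^sup>2))) \<partial>lborel) =
           ennreal (pi / (2 * cos (pi * s / 2)) * a powr (s - 1))"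
proof -
  define c where "c = (s + 1) / 2"
  have c: "0 < c" "c < 1" "2 * c - 1 = s" using assms by (auto simp: c_def field_simps)
  have "(\<integral>\<^sup>+x. ennreal (indicator {0<..} x * (x powr s / (x\<^sup>2 + a\<^sup>2))) \<partial>lborel) =
        (\<integral>\<^sup>+x. (\<integral>\<^sup>+t. ennreal (indicator {0<..} x * x powr s *
            (indicator {0<..} t * exp (- (x\<^sup>2 + a\<^sup>2) * t))) \<partial>lborel) \<partial>lborel)"
  proof (rule nn_integral_cong)
    fix x :: real
    have pos: "x\<^sup>2 + a\<^sup>2 > 0" using assms by (simp add: add_nonneg_pos)
    have "((\<lambda>t. t powr (1 - 1) * exp (- (x\<^sup>2 + a\<^sup>2) * t)) has_integral (Gamma 1 * (x\<^sup>2 + a\<^sup>2) powr (- 1))) {0<..}"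
      using pos by (intro has_integral_powr_exp) auto
    hence "((\<lambda>t. exp (- (x\<^sup>2 + a\<^sup>2) * t)) has_integral (1 / (x\<^sup>2 + a\<^sup>2))) {0<..}"
      using pos by (subst (asm) has_integral_cong[where g = "\<lambda>t. exp (- (x\<^sup>2 + a\<^sup>2) * t)"])
                   (auto simp: powr_minus inverse_eq_divide)
    hence "(\<integral>\<^sup>+t. ennreal (indicator {0<..} t * exp (- (x\<^sup>2 + a\<^sup>2) * t)) \<partial>lborel) = ennreal (1 / (x\<^sup>2 + a\<^sup>2))"
      by (intro nn_integral_Ioi_eq) auto
    hence "ennreal (indicator {0<..} x * x powr s) *
             (\<integral>\<^sup>+t. ennreal (indicator {0<..} t * exp (- (x\<^sup>2 + a\<^sup>2) * t)) \<partial>lborel) =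
           ennreal (indicator {0<..} x * (x powr s / (x\<^sup>2 + a\<^sup>2)))"
      using pos by (simp add: ennreal_mult[symmetric])
    thus "ennreal (indicator {0<..} x * (x powr s / (x\<^sup>2 + a\<^sup>2))) =
            (\<integral>\<^sup>+t. ennreal (indicator {0<..} x * x powr s *
            (indicator {0<..} t * exp (- (x\<^sup>2 + a\<^sup>2) * t))) \<partial>lborel)"
      by (subst (asm) nn_integral_cmult[symmetric]) (auto simp: ennreal_mult[symmetric] mult_ac)
  qed
  also have "\<dots> = (\<integral>\<^sup>+t. (\<integral>\<^sup>+x. ennreal (indicator {0<..} x * x powr s *
            (indicator {0<..} t * exp (- (x\<^sup>2 + a\<^sup>2) * t))) \<partial>lborel) \<partial>lborel)"
    by (rule lborel_pair.Fubini') measurable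
  also have "\<dots> = (\<integral>\<^sup>+t. ennreal (Gamma c / 2) *
      ennreal (indicator {0<..} t * (t powr ((1 - c) - 1) * exp (- (a\<^sup>2) * t))) \<partial>lborel)"
  proof (rule nn_integral_cong)
    fix t :: real
    show "(\<integral>\<^sup>+x. ennreal (indicator {0<..} x * x powr s *
            (indicator {0<..} t * exp (- (x\<^sup>2 + a\<^sup>2) * t))) \<partial>lborel) =
         ennreal (Gamma c / 2) * ennreal (indicator {0<..} t * (t powr ((1 - c) - 1) * exp (- (a\<^sup>2) * t)))"
    proof (cases "t > 0")
      case True
      have "(\<integral>\<^sup>+x. ennreal (indicator {0<..} x * x powr s *
            (indicator {0<..} t * exp (- (x\<^sup>2 + a\<^sup>2) * t))) \<partial>lborel) =
            (\<integral>\<^sup>+x. ennreal (exp (- (a\<^sup>2) * t)) *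
               ennreal (indicator {0<..} x * (x powr (2 * c - 1) * exp (- t * x\<^sup>2))) \<partial>lborel)"
        using True c by (intro nn_integral_cong)
          (auto simp: ennreal_mult[symmetric] exp_add[symmetric] algebra_simps indicator_def)
      also have "\<dots> = ennreal (exp (- (a\<^sup>2) * t)) *
           (\<integral>\<^sup>+x. ennreal (indicator {0<..} x * (x powr (2 * c - 1) * exp (- t * x\<^sup>2))) \<partial>lborel)"
        by (rule nn_integral_cmult) measurable
      also have "(\<integral>\<^sup>+x. ennreal (indicator {0<..} x * (x powr (2 * c - 1) * exp (- t * x\<^sup>2))) \<partial>lborel) =
           ennreal (Gamma c * t powr (- c) / 2)"
        using True c by (intro nn_integral_Ioi_eq has_integral_powr_gauss) auto
      also have "ennreal (exp (- (a\<^sup>2) * t)) * \<dots> =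
           ennreal (Gamma c / 2) * ennreal (indicator {0<..} t * (t powr ((1 - c) - 1) * exp (- (a\<^sup>2) * t)))"
        using True c by (simp add: ennreal_mult[symmetric] mult_ac)
      finally show ?thesis .
    qed auto
  qed
  also have "\<dots> = ennreal (Gamma c / 2) *
      (\<integral>\<^sup>+t. ennreal (indicator {0<..} t * (t powr ((1 - c) - 1) * exp (- (a\<^sup>2) * t))) \<partial>lborel)"
    by (rule nn_integral_cmult) measurable
  also have "(\<integral>\<^sup>+t. ennreal (indicator {0<..} t * (t powr ((1 - c) - 1) * exp (- (a\<^sup>2) * t))) \<partial>lborel) =
       ennreal (Gamma (1 - c) * (a\<^sup>2) powr (- (1 - c)))"
    using c assms by (intro nn_integral_Ioi_eq has_integral_powr_exp) auto
  also have "ennreal (Gamma c / 2) * \<dots> = ennreal (Gamma c * Gamma (1 - c) / 2 * (a\<^sup>2) powr (- (1 - c)))"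
    using c by (simp add: ennreal_mult[symmetric])
  also have "Gamma c * Gamma (1 - c) = pi / cos (pi * s / 2)"
  proof -
    have "sin (pi * c) = cos (pi * s / 2)"
      using sin_cos_eq[of "pi * c"] cos_minus[of "pi * s / 2"] by (simp add: c_def field_simps)
    thus ?thesis by (simp add: Gamma_reflection_real)
  qed
  also have "(a\<^sup>2) powr (- (1 - c)) = a powr (s - 1)"
  proof -
    have "(a\<^sup>2) powr (- (1 - c)) = (a powr 2) powr (- (1 - c))" using assms by simp
    thus ?thesis unfolding powr_powr using c by (simp add: algebra_simps)
  qed
  finally show ?thesis by (simp add: mult_ac)
qed

section \<open>Partial fractions of the hyperbolic cotangent\<close>

text \<open>The quotient on the right is coth (x / 2) / 2. Logarithmic differentiation of Gamma z *
  Gamma (1 - z) = pi / sin (pi z) expresses pi cot (pi z) as a difference of two Digamma values, and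
  the series of Digamma is then the expansion.\<close>

lemma coth_partial_fractions:
  assumes "x > (0::real)"
  shows "(\<lambda>k. 2 * x / (x\<^sup>2 + (2 * pi * real (Suc k))\<^sup>2)) sums
           ((1 + exp (- x)) / (2 * (1 - exp (- x))) - 1 / x)"
proof -
  \<comment> \<open>On the imaginary axis cot becomes coth, and no argument of Gamma meets a pole.
    The factor \<i> / (2 pi) below undoes the rotation.\<close>
  define z :: complex where "z = \<i> * of_real (x / (2 * pi))"
  have z0: "z \<noteq> 0" using assms by (simp add: z_def)
  have Im: "Im z > 0" using assms by (simp add: z_def)
  have nI: "z \<notin> \<int>\<^sub>\<le>\<^sub>0" "1 - z \<notin> \<int>\<^sub>\<le>\<^sub>0" 
    using Im by (auto elim!: nonpos_Ints_cases simp: complex_eq_iff)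
  have nz: "of_nat k + 1 + z \<noteq> 0" "of_nat k + 1 - z \<noteq> 0" for k
    using Im by (auto simp: complex_eq_iff)
  have sinnz: "sin (of_real pi * z) \<noteq> 0"
  proof
    assume "sin (of_real pi * z) = 0"
    hence "Gamma z * Gamma (1 - z) = 0" by (simp add: Gamma_reflection_complex)
    thus False using nI by (simp add: Gamma_eq_zero_iff)
  qed
  have "((\<lambda>w. Gamma w * Gamma (1 - w)) has_field_derivative
          (Gamma z * Gamma (1 - z) * (Digamma z - Digamma (1 - z)))) (at z)"
    using nI by (auto intro!: derivative_eq_intros simp: algebra_simps)
  moreover have "((\<lambda>w. of_real pi / sin (of_real pi * w)) has_field_derivative
          - (of_real pi / sin (of_real pi * z)) * (of_real pi * cos (of_real pi * z) / sin (of_real pi * z))) (at z)"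
    using sinnz by (auto intro!: derivative_eq_intros simp: field_simps power2_eq_square)
  ultimately have "Gamma z * Gamma (1 - z) * (Digamma z - Digamma (1 - z)) =
      - (of_real pi / sin (of_real pi * z)) * (of_real pi * cos (of_real pi * z) / sin (of_real pi * z))"
    unfolding Gamma_reflection_complex by (rule DERIV_unique)
  hence "of_real pi / sin (of_real pi * z) * (Digamma z - Digamma (1 - z)) =
      of_real pi / sin (of_real pi * z) * (- (of_real pi * cos (of_real pi * z) / sin (of_real pi * z)))"
    by (simp only: Gamma_reflection_complex minus_mult_commute)
  hence "Digamma z - Digamma (1 - z) = - (of_real pi * cos (of_real pi * z) / sin (of_real pi * z))"
    using sinnz by (subst (asm) mult_left_cancel) auto
  hence D: "Digamma (1 - z) - Digamma z = of_real pi * cos (of_real pi * z) / sin (of_real pi * z)"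
    by (simp add: algebra_simps)
  have "1 + z \<noteq> 0" "1 - z \<noteq> 0" using nz[of 0] by auto
  from sums_diff[OF summable_sums[OF summable_Digamma[OF this(2)]] summable_sums[OF summable_Digamma[OF this(1)]]]
  have "(\<lambda>k. inverse (1 + z + of_nat k) - inverse (1 - z + of_nat k)) sums (Digamma (1 - z) - Digamma (1 + z))"
    by (simp add: Digamma_def)
  also have "Digamma (1 + z) = Digamma z + 1 / z"
    using Digamma_plus1[OF z0] by (simp add: add_ac)
  finally have "(\<lambda>k. inverse (1 + z + of_nat k) - inverse (1 - z + of_nat k)) sums
      (of_real pi * cos (of_real pi * z) / sin (of_real pi * z) - 1 / z)"
    using D by (simp add: algebra_simps)
  hence "(\<lambda>k. \<i> / (2 * pi) * (inverse (1 + z + of_nat k) - inverse (1 - z + of_nat k))) sums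
      (\<i> / (2 * pi) * (of_real pi * cos (of_real pi * z) / sin (of_real pi * z) - 1 / z))"
    by (rule sums_mult)
  moreover have "\<i> / (2 * pi) * (inverse (1 + z + of_nat k) - inverse (1 - z + of_nat k)) =
      complex_of_real (2 * x / (x\<^sup>2 + (2 * pi * real (Suc k))\<^sup>2))" for k
  proof -
    have "inverse (1 + z + of_nat k) - inverse (1 - z + of_nat k) = -2 * z / ((of_nat k + 1)\<^sup>2 - z\<^sup>2)"
      using nz[of k] by (simp add: field_simps power2_eq_square)
    also have "z\<^sup>2 = - of_real ((x / (2 * pi))\<^sup>2)" by (simp only: z_def power_mult_distrib) simp
    also have "(of_nat k + 1)\<^sup>2 - - complex_of_real ((x / (2 * pi))\<^sup>2) =
        of_real ((x\<^sup>2 + (2 * pi * real (Suc k))\<^sup>2) / (2 * pi)\<^sup>2)"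
      by (simp add: field_simps power2_eq_square)
    finally have 1: "inverse (1 + z + of_nat k) - inverse (1 - z + of_nat k) = -2 * z /
       of_real ((x\<^sup>2 + (2 * pi * real (Suc k))\<^sup>2) / (2 * pi)\<^sup>2)" .
    have 2: "\<i> / (2 * pi) * (-2 * z / of_real (w / (2 * pi)\<^sup>2)) = of_real (2 * x / w)" for w
    proof -
      have "\<i> / (2 * pi) * (-2 * z / of_real (w / (2 * pi)\<^sup>2)) =
          -2 * (\<i> * z) / of_real (2 * pi * (w / (2 * pi)\<^sup>2))" by simp
      also have "\<i> * z = - of_real (x / (2 * pi))" by (simp add: z_def)
      also have "-2 * (- complex_of_real (x / (2 * pi))) / of_real (2 * pi * (w / (2 * pi)\<^sup>2)) =
          of_real (2 * (x / (2 * pi)) / (2 * pi * (w / (2 * pi)\<^sup>2)))" by simp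
      also have "2 * (x / (2 * pi)) / (2 * pi * (w / (2 * pi)\<^sup>2)) = 2 * x / w"
        by (simp add: field_simps power2_eq_square)
      finally show ?thesis .
    qed
    show ?thesis unfolding 1 by (rule 2)
  qed
  moreover have "\<i> / (2 * pi) * (of_real pi * cos (of_real pi * z) / sin (of_real pi * z) - 1 / z) =
      complex_of_real ((1 + exp (- x)) / (2 * (1 - exp (- x))) - 1 / x)"
  proof -
    define e where "e = exp (- x / 2)"
    have e: "e > 0" "e < 1" "exp (- x) = e\<^sup>2" "exp (x / 2) = 1 / e"
      using assms exp_double[of "- x / 2"] by (simp_all add: e_def exp_minus inverse_eq_divide)
    have "exp (\<i> * (of_real pi * z)) = of_real e"
      by (simp add: z_def e_def exp_of_real[symmetric] field_simps)
    moreover have "exp (- (\<i> * (of_real pi * z))) = of_real (1 / e)"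
      unfolding e(4)[symmetric] by (simp add: z_def exp_of_real[symmetric] field_simps)
    ultimately have "cos (of_real pi * z) = (of_real e + 1 / of_real e) / 2"
      "sin (of_real pi * z) = (of_real e - 1 / of_real e) / (2 * \<i>)"
      by (simp_all add: cos_exp_eq sin_exp_eq)
    hence "\<i> / (2 * pi) * (of_real pi * cos (of_real pi * z) / sin (of_real pi * z)) =
      - ((of_real e + 1 / of_real e) / (of_real e - 1 / of_real e)) / 2"
    proof -
      have "\<i> / (2 * pi) * (of_real pi * (P / 2) / (Q / (2 * \<i>))) = - (P / Q) / 2" for P Q :: complex
        by (cases "Q = 0") (simp_all add: field_simps)
      thus ?thesis
        unfolding \<open>cos (of_real pi * z) = _\<close> \<open>sin (of_real pi * z) = _\<close> .
    qed
    also have "\<dots> = complex_of_real (- ((e + 1 / e) / (e - 1 / e)) / 2)" by simp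
    also have "- ((e + 1 / e) / (e - 1 / e)) / 2 = (1 + e\<^sup>2) / (2 * (1 - e\<^sup>2))"
    proof -
      have "e\<^sup>2 < 1" using e by (simp add: power_less_one_iff abs_square_less_1)
      thus ?thesis using e(1) by (simp add: divide_simps power2_eq_square) (simp add: algebra_simps)?
    qed
    finally have "\<i> / (2 * pi) * (of_real pi * cos (of_real pi * z) / sin (of_real pi * z)) =
        complex_of_real ((1 + exp (- x)) / (2 * (1 - exp (- x))))" by (simp add: e(3))
    moreover have "\<i> / (2 * pi) * (1 / z) = of_real (1 / x)"
      using assms by (simp add: z_def field_simps)
    ultimately show ?thesis by (simp add: right_diff_distrib)
  qed
  ultimately have "(\<lambda>k. complex_of_real (2 * x / (x\<^sup>2 + (2 * pi * real (Suc k))\<^sup>2))) sums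
     complex_of_real ((1 + exp (- x)) / (2 * (1 - exp (- x))) - 1 / x)" by simp
  thus ?thesis by (simp only: sums_of_real_iff)
qed

section \<open>The functional equation on the real segment from -1 to 0\<close>

text \<open>The integral inside \<open>trap_err\<close> at a real argument, with b = s + 2. Unlike
  there, the index n = 0 is wanted; its integrand is singular at 0 but integrable for b < 2.\<close>

definition trap_int :: "real \<Rightarrow> nat \<Rightarrow> real" where
  "trap_int b n = integral {0..1} (\<lambda>u. u * (1 - u) * (real n + u) powr (- b))"

lemma has_integral_trap_int:
  assumes "1 < b" "b < (2::real)"
  shows "((\<lambda>u. u * (1 - u) * (real n + u) powr (- b)) has_integral trap_int b n) {0..1}"
    and "n = 0 \<Longrightarrow> trap_int b n = 1 / (2 - b) - 1 / (3 - b)"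
proof -
  have 0: "((\<lambda>u. u * (1 - u) * (real 0 + u) powr (- b)) has_integral (1 / (2 - b) - 1 / (3 - b))) {0..1}"
  proof -
    have "((\<lambda>u. u powr (1 - b) - u powr (2 - b)) has_integral
             (1 powr (1 - b + 1) / (1 - b + 1) - 1 powr (2 - b + 1) / (2 - b + 1))) {0..1}"
      using assms by (intro has_integral_diff has_integral_powr_from_0) auto
    hence "((\<lambda>u. u powr (1 - b) - u powr (2 - b)) has_integral (1 / (2 - b) - 1 / (3 - b))) {0..1}"
      by simp
    moreover have "u powr (1 - b) - u powr (2 - b) = u * (1 - u) * (real 0 + u) powr (- b)" if "u \<in> {0..1}" for u
    proof (cases "u = 0")
      case False
      hence u: "u > 0" using that by auto
      have "u powr (1 + (- b)) = u * u powr (- b)" "u powr (2 + (- b)) = u\<^sup>2 * u powr (- b)"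
        using u by (simp_all only: powr_add) simp_all
      thus ?thesis by (simp add: algebra_simps power2_eq_square)
    qed auto
    ultimately show ?thesis by (rule has_integral_eq[rotated])
  qed
  show "((\<lambda>u. u * (1 - u) * (real n + u) powr (- b)) has_integral trap_int b n) {0..1}"
  proof (cases "n = 0")
    case True
    thus ?thesis using 0 by (auto simp: trap_int_def has_integral_iff)
  next
    case False
    thus ?thesis unfolding trap_int_def
      by (intro integrable_integral integrable_continuous_real continuous_intros) auto
  qed
  show "n = 0 \<Longrightarrow> trap_int b n = 1 / (2 - b) - 1 / (3 - b)"
    using 0 by (auto simp: trap_int_def has_integral_iff)
qed

lemma trap_int_nonneg:
  assumes "1 < b" "b < (2::real)"
  shows "trap_int b n \<ge> 0"
  by (rule has_integral_nonneg[OF has_integral_trap_int(1)[OF assms]]) auto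

lemma trap_err_real:
  assumes "n > 0"
  shows "trap_err n (of_real s) = of_real (s * (s + 1) / 2 * trap_int (s + 2) n)"
proof -
  have "integral {0..1} (\<lambda>u. complex_of_real (u * (1 - u)) * of_real (real n + u) powr (- of_real s - 2)) =
        integral {0..1} (\<lambda>u. complex_of_real (u * (1 - u) * (real n + u) powr (- (s + 2))))"
  proof (intro integral_cong)
    fix u :: real assume "u \<in> {0..1}"
    moreover have "- complex_of_real s - 2 = of_real (- (s + 2))" by simp
    ultimately show "complex_of_real (u * (1 - u)) * of_real (real n + u) powr (- of_real s - 2) =
        complex_of_real (u * (1 - u) * (real n + u) powr (- (s + 2)))"
      using assms by (simp only: of_real_mult) (subst powr_of_real, auto)
  qed
  also have "\<dots> = of_real (trap_int (s + 2) n)"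
  proof -
    have "(\<lambda>u. u * (1 - u) * (real n + u) powr (- (s + 2))) integrable_on {0..1}"
      using assms by (intro integrable_continuous_real continuous_intros) auto
    from integral_linear[OF this bounded_linear_of_real[where 'a = complex]]
    show ?thesis by (simp add: o_def trap_int_def)
  qed
  finally show ?thesis by (simp add: trap_err_def)
qed

text \<open>For -1 < s < 0 the integral with n = 0 exists, and s (s + 1) / 2 times it is exactly 1 /
  (s - 1) + 1 / 2. The polar part of \<open>zeta_right\<close> is thus absorbed as the zeroth term,
  and a series of terms of one sign remains.\<close>

lemma zeta_right_eq_trap_int:
  assumes "-1 < s" "s < (0::real)"
  shows "summable (trap_int (s + 2))"
    and "zeta_right (of_real s) = of_real (s * (s + 1) / 2 * (\<Sum>n. trap_int (s + 2) n))"
proof -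
  have nz: "s * (s + 1) / 2 \<noteq> 0" using assms by auto
  have "summable (\<lambda>n. trap_err (Suc n) (of_real s))"
    using assms by (intro summable_norm_cancel[OF summable_norm_trap_err]) auto
  hence 1: "(\<lambda>n. complex_of_real (s * (s + 1) / 2 * trap_int (s + 2) (Suc n))) sums trap_sum (of_real s)"
    unfolding trap_sum_def by (subst (asm) trap_err_real, simp, subst trap_err_real) (auto intro: summable_sums)
  hence "summable (\<lambda>n. s * (s + 1) / 2 * trap_int (s + 2) (Suc n))"
    using summable_complex_of_real sums_summable by blast
  hence "summable (\<lambda>n. trap_int (s + 2) (Suc n))"
    using nz by (subst (asm) summable_cmult_iff) auto
  thus S: "summable (trap_int (s + 2))" by (simp only: summable_Suc_iff)
  have "trap_sum (of_real s) = of_real (s * (s + 1) / 2 * (\<Sum>n. trap_int (s + 2) (Suc n)))"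
  proof -
    have "(\<lambda>n. s * (s + 1) / 2 * trap_int (s + 2) (Suc n)) sums
            (s * (s + 1) / 2 * (\<Sum>n. trap_int (s + 2) (Suc n)))"
      using \<open>summable (\<lambda>n. trap_int (s + 2) (Suc n))\<close> by (intro sums_mult summable_sums)
    hence "(\<lambda>n. complex_of_real (s * (s + 1) / 2 * trap_int (s + 2) (Suc n))) sums
            of_real (s * (s + 1) / 2 * (\<Sum>n. trap_int (s + 2) (Suc n)))"
      by (rule sums_of_real)
    with 1 show ?thesis by (rule sums_unique2)
  qed
  also have "(\<Sum>n. trap_int (s + 2) (Suc n)) = (\<Sum>n. trap_int (s + 2) n) - trap_int (s + 2) 0"
    using S by (rule suminf_minus_initial_segment[of _ 1, simplified] suminf_split_head)
  also have "trap_int (s + 2) 0 = 1 / (- s) - 1 / (1 - s)"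
    using has_integral_trap_int(2)[of "s + 2" 0] assms by simp
  finally have "zeta_right (of_real s) = of_real (1 / (s - 1) + 1 / 2 +
     s * (s + 1) / 2 * ((\<Sum>n. trap_int (s + 2) n) - (1 / (- s) - 1 / (1 - s))))"
    by (simp add: zeta_right_def)
  also have "1 / (s - 1) + 1 / 2 + s * (s + 1) / 2 * ((\<Sum>n. trap_int (s + 2) n) - (1 / (- s) - 1 / (1 - s)))
     = s * (s + 1) / 2 * (\<Sum>n. trap_int (s + 2) n)"
    using assms by (simp add: divide_simps) (simp add: algebra_simps)?
  finally show "zeta_right (of_real s) = of_real (s * (s + 1) / 2 * (\<Sum>n. trap_int (s + 2) n))" .
qed

lemma integral_parabola_exp:
  assumes "x > (0::real)"
  shows "((\<lambda>u. u * (1 - u) * exp (- u * x)) has_integral ((exp (- x) + 1 - 2 * (1 - exp (- x)) / x) / x\<^sup>2)) {0..1}"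
proof -
  define F where "F = (\<lambda>u. - (u * (1 - u) / x + (1 - 2 * u) / x\<^sup>2 - 2 / x ^ 3) * exp (- u * x))"
  have "((\<lambda>u. u * (1 - u) * exp (- u * x)) has_integral (F 1 - F 0)) {0..1}"
  proof (rule fundamental_theorem_of_calculus)
    fix u :: real
    show "(F has_vector_derivative u * (1 - u) * exp (- u * x)) (at u within {0..1})"
      unfolding F_def has_real_derivative_iff_has_vector_derivative[symmetric] using assms
      by (auto intro!: derivative_eq_intros simp: field_simps power2_eq_square power3_eq_cube)
  qed auto
  moreover have "F 1 - F 0 = (exp (- x) + 1 - 2 * (1 - exp (- x)) / x) / x\<^sup>2"
    using assms by (simp add: F_def field_simps power2_eq_square power3_eq_cube)
  ultimately show ?thesis by simp
qed

lemma ennreal_suminf_eq: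
  assumes "f sums (S::real)" "\<And>n. f n \<ge> 0"
  shows "(\<Sum>n. ennreal (f n)) = ennreal S"
  using assms suminf_ennreal_eq by blast

text \<open>
  For \<open>-1 < s < 0\<close> all terms are positive and Tonelli's theorem applies: \<open>\<Gamma>(s) \<zeta>(s)\<close> is the Mellin
  transform of \<open>coth (x / 2) / 2 - 1 / x\<close>, and integrating the partial fraction expansion of the
  latter term by term produces \<open>\<zeta>(1 - s)\<close>.
\<close>
lemma Gamma_times_trap_int:
  assumes "-1 < s" "s < (0::real)"
  shows "(\<Sum>n. ennreal (Gamma (s + 2) * trap_int (s + 2) n)) =
     (\<integral>\<^sup>+x. ennreal (indicator {0<..} x * (2 * x powr (s - 1) *
         ((1 + exp (- x)) / (2 * (1 - exp (- x))) - 1 / x))) \<partial>lborel)"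
proof -
  define b where "b = s + 2"
  have b: "1 < b" "b < 2" using assms by (auto simp: b_def)
  have Gb: "Gamma b > 0" using b by (intro Gamma_real_pos) auto
  have 1: "ennreal (Gamma b * trap_int b n) =
    (\<integral>\<^sup>+x. (\<integral>\<^sup>+u. ennreal (indicator {0..1} u * (u * (1 - u)) *
         (indicator {0<..} x * (x powr (b - 1) * exp (- (real n + u) * x)))) \<partial>lborel) \<partial>lborel)" for n
  proof -
    have "ennreal (Gamma b * trap_int b n) = ennreal (Gamma b) * ennreal (trap_int b n)"
      using Gb by (simp add: ennreal_mult')
    also have "ennreal (trap_int b n) =
        (\<integral>\<^sup>+u. ennreal (indicator {0..1} u * (u * (1 - u) * (real n + u) powr (- b))) \<partial>lborel)"
      by (rule nn_integral_has_integral_lebesgue[symmetric, OF _ has_integral_trap_int(1)[OF b]]) auto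
    also have "ennreal (Gamma b) * \<dots> =
        (\<integral>\<^sup>+u. ennreal (Gamma b) * ennreal (indicator {0..1} u * (u * (1 - u) * (real n + u) powr (- b))) \<partial>lborel)"
      by (rule nn_integral_cmult[symmetric]) measurable
    also have "\<dots> = (\<integral>\<^sup>+u. (\<integral>\<^sup>+x. ennreal (indicator {0..1} u * (u * (1 - u)) *
         (indicator {0<..} x * (x powr (b - 1) * exp (- (real n + u) * x)))) \<partial>lborel) \<partial>lborel)"
    proof (rule nn_integral_cong)
      fix u :: real
      show "ennreal (Gamma b) * ennreal (indicator {0..1} u * (u * (1 - u) * (real n + u) powr (- b))) =
         (\<integral>\<^sup>+x. ennreal (indicator {0..1} u * (u * (1 - u)) *
         (indicator {0<..} x * (x powr (b - 1) * exp (- (real n + u) * x)))) \<partial>lborel)"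
      \<comment> \<open>For n = 0 and u = 0 the integral of x powr (b - 1) diverges; the factor u *
        (1 - u) makes the integrand 0 in that case.\<close>
      proof (cases "u \<in> {0<..1}")
        case True
        have "(\<integral>\<^sup>+x. ennreal (indicator {0<..} x * (x powr (b - 1) * exp (- (real n + u) * x))) \<partial>lborel)
            = ennreal (Gamma b * (real n + u) powr (- b))"
          using True b by (intro nn_integral_Ioi_eq has_integral_powr_exp) auto
        hence "ennreal (u * (1 - u)) * (\<integral>\<^sup>+x. ennreal (indicator {0<..} x * (x powr (b - 1) * exp (- (real n + u) * x))) \<partial>lborel)
            = ennreal (u * (1 - u)) * ennreal (Gamma b * (real n + u) powr (- b))" by simp
        also have "ennreal (u * (1 - u)) * (\<integral>\<^sup>+x. ennreal (indicator {0<..} x * (x powr (b - 1) * exp (- (real n + u) * x))) \<partial>lborel)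
            = (\<integral>\<^sup>+x. ennreal (u * (1 - u)) * ennreal (indicator {0<..} x * (x powr (b - 1) * exp (- (real n + u) * x))) \<partial>lborel)"
          by (rule nn_integral_cmult[symmetric]) measurable
        finally show ?thesis using True Gb
          by (simp add: ennreal_mult[symmetric] mult_ac)
      next
        case False
        hence h: "indicator {0..1} u * (u * (1 - u)) = 0" by (auto simp: indicator_def)
        moreover have "indicator {0..1} u * (u * (1 - u) * p) = 0" for p
          using h by auto
        ultimately show ?thesis by (simp only: mult_zero_left ennreal_0 mult_zero_right nn_integral_const)
      qed
    qed
    also have "\<dots> = (\<integral>\<^sup>+x. (\<integral>\<^sup>+u. ennreal (indicator {0..1} u * (u * (1 - u)) *
         (indicator {0<..} x * (x powr (b - 1) * exp (- (real n + u) * x)))) \<partial>lborel) \<partial>lborel)"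
      by (rule lborel_pair.Fubini') measurable
    finally show ?thesis .
  qed
  have "(\<Sum>n. ennreal (Gamma b * trap_int b n)) =
    (\<integral>\<^sup>+x. (\<Sum>n. \<integral>\<^sup>+u. ennreal (indicator {0..1} u * (u * (1 - u)) *
         (indicator {0<..} x * (x powr (b - 1) * exp (- (real n + u) * x)))) \<partial>lborel) \<partial>lborel)"
    unfolding 1 by (rule nn_integral_suminf[symmetric]) measurable
  also have "\<dots> = (\<integral>\<^sup>+x. ennreal (indicator {0<..} x * (2 * x powr (s - 1) *
         ((1 + exp (- x)) / (2 * (1 - exp (- x))) - 1 / x))) \<partial>lborel)"
  proof (rule nn_integral_cong)
    fix x :: real
    show "(\<Sum>n. \<integral>\<^sup>+u. ennreal (indicator {0..1} u * (u * (1 - u)) *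
         (indicator {0<..} x * (x powr (b - 1) * exp (- (real n + u) * x)))) \<partial>lborel) =
       ennreal (indicator {0<..} x * (2 * x powr (s - 1) * ((1 + exp (- x)) / (2 * (1 - exp (- x))) - 1 / x)))"
    proof (cases "x > 0")
      case True
      define K where "K = (exp (- x) + 1 - 2 * (1 - exp (- x)) / x) / x\<^sup>2"
      have K: "(\<integral>\<^sup>+u. ennreal (indicator {0..1} u * (u * (1 - u) * exp (- u * x))) \<partial>lborel) = ennreal K"
        unfolding K_def
        by (rule nn_integral_has_integral_lebesgue[OF _ integral_parabola_exp[OF True]]) auto
      have K0: "K \<ge> 0" unfolding K_def
        by (rule has_integral_nonneg[OF integral_parabola_exp[OF True]]) auto
      have "(\<integral>\<^sup>+u. ennreal (indicator {0..1} u * (u * (1 - u)) *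
         (indicator {0<..} x * (x powr (b - 1) * exp (- (real n + u) * x)))) \<partial>lborel) =
         ennreal (x powr (b - 1) * K * exp (- x) ^ n)" for n
      proof -
        have "(\<integral>\<^sup>+u. ennreal (indicator {0..1} u * (u * (1 - u)) *
         (indicator {0<..} x * (x powr (b - 1) * exp (- (real n + u) * x)))) \<partial>lborel) =
         (\<integral>\<^sup>+u. ennreal (x powr (b - 1) * exp (- x) ^ n) *
            ennreal (indicator {0..1} u * (u * (1 - u) * exp (- u * x))) \<partial>lborel)"
        proof (rule nn_integral_cong)
          fix u :: real
          have "exp (- (real n + u) * x) = exp (- x) ^ n * exp (- u * x)"
            by (simp add: exp_of_nat_mult[symmetric] exp_add[symmetric] algebra_simps)
          thus "ennreal (indicator {0..1} u * (u * (1 - u)) *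
              (indicator {0<..} x * (x powr (b - 1) * exp (- (real n + u) * x)))) =
            ennreal (x powr (b - 1) * exp (- x) ^ n) *
              ennreal (indicator {0..1} u * (u * (1 - u) * exp (- u * x)))"
            using True by (subst ennreal_mult'[symmetric]) (simp_all add: mult_ac)
        qed
        also have "\<dots> = ennreal (x powr (b - 1) * exp (- x) ^ n) * ennreal K"
          unfolding K[symmetric] by (rule nn_integral_cmult) measurable
        also have "\<dots> = ennreal (x powr (b - 1) * K * exp (- x) ^ n)"
          using K0 by (simp add: ennreal_mult[symmetric] mult_ac)
        finally show ?thesis .
      qed
      \<comment> \<open>The dependence on n has been isolated in exp (- x) ^ n. The geometric factor
        1 / (1 - exp (- x)) turns K, the Laplace transform of the parabola, into the coth
        kernel.\<close>
      moreover have "(\<Sum>n. ennreal (x powr (b - 1) * K * exp (- x) ^ n)) =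
           ennreal (x powr (b - 1) * K * (1 / (1 - exp (- x))))"
        using True K0 by (intro ennreal_suminf_eq sums_mult geometric_sums) auto
      moreover have "x powr (b - 1) * K * (1 / (1 - exp (- x))) =
          2 * x powr (s - 1) * ((1 + exp (- x)) / (2 * (1 - exp (- x))) - 1 / x)"
      proof -
        have "x powr (b - 1) = x powr (s - 1) * x\<^sup>2"
        proof -
          have "x powr (b - 1) = x powr ((s - 1) + 2)" by (simp add: b_def)
          thus ?thesis using True by (simp only: powr_add) simp
        qed
        moreover have "exp (- x) < 1" using True by simp
        ultimately show ?thesis using True unfolding K_def by (simp add: field_simps)
      qed
      ultimately show ?thesis using True by simp
    qed auto
  qed
  finally show ?thesis by (simp add: b_def)
qed

lemma cos_pi_half_pos:
  assumes "-1 < s" "s < (0::real)"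
  shows "cos (pi * s / 2) > 0"
proof (rule cos_gt_zero_pi)
  have "pi * (-1) < pi * s" using assms pi_gt_zero by (intro mult_strict_left_mono) auto
  thus "- (pi / 2) < pi * s / 2" by simp
  have "pi * s < pi * 1" using assms pi_gt_zero by (intro mult_strict_left_mono) auto
  thus "pi * s / 2 < pi / 2" by simp
qed

text \<open>The second evaluation of the same Mellin integral. The work is done in
  \<open>ennreal\<close>, where sums and integrals of nonnegative terms may be exchanged freely;
  nonnegativity of both sides then brings the equation back to the reals.\<close>

lemma sum_trap_int:
  assumes "-1 < s" "s < (0::real)"
  shows "Gamma (s + 2) * (\<Sum>n. trap_int (s + 2) n) =
     (2 * pi) powr s / cos (pi * s / 2) * (\<Sum>k. real (Suc k) powr (s - 1))"
proof -
  have b: "1 < s + 2" "s + 2 < 2" using assms by auto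
  have Gb: "Gamma (s + 2) > 0" using assms by (intro Gamma_real_pos) auto
  have cos: "cos (pi * s / 2) > 0"
    using assms by (rule cos_pi_half_pos)
  have summ: "summable (\<lambda>k. real (Suc k) powr (s - 1))"
    using summable_powr_minus[of "1 - s"] assms by simp
  have "ennreal (Gamma (s + 2) * (\<Sum>n. trap_int (s + 2) n)) = (\<Sum>n. ennreal (Gamma (s + 2) * trap_int (s + 2) n))"
    using zeta_right_eq_trap_int(1)[OF assms] Gb trap_int_nonneg[OF b]
    by (intro ennreal_suminf_eq[symmetric] sums_mult summable_sums) auto
  also have "\<dots> = (\<integral>\<^sup>+x. (\<Sum>k. ennreal (indicator {0<..} x * (4 * (x powr s / (x\<^sup>2 + (2 * pi * real (Suc k))\<^sup>2))))) \<partial>lborel)"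
    unfolding Gamma_times_trap_int[OF assms]
  proof (rule nn_integral_cong)
    fix x :: real
    show "ennreal (indicator {0<..} x * (2 * x powr (s - 1) *
         ((1 + exp (- x)) / (2 * (1 - exp (- x))) - 1 / x))) =
       (\<Sum>k. ennreal (indicator {0<..} x * (4 * (x powr s / (x\<^sup>2 + (2 * pi * real (Suc k))\<^sup>2)))))"
    proof (cases "x > 0")
      case True
      have "(\<lambda>k. 2 * x powr (s - 1) * (2 * x / (x\<^sup>2 + (2 * pi * real (Suc k))\<^sup>2))) sums
              (2 * x powr (s - 1) * ((1 + exp (- x)) / (2 * (1 - exp (- x))) - 1 / x))"
        by (intro sums_mult coth_partial_fractions True)
      moreover have "2 * x powr (s - 1) * (2 * x / (x\<^sup>2 + (2 * pi * real (Suc k))\<^sup>2)) =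
          4 * (x powr s / (x\<^sup>2 + (2 * pi * real (Suc k))\<^sup>2))" for k
        using True by (simp add: powr_diff)
      ultimately have S: "(\<lambda>k. 4 * (x powr s / (x\<^sup>2 + (2 * pi * real (Suc k))\<^sup>2))) sums
              (2 * x powr (s - 1) * ((1 + exp (- x)) / (2 * (1 - exp (- x))) - 1 / x))" by (simp only:)
      have nn: "4 * (x powr s / (x\<^sup>2 + (2 * pi * real (Suc k))\<^sup>2)) \<ge> 0" for k
        by (intro mult_nonneg_nonneg divide_nonneg_nonneg add_nonneg_nonneg) auto
      have i: "indicator {0<..} x = (1::real)" using True by simp
      show ?thesis by (simp only: i mult_1_left ennreal_suminf_eq[OF S nn])
    qed auto
  qed
  also have "\<dots> = (\<Sum>k. \<integral>\<^sup>+x. ennreal (indicator {0<..} x * (4 * (x powr s / (x\<^sup>2 + (2 * pi * real (Suc k))\<^sup>2)))) \<partial>lborel)"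
    by (rule nn_integral_suminf) measurable
  also have "\<dots> = (\<Sum>k. ennreal ((2 * pi) powr s / cos (pi * s / 2) * real (Suc k) powr (s - 1)))"
  proof (rule suminf_cong)
    fix k
    have "(\<integral>\<^sup>+x. ennreal (indicator {0<..} x * (4 * (x powr s / (x\<^sup>2 + (2 * pi * real (Suc k))\<^sup>2)))) \<partial>lborel) =
       (\<integral>\<^sup>+x. ennreal 4 * ennreal (indicator {0<..} x * (x powr s / (x\<^sup>2 + (2 * pi * real (Suc k))\<^sup>2))) \<partial>lborel)"
      by (intro nn_integral_cong) (auto simp: ennreal_mult'[symmetric] indicator_def simp del: ennreal_numeral)
    also have "\<dots> = ennreal 4 * (\<integral>\<^sup>+x. ennreal (indicator {0<..} x * (x powr s / (x\<^sup>2 + (2 * pi * real (Suc k))\<^sup>2))) \<partial>lborel)"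
      by (rule nn_integral_cmult) measurable
    also have "\<dots> = ennreal 4 * ennreal (pi / (2 * cos (pi * s / 2)) * (2 * pi * real (Suc k)) powr (s - 1))"
      using assms by (subst nn_integral_powr_over_sum_squares) auto
    also have "\<dots> = ennreal (4 * (pi / (2 * cos (pi * s / 2)) * (2 * pi * real (Suc k)) powr (s - 1)))"
      by (rule ennreal_mult'[symmetric]) simp
    also have "4 * (pi / (2 * cos (pi * s / 2)) * (2 * pi * real (Suc k)) powr (s - 1)) =
        (2 * pi) powr s / cos (pi * s / 2) * real (Suc k) powr (s - 1)"
    proof -
      have "(2 * pi * real (Suc k)) powr (s - 1) = (2 * pi) powr s / (2 * pi) * real (Suc k) powr (s - 1)"
        by (subst powr_mult) (auto simp: powr_diff)
      thus ?thesis by simp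
    qed
    finally show "(\<integral>\<^sup>+x. ennreal (indicator {0<..} x * (4 * (x powr s / (x\<^sup>2 + (2 * pi * real (Suc k))\<^sup>2)))) \<partial>lborel)
       = ennreal ((2 * pi) powr s / cos (pi * s / 2) * real (Suc k) powr (s - 1))" .
  qed
  also have "\<dots> = ennreal ((2 * pi) powr s / cos (pi * s / 2) * (\<Sum>k. real (Suc k) powr (s - 1)))"
    using cos by (intro ennreal_suminf_eq sums_mult summable_sums summ) auto
  finally have eq: "ennreal (Gamma (s + 2) * (\<Sum>n. trap_int (s + 2) n)) =
      ennreal ((2 * pi) powr s / cos (pi * s / 2) * (\<Sum>k. real (Suc k) powr (s - 1)))" .
  have "0 \<le> Gamma (s + 2) * (\<Sum>n. trap_int (s + 2) n)"
    using Gb by (intro mult_nonneg_nonneg suminf_nonneg zeta_right_eq_trap_int(1)[OF assms] trap_int_nonneg b) auto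
  moreover have "0 \<le> (2 * pi) powr s / cos (pi * s / 2) * (\<Sum>k. real (Suc k) powr (s - 1))"
    using cos by (intro mult_nonneg_nonneg suminf_nonneg summ divide_nonneg_nonneg) auto
  ultimately show ?thesis using eq ennreal_inj by blast
qed

text \<open>Gamma (s + 2) = s (s + 1) Gamma s cancels the prefactor s (s + 1) / 2 up to the 2. The
  remaining 1 / (Gamma s * cos (pi s / 2)) becomes Gamma (1 - s) * sin (pi s / 2) by the reflection
  formula and sin (pi s) = 2 sin (pi s / 2) cos (pi s / 2).\<close>

lemma zeta_right_functional_equation:
  assumes "-1 < s" "s < (0::real)"
  shows "zeta_right (of_real s) = 2 * (2 * of_real pi) powr (of_real s - 1) * sin (of_real pi * of_real s / 2) *
           Gamma (1 - of_real s) * zeta_right (1 - of_real s)"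
proof -
  define Z where "Z = (\<Sum>k. real (Suc k) powr (s - 1))"
  have summ: "summable (\<lambda>k. real (Suc k) powr (s - 1))"
    using summable_powr_minus[of "1 - s"] assms by simp
  have Z: "zeta_right (1 - of_real s) = of_real Z"
  proof -
    have "(\<lambda>k. 1 / complex_of_nat (Suc k) powr (1 - of_real s)) sums zeta_right (1 - of_real s)"
      using assms by (intro zeta_right_sums) auto
    moreover have "1 / complex_of_nat (Suc k) powr (1 - of_real s) = of_real (real (Suc k) powr (s - 1))" for k
    proof -
      have "1 / complex_of_nat (Suc k) powr (1 - of_real s) = complex_of_real (real (Suc k)) powr (of_real (s - 1))"
        using powr_minus[of "complex_of_nat (Suc k)" "1 - of_real s"] by (simp add: inverse_eq_divide)
      thus ?thesis by (subst (asm) powr_of_real) auto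
    qed
    ultimately have "(\<lambda>k. complex_of_real (real (Suc k) powr (s - 1))) sums zeta_right (1 - of_real s)" by simp
    moreover have "(\<lambda>k. complex_of_real (real (Suc k) powr (s - 1))) sums of_real Z"
      unfolding Z_def by (intro sums_of_real summable_sums summ)
    ultimately show ?thesis by (rule sums_unique2)
  qed
  have cos: "cos (pi * s / 2) > 0"
    using assms by (rule cos_pi_half_pos)
  have nI: "s \<notin> \<int>\<^sub>\<le>\<^sub>0" using assms by (auto elim!: nonpos_Ints_cases)
  have Gs: "Gamma (s + 2) = s * (s + 1) * Gamma s"
  proof -
    have "s + 1 \<notin> \<int>\<^sub>\<le>\<^sub>0" using assms by (auto elim!: nonpos_Ints_cases)
    thus ?thesis using Gamma_plus1[OF nI] Gamma_plus1[of "s + 1"] by (simp add: algebra_simps)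
  qed
  have Gnz: "Gamma s \<noteq> 0" using nI by (simp add: Gamma_eq_zero_iff)
  have refl: "Gamma (1 - s) * sin (pi * s) * Gamma s = pi"
  proof -
    have "sin (pi * s) \<noteq> 0"
    proof
      assume "sin (pi * s) = 0"
      hence "Gamma s * Gamma (1 - s) = 0" by (simp add: Gamma_reflection_real)
      moreover have "Gamma (1 - s) > 0" using assms by (intro Gamma_real_pos) auto
      ultimately show False using Gnz by auto
    qed
    thus ?thesis using Gamma_reflection_real[of s] by (simp add: field_simps)
  qed
  have sin2: "sin (pi * s) = 2 * sin (pi * s / 2) * cos (pi * s / 2)"
    using sin_double[of "pi * s / 2"] by simp
  have "s * (s + 1) / 2 * (\<Sum>n. trap_int (s + 2) n) * Gamma s =
          Gamma (s + 2) * (\<Sum>n. trap_int (s + 2) n) / 2" by (simp add: Gs)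
  also have "\<dots> = (2 * pi) powr s / cos (pi * s / 2) * Z / 2"
    unfolding sum_trap_int[OF assms] Z_def ..
  also have "\<dots> = (2 * pi) powr s / cos (pi * s / 2) * Z / 2 * (Gamma (1 - s) * sin (pi * s) * Gamma s / pi)"
    using refl by simp
  also have "\<dots> = 2 * (2 * pi) powr (s - 1) * sin (pi * s / 2) * Gamma (1 - s) * Z * Gamma s"
    using cos by (simp add: sin2 powr_diff field_simps)
  finally have "s * (s + 1) / 2 * (\<Sum>n. trap_int (s + 2) n) =
          2 * (2 * pi) powr (s - 1) * sin (pi * s / 2) * Gamma (1 - s) * Z" using Gnz by simp
  hence "zeta_right (of_real s) = of_real (2 * (2 * pi) powr (s - 1) * sin (pi * s / 2) * Gamma (1 - s) * Z)"
    using zeta_right_eq_trap_int(2)[OF assms] by simp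
  also have "\<dots> = 2 * of_real ((2 * pi) powr (s - 1)) * of_real (sin (pi * s / 2)) * of_real (Gamma (1 - s)) * of_real Z"
    by simp
  also have "complex_of_real ((2 * pi) powr (s - 1)) = (2 * of_real pi) powr (of_real s - 1)"
    using powr_of_real[of "2 * pi" "s - 1"] pi_gt_zero by simp
  also have "complex_of_real (sin (pi * s / 2)) = sin (of_real pi * of_real s / 2)"
    by (simp add: sin_of_real[symmetric])
  also have "complex_of_real (Gamma (1 - s)) = Gamma (1 - of_real s)"
    using Gamma_complex_of_real[of "1 - s"] by simp
  finally show ?thesis using Z by simp
qed

section \<open>The zeta function and its Dirichlet series\<close>

definition zeta_left :: "complex \<Rightarrow> complex" where
  "zeta_left s = 2 * (2 * of_real pi) powr (s - 1) * sin (of_real pi * s / 2) *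
     Gamma (1 - s) * zeta_right (1 - s)"

lemma holomorphic_zeta_left: "zeta_left holomorphic_on {s. Re s < 0}"
proof -
  have "zeta_right \<circ> (\<lambda>s. 1 - s) holomorphic_on {s. Re s < 0}"
    by (rule holomorphic_on_compose_gen[OF _ holomorphic_zeta_right]) (auto intro!: holomorphic_intros)
  hence "(\<lambda>s. zeta_right (1 - s)) holomorphic_on {s. Re s < 0}" by (simp add: o_def)
  thus ?thesis unfolding zeta_left_def[abs_def]
    by (intro holomorphic_intros) (auto elim!: nonpos_Ints_cases simp: complex_eq_iff)
qed

text \<open>So far the functional equation is known on a real segment only. The segment has an
  accumulation point in the strip, so the identity theorem extends the equation to all of
  it.\<close>

lemma zeta_left_eq_right:
  assumes "-1 < Re s" "Re s < 0"
  shows "zeta_left s = zeta_right s"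
proof -
  let ?S = "{s. -1 < Re s} \<inter> {s. Re s < 0}"
  have "zeta_left s - zeta_right s = 0"
  proof (rule analytic_continuation[of "\<lambda>s. zeta_left s - zeta_right s" ?S "of_real ` {-1<..<0}" "of_real (-1/2)"])
    show "(\<lambda>s. zeta_left s - zeta_right s) holomorphic_on ?S"
      by (intro holomorphic_intros holomorphic_on_subset[OF holomorphic_zeta_left]
                holomorphic_on_subset[OF holomorphic_zeta_right]) auto
    show "open ?S" by (intro open_Int open_halfspace_Re_gt open_halfspace_Re_lt)
    show "connected ?S"
      by (intro convex_connected convex_Int convex_halfspace_Re_gt convex_halfspace_Re_lt)
    have "(-1/2 :: real) islimpt {-1<..<0}"
      by (intro interior_limit_point) (auto simp: interior_open)
    thus "of_real (-1/2) islimpt complex_of_real ` {-1<..<0}"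
      by (subst islimpt_isCont_image) (auto simp: eventually_at_filter complex_eq_iff)
    show "zeta_left z - zeta_right z = 0" if "z \<in> of_real ` {-1<..<0}" for z
      using that zeta_right_functional_equation by (auto simp: zeta_left_def)
  qed (use assms in auto)
  thus ?thesis by simp
qed

text \<open>The seam Re s = -1/2 is an arbitrary line inside the strip -1 < Re s < 0, where both
  formulas agree. The value at 1 follows the convention in \<open>zeta_def\<close>.\<close>

definition zeta_glued :: "complex \<Rightarrow> complex" where
  "zeta_glued s = (if s = 1 then 0 else if Re s > -1/2 then zeta_right s else zeta_left s)"

lemma zeta_glued_eq:
  "Re s > -1 \<Longrightarrow> s \<noteq> 1 \<Longrightarrow> zeta_glued s = zeta_right s"
  "Re s < 0 \<Longrightarrow> zeta_glued s = zeta_left s"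
  using zeta_left_eq_right[of s] by (auto simp: zeta_glued_def)

lemma holomorphic_zeta_glued: "zeta_glued holomorphic_on (- {1})"
proof -
  have 1: "zeta_glued holomorphic_on ({s. Re s > -1} - {1})"
    using holomorphic_zeta_right by (rule holomorphic_transform) (auto simp: zeta_glued_eq)
  have 2: "zeta_glued holomorphic_on {s. Re s < 0}"
    using holomorphic_zeta_left by (rule holomorphic_transform) (auto simp: zeta_glued_eq)
  have "zeta_glued holomorphic_on (({s. Re s > -1} - {1}) \<union> {s. Re s < 0})"
    using 1 2 by (intro holomorphic_on_Un open_Diff open_halfspace_Re_gt open_halfspace_Re_lt) auto
  also have "({s. Re s > -1} - {1}) \<union> {s. Re s < 0} = - {1 :: complex}" by auto
  finally show ?thesis .
qed

text \<open>The glued function shows existence for the definite description. Uniqueness is the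
  identity theorem on the punctured plane, which is connected; at 1 itself the prescribed value
  decides.\<close>

lemma zeta_eq_glued: "zeta = zeta_glued"
  unfolding zeta_def
proof (rule the_equality)
  have "zeta_glued s = (\<Sum>n. 1 / of_nat (Suc n) powr s)" if "Re s > 1" for s
    using zeta_right_sums[OF that] that by (subst zeta_glued_eq) (auto simp: sums_iff)
  thus "zeta_glued holomorphic_on - {1} \<and>
      (\<forall>s. 1 < Re s \<longrightarrow> zeta_glued s = (\<Sum>n. 1 / of_nat (Suc n) powr s)) \<and> zeta_glued 1 = 0"
    using holomorphic_zeta_glued by (simp add: zeta_glued_def)
  note * = this
  fix f :: "complex \<Rightarrow> complex"
  assume f: "f holomorphic_on - {1} \<and>
      (\<forall>s. 1 < Re s \<longrightarrow> f s = (\<Sum>n. 1 / of_nat (Suc n) powr s)) \<and> f 1 = 0"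
  have "f s = zeta_glued s" if "s \<noteq> 1" for s
  proof (rule analytic_continuation_open[of "{s. Re s > 1}" "- {1}" f zeta_glued])
    have "2 \<in> {s. Re s > 1}" by simp
    thus "{s. Re s > 1} \<noteq> {}" by blast
    show "connected (- {1 :: complex})"
      by (rule connected_punctured_universe) auto
    show "f z = zeta_glued z" if "z \<in> {s. Re s > 1}" for z using that f * by simp
  qed (use f * that in \<open>auto simp: open_halfspace_Re_gt\<close>)
  thus "f = zeta_glued" using f * by (metis ext)
qed

lemma holomorphic_zeta: "zeta holomorphic_on (- {1})"
  unfolding zeta_eq_glued by (rule holomorphic_zeta_glued)

lemma holomorphic_zeta' [holomorphic_intros]: "1 \<notin> A \<Longrightarrow> zeta holomorphic_on A"
  by (rule holomorphic_on_subset[OF holomorphic_zeta]) auto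

lemma zeta_eq_right: "Re s > -1 \<Longrightarrow> s \<noteq> 1 \<Longrightarrow> zeta s = zeta_right s"
  unfolding zeta_eq_glued by (rule zeta_glued_eq)

lemma zeta_functional_equation:
  assumes "Re s < 0"
  shows "zeta s = 2 * (2 * of_real pi) powr (s - 1) * sin (of_real pi * s / 2) *
     Gamma (1 - s) * zeta (1 - s)"
proof -
  have "zeta (1 - s) = zeta_right (1 - s)" using assms by (intro zeta_eq_right) auto
  moreover have "zeta s = zeta_left s" using assms by (simp add: zeta_eq_glued zeta_glued_eq)
  ultimately show ?thesis by (simp add: zeta_left_def)
qed

lemma zeta_sums:
  assumes "Re s > 1"
  shows "(\<lambda>n. of_nat (Suc n) powr (- s)) sums zeta s"
proof -
  have "zeta s = zeta_right s" using assms by (intro zeta_eq_right) auto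
  thus ?thesis using zeta_right_sums[OF assms]
    by (simp add: powr_minus inverse_eq_divide del: of_nat_Suc)
qed

section \<open>Size of zeta\<close>

lemma norm_of_nat_powr_le:
  assumes "Re s \<ge> c"
  shows "norm (complex_of_nat (Suc n) powr (- s)) \<le> real (Suc n) powr (- c)"
  unfolding norm_of_nat_powr using assms by (intro powr_mono) auto

lemma norm_zeta_le:
  assumes "c > 1" "Re s \<ge> c"
  shows "norm (zeta s) \<le> (\<Sum>n. real (Suc n) powr (- c))"
proof -
  have "norm (\<Sum>n. complex_of_nat (Suc n) powr (- s)) \<le> (\<Sum>n. real (Suc n) powr (- c))"
    using assms by (intro norm_suminf_le norm_of_nat_powr_le summable_powr_minus) auto
  thus ?thesis using zeta_sums[of s] assms by (simp add: sums_iff)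
qed

text \<open>Supplies the lower bound at the centres 3 + \<i> T of the discs in Landau's lemma,
  uniformly in T. It rests on |zeta s - 1| \<le> (pi^2 / 6 - 1) / 2 \<le> 5 / 6, obtained by
  estimating n^-3 \<le> n^-2 / 2 for n \<ge> 2.\<close>

lemma norm_zeta_ge:
  assumes "Re s = 3"
  shows "norm (zeta s) \<ge> 1 / 6"
proof -
  have S: "(\<lambda>n. of_nat (Suc n) powr (- s)) sums zeta s" using assms by (intro zeta_sums) auto
  hence "(\<lambda>n. complex_of_nat (Suc (Suc n)) powr (- s)) sums (zeta s - 1)"
    using sums_Suc_iff[of "\<lambda>n. complex_of_nat (Suc n) powr (- s)" "zeta s - 1"] by simp
  hence eq: "zeta s - 1 = (\<Sum>n. complex_of_nat (Suc (Suc n)) powr (- s))" by (simp add: sums_iff)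
  have sq: "(\<lambda>n. 1 / (real (Suc n))\<^sup>2) sums (pi\<^sup>2 / 6)"
    using inverse_squares_sums by (simp add: add_ac)
  hence sq': "(\<lambda>n. 1 / (real (Suc (Suc n)))\<^sup>2) sums (pi\<^sup>2 / 6 - 1)"
    using sums_Suc_iff[of "\<lambda>n. 1 / (real (Suc n))\<^sup>2" "pi\<^sup>2 / 6 - 1"] by simp
  have "norm (zeta s - 1) \<le> (\<Sum>n. 1/2 * (1 / (real (Suc (Suc n)))\<^sup>2))"
    unfolding eq
  proof (rule norm_suminf_le)
    fix n
    have "norm (complex_of_nat (Suc (Suc n)) powr (- s)) = real (Suc (Suc n)) powr (- 3)"
      unfolding norm_of_nat_powr using assms by simp
    also have "\<dots> = 1 / (real (Suc (Suc n)) * (real (Suc (Suc n)))\<^sup>2)"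
      by (simp add: powr_minus inverse_eq_divide power2_eq_square power3_eq_cube numeral_eq_Suc)
    also have "\<dots> \<le> 1 / (2 * (real (Suc (Suc n)))\<^sup>2)"
      by (intro divide_left_mono mult_right_mono) auto
    finally show "norm (complex_of_nat (Suc (Suc n)) powr (- s)) \<le> 1/2 * (1 / (real (Suc (Suc n)))\<^sup>2)" by simp
    show "summable (\<lambda>n. 1/2 * (1 / (real (Suc (Suc n)))\<^sup>2))"
      using sq' by (intro summable_mult) (auto simp: sums_iff)
  qed
  also have "\<dots> = 1/2 * (pi\<^sup>2 / 6 - 1)"
    using sums_mult[OF sq', of "1/2"] by (simp only: sums_iff)
  also have "\<dots> \<le> 5 / 6"
  proof -
    have "pi\<^sup>2 \<le> 4\<^sup>2" using pi_less_4 pi_gt_zero by (intro power_mono) auto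
    thus ?thesis by simp
  qed
  finally have "norm (zeta s - 1) \<le> 5 / 6" .
  moreover have "1 \<le> norm (zeta s) + norm (zeta s - 1)"
    using norm_triangle_ineq4[of "zeta s" "zeta s - 1"] by simp
  ultimately show ?thesis by simp
qed

text \<open>The range -9 \<le> Re s \<le> 15 is what discs of radius 12 around points with real part
  3 occupy. To the right of -1/2 the trapezoidal formula grows only quadratically; to the left, the
  sine in the functional equation is of size exp (pi |Im s| / 2), and pi / 2 < 2.\<close>

lemma zeta_growth:
  obtains C where "C \<ge> 1"
    "\<And>s. -9 \<le> Re s \<Longrightarrow> Re s \<le> 15 \<Longrightarrow> \<bar>Im s\<bar> \<ge> 1 \<Longrightarrow> norm (zeta s) \<le> C * exp (2 * \<bar>Im s\<bar>)"
proof -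
  define C0 where "C0 = (\<Sum>n. real (Suc n) powr (- (3/2)))"
  have C0: "C0 \<ge> 0" unfolding C0_def by (intro suminf_nonneg summable_powr_minus) auto
  have "compact (Gamma ` {1..10::real})"
    by (intro compact_continuous_image continuous_on_Gamma) (auto elim!: nonpos_Ints_cases)
  then obtain G where G: "\<And>x::real. x \<in> {1..10} \<Longrightarrow> Gamma x \<le> G"
    using compact_imp_bounded bounded_real by (metis (mono_tags, lifting) abs_le_D1 imageI)
  have "Gamma (1::real) \<le> G" by (rule G) auto
  hence G1: "G \<ge> 1" by simp
  define C where "C = 2 + 32 * C0 + 2 * G * C0"
  have "2 * G * C0 \<ge> 0" using C0 G1 by auto
  hence Cge: "C \<ge> 1" unfolding C_def using C0 by linarith
  show ?thesis
  proof (rule that[OF Cge])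
    fix s assume s: "-9 \<le> Re s" "Re s \<le> 15" "\<bar>Im s\<bar> \<ge> 1"
    define t where "t = \<bar>Im s\<bar>"
    have t: "t \<ge> 1" using s by (simp add: t_def)
    have e1: "exp (2 * t) \<ge> 1" using t by simp
    show "norm (zeta s) \<le> C * exp (2 * \<bar>Im s\<bar>)"
    proof (cases "Re s \<ge> -1/2")
      case True
      have s1: "s \<noteq> 1" using s by auto
      have "norm (s - 1) \<ge> 1" using abs_Im_le_cmod[of "s - 1"] s by simp
      hence a: "norm (1 / (s - 1)) \<le> 1" by (simp add: norm_divide divide_simps)
      have "norm s \<le> 15 + t" "norm (s + 1) \<le> 16 + t"
        using cmod_le[of s] cmod_le[of "s + 1"] s True by (auto simp: t_def)
      hence ns: "norm s \<le> 16 * (1 + t)" "norm (s + 1) \<le> 16 * (1 + t)" using t by auto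
      have "norm (trap_sum s) \<le> norm s * norm (s + 1) / 8 * C0"
        using norm_trap_sum_le[of "-1/2" s] True by (simp add: C0_def)
      also have "\<dots> \<le> (16 * (1 + t)) * (16 * (1 + t)) / 8 * C0"
        using ns C0 t by (intro mult_right_mono divide_right_mono mult_mono) auto
      also have "\<dots> = 32 * C0 * ((1 + t) * (1 + t))" by (simp add: algebra_simps)
      also have "\<dots> \<le> 32 * C0 * (exp t * exp t)"
        using C0 t exp_ge_add_one_self[of t] by (intro mult_left_mono mult_mono) auto
      also have "exp t * exp t = exp (2 * t)" by (simp flip: exp_add)
      finally have b: "norm (trap_sum s) \<le> 32 * C0 * exp (2 * t)" .
      have "zeta s = 1 / (s - 1) + 1/2 + trap_sum s"
        using True s1 by (subst zeta_eq_right) (auto simp: zeta_right_def)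
      hence "norm (zeta s) \<le> norm (1 / (s - 1)) + norm (1/2 :: complex) + norm (trap_sum s)"
        by (simp only:) (intro norm_triangle_le add_mono norm_triangle_ineq order_refl)
      also have "\<dots> \<le> 1 + 1 + 32 * C0 * exp (2 * t)" using a b by (intro add_mono) auto
      also have "\<dots> \<le> 2 * exp (2 * t) + 32 * C0 * exp (2 * t)" using e1 by simp
      also have "\<dots> \<le> 2 * exp (2 * t) + 32 * C0 * exp (2 * t) + 2 * G * C0 * exp (2 * t)"
        using C0 G1 by simp
      also have "\<dots> = C * exp (2 * t)" by (simp add: C_def algebra_simps)
      finally show ?thesis by (simp add: t_def)
    next
      case False
      have z: "zeta s = 2 * (2 * of_real pi) powr (s - 1) * sin (of_real pi * s / 2) *
                 Gamma (1 - s) * zeta (1 - s)"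
        using False by (intro zeta_functional_equation) auto
      have p: "norm ((2 * complex_of_real pi) powr (s - 1)) \<le> 1"
      proof -
        have "norm (complex_of_real (2 * pi) powr (s - 1)) = (2 * pi) powr (Re s - 1)"
          by (subst norm_powr_real_powr) auto
        also have "\<dots> \<le> (2 * pi) powr 0"
          using False pi_ge_two by (intro powr_mono) auto
        finally show ?thesis by simp
      qed
      have "norm (sin (of_real pi * s / 2)) \<le> exp \<bar>Im (of_real pi * s / 2)\<bar>"
        using cmod_sin_le_exp[of 1 "of_real pi * s / 2"] by simp
      also have "\<dots> \<le> exp (2 * t)"
        using mult_right_mono[of pi 4 t] pi_less_4 t by (simp add: t_def abs_mult)
      finally have q: "norm (sin (of_real pi * s / 2)) \<le> exp (2 * t)" .
      have "norm (Gamma (1 - s)) \<le> Gamma (Re (1 - s))"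
        using False by (intro norm_Gamma_le_Gamma_Re) auto
      also have "\<dots> \<le> G" using False s by (intro G) auto
      finally have r: "norm (Gamma (1 - s)) \<le> G" .
      have w: "norm (zeta (1 - s)) \<le> C0"
        unfolding C0_def using False by (intro norm_zeta_le) auto
      have "norm (zeta s) = 2 * norm ((2 * complex_of_real pi) powr (s - 1)) * norm (sin (of_real pi * s / 2)) *
              norm (Gamma (1 - s)) * norm (zeta (1 - s))"
        unfolding z by (simp add: norm_mult)
      also have "\<dots> \<le> 2 * 1 * exp (2 * t) * G * C0"
        using p q r w G1 by (intro mult_mono) auto
      also have "\<dots> \<le> C * exp (2 * t)"
        using C0 e1 by (auto simp: C_def algebra_simps)
      finally show ?thesis by (simp add: t_def)
    qed
  qed
qed

section \<open>The Dirichlet series of the von Mangoldt function\<close>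

lemma mangoldt_powr_summable:
  assumes "c > 1"
  shows "summable (\<lambda>n. ln (real (Suc n)) * real (Suc n) powr (- c))"
    and "summable (\<lambda>n. mangoldt (Suc n) * real (Suc n) powr (- c))"
proof -
  define e where "e = (c - 1) / 2"
  have e: "e > 0" "c - e > 1" using assms by (auto simp: e_def field_simps)
  have le: "ln (real (Suc n)) * real (Suc n) powr (- c) \<le> 1 / e * real (Suc n) powr (- (c - e))" for n
  proof -
    have "ln (real (Suc n)) * real (Suc n) powr (- c) \<le> real (Suc n) powr e / e * real (Suc n) powr (- c)"
      using ln_powr_bound[of "real (Suc n)" e] e by (intro mult_right_mono) auto
    also have "\<dots> = 1 / e * (real (Suc n) powr e * real (Suc n) powr (- c))" by simp
    also have "real (Suc n) powr e * real (Suc n) powr (- c) = real (Suc n) powr (- (c - e))"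
      unfolding powr_add[symmetric] by simp
    finally show ?thesis .
  qed
  show 1: "summable (\<lambda>n. ln (real (Suc n)) * real (Suc n) powr (- c))"
    using le e by (intro summable_comparison_test'[OF summable_mult[OF summable_powr_minus[OF e(2)], of "1 / e"]])
                  (auto simp: abs_mult)
  show "summable (\<lambda>n. mangoldt (Suc n) * real (Suc n) powr (- c))"
  proof (rule summable_comparison_test'[OF 1])
    fix n :: nat
    show "norm (mangoldt (Suc n) * real (Suc n) powr (- c)) \<le> ln (real (Suc n)) * real (Suc n) powr (- c)"
      using mangoldt_le[of "Suc n"] mangoldt_nonneg[of "Suc n"]
      by (simp add: abs_mult mult_right_mono del: of_nat_Suc)
  qed
qed

lemma Re_ge_in_ball:
  assumes "y \<in> ball x ((Re x - 1) / 2)"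
  shows "Re y \<ge> (Re x + 1) / 2"
proof -
  have "norm (x - y) \<le> (Re x - 1) / 2" using assms by (simp add: dist_norm)
  hence "\<bar>Re (x - y)\<bar> \<le> (Re x - 1) / 2" using abs_Re_le_cmod order_trans by blast
  moreover have "Re x - Re y \<le> \<bar>Re (x - y)\<bar>" using abs_ge_self[of "Re (x - y)"] by simp
  ultimately have "Re x - Re y \<le> (Re x - 1) / 2" by (rule order_trans[rotated])
  thus ?thesis by (simp add: field_simps)
qed

text \<open>Used for the coefficients 1 and for the von Mangoldt function alike. On a disc around x
  the terms are dominated by those at the real abscissa halfway between 1 and Re x.\<close>

lemma Dirichlet_series_deriv:
  fixes a :: "nat \<Rightarrow> real"
  assumes a: "\<And>c. c > 1 \<Longrightarrow> summable (\<lambda>n. a n * real (Suc n) powr (- c))" "\<And>n. a n \<ge> 0"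
  obtains g g' where "\<And>s. Re s > 1 \<Longrightarrow> (\<lambda>n. of_real (a n) * of_nat (Suc n) powr (- s)) sums g s"
    "\<And>s. Re s > 1 \<Longrightarrow> (\<lambda>n. - of_real (a n * ln (real (Suc n))) * of_nat (Suc n) powr (- s)) sums g' s"
    "\<And>s. Re s > 1 \<Longrightarrow> (g has_field_derivative g' s) (at s)"
proof -
  have "\<exists>g g'. \<forall>x\<in>{s. Re s > 1}. ((\<lambda>n. of_real (a n) * of_nat (Suc n) powr (- x)) sums g x) \<and>
      ((\<lambda>n. - of_real (a n * ln (real (Suc n))) * of_nat (Suc n) powr (- x)) sums g' x) \<and>
      (g has_field_derivative g' x) (at x)"
  proof (rule series_and_derivative_comparison_complex)
    show "open {s. Re s > 1}" by (rule open_halfspace_Re_gt)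
    show "((\<lambda>x. of_real (a n) * of_nat (Suc n) powr (- x)) has_field_derivative
            - of_real (a n * ln (real (Suc n))) * of_nat (Suc n) powr (- x)) (at x)" for n and x :: complex
    proof -
      have "((\<lambda>x. of_real (a n) * exp ((- x) * of_real (ln (real (Suc n))))) has_field_derivative
            of_real (a n) * (exp ((- x) * of_real (ln (real (Suc n)))) * - of_real (ln (real (Suc n))))) (at x)"
        by (auto intro!: derivative_eq_intros)
      moreover have "complex_of_nat (Suc n) powr (- x) = exp ((- x) * of_real (ln (real (Suc n))))" for x :: complex
        using powr_of_real_exp[of "real (Suc n)" "- x"] by simp
      ultimately show ?thesis by (simp add: mult_ac del: of_nat_Suc)
    qed
    fix x assume x: "x \<in> {s. Re s > 1}"
    define c where "c = (Re x + 1) / 2"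
    have c: "c > 1" using x by (auto simp: c_def)
    show "\<exists>d (h :: nat \<Rightarrow> complex). 0 < d \<and> summable h \<and> range h \<subseteq> \<real>\<^sub>\<ge>\<^sub>0 \<and>
      (\<forall>\<^sub>F n in sequentially. \<forall>y\<in>ball x d \<inter> {s. Re s > 1}. norm (of_real (a n) * of_nat (Suc n) powr (- y)) \<le> norm (h n))"
    proof (intro exI conjI always_eventually allI ballI)
      show "(Re x - 1) / 2 > 0" using x by simp
      show "summable (\<lambda>n. complex_of_real (a n * real (Suc n) powr (- c)))"
        using a(1)[OF c] by (rule summable_of_real)
      show "range (\<lambda>n. complex_of_real (a n * real (Suc n) powr (- c))) \<subseteq> \<real>\<^sub>\<ge>\<^sub>0"
        using a(2) by (auto simp del: of_real_mult)
      fix n y assume y: "y \<in> ball x ((Re x - 1) / 2) \<inter> {s. Re s > 1}"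
      have "norm (of_real (a n) * complex_of_nat (Suc n) powr (- y)) \<le> a n * real (Suc n) powr (- c)"
        unfolding norm_mult using a(2)[of n] Re_ge_in_ball[of y x] y
        by (intro mult_mono norm_of_nat_powr_le) (auto simp: c_def)
      also have "\<dots> = norm (complex_of_real (a n * real (Suc n) powr (- c)))"
        using a(2)[of n] by (simp only: norm_of_real abs_of_nonneg mult_nonneg_nonneg powr_ge_zero)
      finally show "norm (of_real (a n) * complex_of_nat (Suc n) powr (- y)) \<le> norm (complex_of_real (a n * real (Suc n) powr (- c)))" .
    qed
  qed
  then obtain g g' where "\<forall>x\<in>{s. Re s > 1}. ((\<lambda>n. of_real (a n) * of_nat (Suc n) powr (- x)) sums g x) \<and>
      ((\<lambda>n. - of_real (a n * ln (real (Suc n))) * of_nat (Suc n) powr (- x)) sums g' x) \<and>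
      (g has_field_derivative g' x) (at x)" by blast
  thus ?thesis using that by blast
qed

lemma deriv_zeta_sums:
  assumes "Re s > 1"
  shows "(\<lambda>n. of_real (ln (real (Suc n))) * of_nat (Suc n) powr (- s)) sums (- deriv zeta s)"
proof -
  obtain g g' where g: "\<And>s. Re s > 1 \<Longrightarrow> (\<lambda>n. of_real 1 * of_nat (Suc n) powr (- s)) sums g s"
    "\<And>s. Re s > 1 \<Longrightarrow> (\<lambda>n. - of_real (1 * ln (real (Suc n))) * of_nat (Suc n) powr (- s)) sums g' s"
    "\<And>s. Re s > 1 \<Longrightarrow> (g has_field_derivative g' s) (at s)"
    by (rule Dirichlet_series_deriv[of "\<lambda>_. 1"]) (auto intro: summable_powr_minus simp del: of_nat_Suc)
  have eq: "g z = zeta z" if "Re z > 1" for z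
    using g(1)[OF that] zeta_sums[OF that] by (simp add: sums_iff)
  have "(zeta has_field_derivative g' s) (at s)"
    by (rule has_field_derivative_transform_within_open[OF g(3)[OF assms] open_halfspace_Re_gt[of 1]])
       (use assms eq in auto)
  hence "deriv zeta s = g' s" by (rule DERIV_imp_deriv)
  thus ?thesis using sums_minus[OF g(2)[OF assms]] by simp
qed

definition mangoldt_series :: "complex \<Rightarrow> complex" where
  "mangoldt_series s = (\<Sum>n. mangoldt (Suc n) * of_nat (Suc n) powr (- s))"

lemma mangoldt_series_summable:
  assumes "Re s > 1"
  shows "summable (\<lambda>n. norm (mangoldt (Suc n) * complex_of_nat (Suc n) powr (- s)))"
  using mangoldt_powr_summable(2)[OF assms]
  by (simp add: norm_mult norm_of_nat_powr mangoldt_nonneg del: of_nat_Suc)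

text \<open>The divisor sum of the von Mangoldt function is ln n (\<open>mangoldt_sum\<close>). Both
  series converge absolutely, so the double sum over (d, k) may be regrouped by n = d * k, with d
  running over the divisors of n.\<close>

lemma mangoldt_series_times_zeta:
  assumes s: "Re s > 1"
  shows "mangoldt_series s * zeta s = - deriv zeta s"
proof -
  define a where "a = (\<lambda>n. mangoldt n * complex_of_nat n powr (- s))"
  define b where "b = (\<lambda>n. complex_of_nat n powr (- s))"
  define l where "l = (\<lambda>n. of_real (ln (real n)) * complex_of_nat n powr (- s))"
  define N where "N = range Suc"
  have N: "n \<in> N \<longleftrightarrow> n > 0" for n unfolding N_def by (cases n) auto
  have tr: "(f has_sum S) N" "(\<lambda>n. norm (f n)) summable_on N"
    if "summable (\<lambda>n. norm (f (Suc n)))" "(\<lambda>n. f (Suc n)) sums S" for f :: "nat \<Rightarrow> complex" and S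
  proof -
    show "(f has_sum S) N"
      unfolding N_def using norm_summable_imp_has_sum[OF that] by (subst has_sum_reindex) (auto simp: o_def)
    have "(\<lambda>n. norm (f (Suc n))) summable_on UNIV"
      using that(1) by (intro norm_summable_imp_summable_on) auto
    thus "(\<lambda>n. norm (f n)) summable_on N"
      unfolding N_def by (subst summable_on_reindex) (auto simp: o_def)
  qed
  have A: "(a has_sum mangoldt_series s) N" "(\<lambda>n. norm (a n)) summable_on N"
    using mangoldt_series_summable[OF s] summable_norm_cancel[OF mangoldt_series_summable[OF s]]
    by (auto intro!: tr simp: a_def mangoldt_series_def summable_sums)
  have B: "(b has_sum zeta s) N" "(\<lambda>n. norm (b n)) summable_on N"
    using summable_powr_minus[OF s] zeta_sums[OF s]
    by (auto intro!: tr simp: b_def norm_of_nat_powr simp del: of_nat_Suc)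
  have Lsum: "(l has_sum (- deriv zeta s)) N"
  proof (rule tr)
    show "summable (\<lambda>n. norm (l (Suc n)))"
      using mangoldt_powr_summable(1)[OF s]
      by (simp add: l_def norm_mult norm_of_nat_powr del: of_nat_Suc)
  qed (use deriv_zeta_sums[OF s] in \<open>simp add: l_def\<close>)
  have "(\<lambda>p. norm (case p of (d, k) \<Rightarrow> a d * b k)) summable_on N \<times> N"
  proof (rule iffD2[OF Infinite_Sum.abs_summable_on_Sigma_iff], intro conjI ballI)
    show "(\<lambda>k. norm (case (d, k) of (d, k) \<Rightarrow> a d * b k)) summable_on N" for d
      using summable_on_cmult_right[OF B(2), of "norm (a d)"] by (simp add: norm_mult)
    have "(\<lambda>d. norm (a d) * (\<Sum>\<^sub>\<infinity>k\<in>N. norm (b k))) summable_on N"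
      using A(2) by (rule summable_on_cmult_left)
    moreover have "(\<Sum>\<^sub>\<infinity>k\<in>N. norm (case (d, k) of (d, k) \<Rightarrow> a d * b k)) = norm (a d) * (\<Sum>\<^sub>\<infinity>k\<in>N. norm (b k))" for d
      using infsum_cmult_right[of "norm (a d)" "\<lambda>k. norm (b k)" N] B(2) by (simp add: norm_mult)
    moreover have "(\<Sum>\<^sub>\<infinity>k\<in>N. norm (b k)) \<ge> 0" by (intro infsum_nonneg) auto
    ultimately show "(\<lambda>d. norm (\<Sum>\<^sub>\<infinity>k\<in>N. norm (case (d, k) of (d, k) \<Rightarrow> a d * b k))) summable_on N"
      by (simp add: abs_mult)
  qed
  hence "(\<lambda>(d, k). a d * b k) summable_on N \<times> N"
    by (rule Infinite_Sum.abs_summable_summable)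
  hence "((\<lambda>(d, k). a d * b k) has_sum (mangoldt_series s * zeta s)) (N \<times> N)"
    by (rule has_sum_SigmaI[rotated 2, where g = "\<lambda>d. a d * zeta s"])
       (auto intro!: has_sum_cmult_right has_sum_cmult_left A B)
  also have "?this \<longleftrightarrow> ((\<lambda>(n, d). mangoldt d * b n) has_sum (mangoldt_series s * zeta s)) (SIGMA n:N. {d. d dvd n})"
  proof (rule has_sum_reindex_bij_witness[of _ "\<lambda>(n, d). (d, n div d)" "\<lambda>(d, k). (d * k, d)"])
    fix x assume "x \<in> N \<times> N"
    then obtain d k where x: "x = (d, k)" "d > 0" "k > 0" by (auto simp: N)
    have "complex_of_nat (d * k) powr (- s) = of_nat d powr (- s) * of_nat k powr (- s)"
      using powr_times_real[of "of_nat d" "of_nat k" "- s"] by simp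
    thus "(case case x of (d, k) \<Rightarrow> (d * k, d) of (n, d) \<Rightarrow> mangoldt d * b n) = (case x of (d, k) \<Rightarrow> a d * b k)"
      using x by (simp add: a_def b_def)
  qed (auto simp: N elim!: dvdE)
  finally have "((\<lambda>(n, d). mangoldt d * b n) has_sum (mangoldt_series s * zeta s)) (SIGMA n:N. {d. d dvd n})" .
  hence "(l has_sum (mangoldt_series s * zeta s)) N"
  proof (rule has_sum_SigmaD)
    fix n assume n: "n \<in> N"
    have "((\<lambda>d. mangoldt d * b n) has_sum (\<Sum>d | d dvd n. mangoldt d * b n)) {d. d dvd n}"
      using n by (intro has_sum_finite) (auto simp: N)
    also have "(\<Sum>d | d dvd n. mangoldt d * b n) = (\<Sum>d | d dvd n. mangoldt d) * b n"
      by (simp add: sum_distrib_right)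
    also have "\<dots> = l n" using n by (subst mangoldt_sum) (auto simp: N l_def b_def)
    finally show "((\<lambda>y. case (n, y) of (n, d) \<Rightarrow> mangoldt d * b n) has_sum l n) {d. d dvd n}" by simp
  qed
  with Lsum show ?thesis using has_sum_unique by blast
qed

lemma holomorphic_mangoldt_series: "mangoldt_series holomorphic_on {s. Re s > 1}"
proof -
  obtain g g' where g: "\<And>s. Re s > 1 \<Longrightarrow> (\<lambda>n. of_real (mangoldt (Suc n)) * of_nat (Suc n) powr (- s)) sums g s"
    "\<And>s. Re s > 1 \<Longrightarrow> (\<lambda>n. - of_real (mangoldt (Suc n) * ln (real (Suc n))) * of_nat (Suc n) powr (- s)) sums g' s"
    "\<And>s. Re s > 1 \<Longrightarrow> (g has_field_derivative g' s) (at s)"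
    by (rule Dirichlet_series_deriv[OF mangoldt_powr_summable(2) mangoldt_nonneg]) (assumption, (rule that; assumption))
  have "g holomorphic_on {s. Re s > 1}"
    using g(3) by (auto simp: holomorphic_on_open open_halfspace_Re_gt)
  thus ?thesis
    by (rule holomorphic_transform) (use g(1) in \<open>auto simp: mangoldt_series_def sums_iff\<close>)
qed

text \<open>
  A primitive \<open>P\<close> of \<open>mangoldt_series\<close> makes \<open>\<zeta> e\<^sup>P\<close> constant, which replaces the Euler product.
\<close>
lemma zeta_neq_0_right:
  assumes "Re s > 1"
  shows "zeta s \<noteq> 0"
proof -
  let ?S = "{s. Re s > 1}"
  obtain P where P: "\<And>x. x \<in> ?S \<Longrightarrow> (P has_field_derivative mangoldt_series x) (at x within ?S)"
    using holomorphic_convex_primitive'[OF convex_halfspace_Re_gt open_halfspace_Re_gt holomorphic_mangoldt_series] by blast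
  have "((\<lambda>s. zeta s * exp (P s)) has_field_derivative 0) (at x within ?S)" if "x \<in> ?S" for x
  proof -
    have "zeta holomorphic_on ?S" by (intro holomorphic_intros) auto
    hence "(zeta has_field_derivative deriv zeta x) (at x within ?S)"
      using that open_halfspace_Re_gt has_field_derivative_at_within holomorphic_derivI by blast
    hence "((\<lambda>s. zeta s * exp (P s)) has_field_derivative
             zeta x * (exp (P x) * mangoldt_series x) + deriv zeta x * exp (P x)) (at x within ?S)"
      using P[OF that] by (auto intro!: derivative_eq_intros)
    moreover have "zeta x * (exp (P x) * mangoldt_series x) + deriv zeta x * exp (P x) = 0"
    proof -
      have "deriv zeta x = - (mangoldt_series x * zeta x)"
        using mangoldt_series_times_zeta[of x] that by simp
      thus ?thesis by (simp add: algebra_simps)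
    qed
    ultimately show ?thesis by simp
  qed
  from has_field_derivative_zero_constant[OF convex_halfspace_Re_gt this]
  obtain c where c: "\<And>x. x \<in> ?S \<Longrightarrow> zeta x * exp (P x) = c" by blast
  have "norm (zeta 3) \<ge> 1 / 6" by (rule norm_zeta_ge) auto
  hence "zeta 3 \<noteq> 0" by auto
  hence "c \<noteq> 0" using c[of 3] by auto
  thus ?thesis using c[of s] assms by auto
qed

lemma log_deriv_zeta_right:
  assumes "Re s > 1"
  shows "- (deriv zeta s / zeta s) = mangoldt_series s"
  using mangoldt_series_times_zeta[OF assms] zeta_neq_0_right[OF assms] by (simp add: field_simps)

lemma norm_mangoldt_series_le:
  assumes "c > 1" "Re s \<ge> c"
  shows "norm (mangoldt_series s) \<le> (\<Sum>n. mangoldt (Suc n) * real (Suc n) powr (- c))"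
  unfolding mangoldt_series_def
proof (rule norm_suminf_le[OF _ mangoldt_powr_summable(2)[OF assms(1)]])
  show "norm (mangoldt (Suc n) * complex_of_nat (Suc n) powr (- s)) \<le> mangoldt (Suc n) * real (Suc n) powr (- c)" for n
    unfolding norm_mult using assms norm_of_nat_powr_le[of c s n] mangoldt_nonneg
    by (intro mult_mono) auto
qed

section \<open>Bounds for the logarithmic derivative\<close>

lemma norm_sin_squared_eq:
  "(norm (sin z))\<^sup>2 = (sin (Re z))\<^sup>2 + ((exp (Im z) - exp (- Im z)) / 2)\<^sup>2"
  unfolding norm_sin_squared exp_minus cos_double_sin exp_double
  by (simp add: field_simps power2_eq_square)

lemma norm_sin_ge_sin_Re: "\<bar>sin (Re z)\<bar> \<le> norm (sin z)"
  by (rule power2_le_imp_le) (simp_all add: norm_sin_squared_eq)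

lemma norm_sin_ge_half:
  assumes "\<bar>Im z\<bar> \<ge> 1"
  shows "norm (sin z) \<ge> 1 / 2"
proof (rule power2_le_imp_le)
  have sinh: "(exp y - exp (- y)) / 2 \<ge> 1 / 2" if "y \<ge> 1" for y :: real
  proof -
    have "exp y \<ge> 2" using exp_ge_add_one_self[of y] that by linarith
    moreover have "exp (- y) \<le> 1" using that by simp
    ultimately have "1 \<le> exp y - exp (- y)" by linarith
    thus ?thesis by (rule divide_right_mono) simp
  qed
  have "((exp (Im z) - exp (- Im z)) / 2)\<^sup>2 = ((exp \<bar>Im z\<bar> - exp (- \<bar>Im z\<bar>)) / 2)\<^sup>2"
    by (cases "Im z \<ge> 0") (simp_all add: power2_commute power_divide)
  also have "\<dots> \<ge> (1 / 2)\<^sup>2" using sinh[OF assms] by (intro power_mono) auto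
  finally have "(1 / 2)\<^sup>2 \<le> ((exp (Im z) - exp (- Im z)) / 2)\<^sup>2" .
  thus "(1 / 2)\<^sup>2 \<le> (norm (sin z))\<^sup>2"
    unfolding norm_sin_squared_eq using zero_le_power2[of "sin (Re z)"] by linarith
qed simp

lemma norm_cot_le:
  assumes "d > 0" "norm (sin z) \<ge> d"
  shows "norm (cos z / sin z :: complex) \<le> 1 + 1 / d"
proof -
  have pos: "norm (sin z) > 0" using assms by linarith
  have "(norm (cos z))\<^sup>2 \<le> 1 + (norm (sin z))\<^sup>2"
  proof -
    have "cos z ^ 2 = 1 - sin z ^ 2" by (simp add: cos_squared_eq)
    hence "norm (cos z ^ 2) \<le> 1 + norm (sin z ^ 2)"
      using norm_triangle_ineq4[of 1 "sin z ^ 2"] by simp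
    thus ?thesis by (simp add: norm_power)
  qed
  also have "\<dots> \<le> (1 + norm (sin z))\<^sup>2" by (simp add: power2_eq_square algebra_simps)
  finally have "norm (cos z) \<le> 1 + norm (sin z)" by (rule power2_le_imp_le) auto
  hence "norm (cos z) / norm (sin z) \<le> (1 + norm (sin z)) / norm (sin z)"
    by (rule divide_right_mono) auto
  also have "\<dots> = 1 / norm (sin z) + 1"
    using pos by (simp add: field_simps)
  also have "\<dots> \<le> 1 / d + 1" using assms pos by (intro add_mono divide_left_mono mult_pos_pos) auto
  finally show ?thesis by (simp add: norm_divide)
qed

text \<open>Linear growth is far from sharp but is all that is required. The k-th term of the series
  is (z - 1) / ((k + 1) (z + k)), where |z + k| \<ge> k + 1 because Re z \<ge> 1.\<close>

lemma norm_Digamma_le: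
  fixes z :: complex
  assumes "Re z \<ge> 1"
  shows "norm (Digamma z) \<le> (pi\<^sup>2 / 6 + euler_mascheroni) * (1 + norm z)"
proof -
  have sq: "(\<lambda>n. 1 / (real (Suc n))\<^sup>2) sums (pi\<^sup>2 / 6)"
    using inverse_squares_sums by (simp add: add_ac)
  have "norm (\<Sum>k. inverse (of_nat (Suc k)) - inverse (z + of_nat k)) \<le> (\<Sum>k. (1 + norm z) * (1 / (real (Suc k))\<^sup>2))"
  proof (rule norm_suminf_le)
    fix k
    have Re: "Re (z + of_nat k) \<ge> real (Suc k)" using assms by simp
    hence n: "norm (z + of_nat k) \<ge> real (Suc k)" using complex_Re_le_cmod order_trans by blast
    hence nz: "z + of_nat k \<noteq> 0" by (metis norm_zero not_less of_nat_0_less_iff zero_less_Suc)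
    have "inverse (of_nat (Suc k)) - inverse (z + of_nat k) = (z - 1) / (of_nat (Suc k) * (z + of_nat k))"
      using nz by (simp add: field_simps del: of_nat_Suc) (simp add: algebra_simps)
    hence "norm (inverse (of_nat (Suc k)) - inverse (z + of_nat k)) = norm (z - 1) / (real (Suc k) * norm (z + of_nat k))"
      by (simp add: norm_divide norm_mult del: of_nat_Suc)
    also have "\<dots> \<le> (1 + norm z) / (real (Suc k) * real (Suc k))"
      using n norm_triangle_ineq4[of z 1] by (intro frac_le mult_left_mono) auto
    finally show "norm (inverse (of_nat (Suc k)) - inverse (z + of_nat k)) \<le> (1 + norm z) * (1 / (real (Suc k))\<^sup>2)"
      by (simp add: power2_eq_square)
    show "summable (\<lambda>k. (1 + norm z) * (1 / (real (Suc k))\<^sup>2))"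
      using sq by (intro summable_mult) (auto simp: sums_iff)
  qed
  also have "\<dots> = (1 + norm z) * (pi\<^sup>2 / 6)"
    using sums_mult[OF sq, of "1 + norm z"] by (simp only: sums_iff)
  finally have 1: "norm (\<Sum>k. inverse (of_nat (Suc k)) - inverse (z + of_nat k)) \<le> (1 + norm z) * (pi\<^sup>2 / 6)" .
  have e: "norm (euler_mascheroni :: complex) = euler_mascheroni"
    by (metis abs_of_pos euler_mascheroni_pos norm_of_real of_real_euler_mascheroni)
  have "norm (Digamma z) \<le> norm (\<Sum>k. inverse (of_nat (Suc k)) - inverse (z + of_nat k)) + norm (euler_mascheroni :: complex)"
    unfolding Digamma_def by (rule norm_triangle_ineq4)
  also have "\<dots> \<le> (1 + norm z) * (pi\<^sup>2 / 6) + euler_mascheroni * (1 + norm z)"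
    using 1 e euler_mascheroni_pos by (intro add_mono) (auto simp: algebra_simps)
  finally show ?thesis by (simp add: algebra_simps)
qed

section \<open>The logarithmic derivative in the left half-plane\<close>

lemma zeta_eq_0_iff_left:
  assumes "Re s < 0"
  shows "zeta s = 0 \<longleftrightarrow> sin (of_real pi * s / 2) = 0"
proof -
  have "Gamma (1 - s) \<noteq> 0" using assms
    by (auto simp: Gamma_eq_zero_iff elim!: nonpos_Ints_cases dest!: arg_cong[of _ _ Re])
  moreover have "zeta (1 - s) \<noteq> 0" using assms by (intro zeta_neq_0_right) auto
  moreover have "(2 * complex_of_real pi) powr (s - 1) \<noteq> 0" by simp
  ultimately show ?thesis using zeta_functional_equation[OF assms] by auto
qed

text \<open>Logarithmic differentiation of the functional equation. The reflection of the argument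
  flips the sign of zeta'/zeta at 1 - s, which is why \<open>mangoldt_series\<close> enters with a
  plus.\<close>

lemma log_deriv_zeta_left:
  assumes s: "Re s < 0" and sin: "sin (of_real pi * s / 2) \<noteq> 0"
  shows "deriv zeta s / zeta s = of_real (ln (2 * pi)) +
    of_real pi / 2 * (cos (of_real pi * s / 2) / sin (of_real pi * s / 2)) - Digamma (1 - s) + mangoldt_series (1 - s)"
proof -
  define E where "E = (\<lambda>s::complex. exp ((s - 1) * of_real (ln (2 * pi))))"
  define S where "S = (\<lambda>s. sin (complex_of_real pi * s / 2))"
  have nI: "1 - s \<notin> \<int>\<^sub>\<le>\<^sub>0" using s by (auto elim!: nonpos_Ints_cases dest!: arg_cong[of _ _ Re])
  have E: "(2 * complex_of_real pi) powr (s - 1) = E s" for s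
    using powr_of_real_exp[of "2 * pi" "s - 1"] by (simp add: E_def)
  have z1: "zeta (1 - s) \<noteq> 0" using s by (intro zeta_neq_0_right) auto
  have dE: "(E has_field_derivative E s * of_real (ln (2 * pi))) (at s)"
    unfolding E_def by (auto intro!: derivative_eq_intros)
  have dS: "(S has_field_derivative cos (of_real pi * s / 2) * (of_real pi / 2)) (at s)"
    unfolding S_def by (auto intro!: derivative_eq_intros)
  have dG: "((\<lambda>s. Gamma (1 - s)) has_field_derivative - (Gamma (1 - s) * Digamma (1 - s))) (at s)"
    using nI by (auto intro!: derivative_eq_intros)
  have dZ: "((\<lambda>s. zeta (1 - s)) has_field_derivative - deriv zeta (1 - s)) (at s)"
  proof -
    have "(zeta has_field_derivative deriv zeta (1 - s)) (at (1 - s))"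
      using s by (intro holomorphic_derivI[OF holomorphic_zeta]) auto
    moreover have "((\<lambda>s. 1 - s) has_field_derivative - 1) (at s)"
      by (auto intro!: derivative_eq_intros)
    ultimately show ?thesis
      using DERIV_chain2[where f = zeta and g = "\<lambda>s. 1 - s" and x = s] by force
  qed
  have D: "((\<lambda>s. 2 * E s * S s * Gamma (1 - s) * zeta (1 - s)) has_field_derivative
      2 * E s * S s * Gamma (1 - s) * (- deriv zeta (1 - s)) +
      (2 * E s * S s * (- (Gamma (1 - s) * Digamma (1 - s))) +
       (2 * E s * (cos (of_real pi * s / 2) * (of_real pi / 2)) + 2 * (E s * of_real (ln (2 * pi))) * S s) * Gamma (1 - s)) *
      zeta (1 - s)) (at s)"
    by (rule DERIV_cong[OF DERIV_mult[OF DERIV_mult[OF DERIV_mult[OF DERIV_cmult[OF dE, of 2] dS] dG] dZ]])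
       (simp add: algebra_simps)
  have "(zeta has_field_derivative
      2 * E s * S s * Gamma (1 - s) * (- deriv zeta (1 - s)) +
      (2 * E s * S s * (- (Gamma (1 - s) * Digamma (1 - s))) +
       (2 * E s * (cos (of_real pi * s / 2) * (of_real pi / 2)) + 2 * (E s * of_real (ln (2 * pi))) * S s) * Gamma (1 - s)) *
      zeta (1 - s)) (at s)"
    by (rule has_field_derivative_transform_within_open[OF D open_halfspace_Re_lt[of 0]])
       (use s in \<open>auto simp: zeta_functional_equation E S_def\<close>)
  hence d: "deriv zeta s =
      2 * E s * S s * Gamma (1 - s) * (- deriv zeta (1 - s)) +
      (2 * E s * S s * (- (Gamma (1 - s) * Digamma (1 - s))) +
       (2 * E s * (cos (of_real pi * s / 2) * (of_real pi / 2)) + 2 * (E s * of_real (ln (2 * pi))) * S s) * Gamma (1 - s)) *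
      zeta (1 - s)" by (rule DERIV_imp_deriv)
  have z: "zeta s = 2 * E s * S s * Gamma (1 - s) * zeta (1 - s)"
    using zeta_functional_equation[OF s] by (simp add: E S_def)
  have nz: "E s \<noteq> 0" "S s \<noteq> 0" "Gamma (1 - s) \<noteq> 0"
    using sin nI by (auto simp: E_def S_def Gamma_eq_zero_iff)
  have m: "mangoldt_series (1 - s) = - (deriv zeta (1 - s) / zeta (1 - s))"
    using log_deriv_zeta_right[of "1 - s"] s by simp
  have "deriv zeta s / zeta s = of_real (ln (2 * pi)) +
     of_real pi / 2 * (cos (of_real pi * s / 2) / S s) - Digamma (1 - s) - deriv zeta (1 - s) / zeta (1 - s)"
    unfolding d z using nz z1 by (simp add: field_simps)
  thus ?thesis unfolding m S_def by simp
qed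

text \<open>Only the cotangent can become large, and the lower bound on the sine controls it.
  Digamma grows at most linearly, and the Dirichlet series at 1 - s is bounded since Re (1 - s)
  \<ge> 3/2. The bound on the sine is verified in two ways below: through a large imaginary part, or
  through the position of Re s between the even integers.\<close>

lemma log_deriv_zeta_left_bound:
  assumes "d > 0"
  obtains C where "C > 0"
    "\<And>s. Re s \<le> -1/2 \<Longrightarrow> norm (sin (of_real pi * s / 2)) \<ge> d \<Longrightarrow>
       zeta s \<noteq> 0 \<and> norm (deriv zeta s / zeta s) \<le> C * (1 + norm s)"
proof -
  define L where "L = (\<Sum>n. mangoldt (Suc n) * real (Suc n) powr (- (3/2)))"
  have L: "L \<ge> 0" unfolding L_def
    by (intro suminf_nonneg mangoldt_powr_summable) (auto simp: mangoldt_nonneg)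
  define G where "G = pi\<^sup>2 / 6 + (euler_mascheroni :: real)"
  have G: "G \<ge> 0" using euler_mascheroni_pos by (simp add: G_def)
  define C where "C = \<bar>ln (2 * pi)\<bar> + pi / 2 * (1 + 1 / d) + 2 * G + L + 1"
  have C: "C > 0" unfolding C_def using assms L G by (intro add_nonneg_pos add_nonneg_nonneg) auto
  show ?thesis
  proof (rule that[OF C])
    fix s assume s: "Re s \<le> -1/2" "norm (sin (of_real pi * s / 2)) \<ge> d"
    have s0: "Re s < 0" using s by simp
    have sin: "sin (of_real pi * s / 2) \<noteq> 0" using s assms by auto
    have z: "zeta s \<noteq> 0" using zeta_eq_0_iff_left[OF s0] sin by simp
    have 1: "norm (of_real pi / 2 * (cos (of_real pi * s / 2) / sin (of_real pi * s / 2))) \<le> pi / 2 * (1 + 1 / d)"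
      unfolding norm_mult using norm_cot_le[OF assms s(2)] by (intro mult_mono) auto
    have "norm (Digamma (1 - s)) \<le> G * (1 + norm (1 - s))"
      unfolding G_def using s by (intro norm_Digamma_le) auto
    also have "\<dots> \<le> G * (2 * (1 + norm s))"
    proof (rule mult_left_mono[OF _ G])
      have "norm (1 - s) \<le> 1 + norm s" using norm_triangle_ineq4[of 1 s] by simp
      also have "\<dots> \<le> 1 + 2 * norm s" by simp
      finally show "1 + norm (1 - s) \<le> 2 * (1 + norm s)" by simp
    qed
    finally have 2: "norm (Digamma (1 - s)) \<le> 2 * G * (1 + norm s)" by (simp add: algebra_simps)
    have 3: "norm (mangoldt_series (1 - s)) \<le> L"
      unfolding L_def using s by (intro norm_mangoldt_series_le) auto
    have "norm (deriv zeta s / zeta s) \<le> norm (complex_of_real (ln (2 * pi))) +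
       norm (of_real pi / 2 * (cos (of_real pi * s / 2) / sin (of_real pi * s / 2))) +
       norm (Digamma (1 - s)) + norm (mangoldt_series (1 - s))"
      unfolding log_deriv_zeta_left[OF s0 sin]
      by (intro norm_triangle_le norm_triangle_le_diff add_mono order_refl)
    also have "\<dots> \<le> \<bar>ln (2 * pi)\<bar> + pi / 2 * (1 + 1 / d) + 2 * G * (1 + norm s) + L"
      using 1 2 3 by (intro add_mono) auto
    also have "\<dots> \<le> (\<bar>ln (2 * pi)\<bar> + pi / 2 * (1 + 1 / d) + L) * (1 + norm s) + 2 * G * (1 + norm s)"
      using L assms mult_left_mono[of 1 "1 + norm s" "\<bar>ln (2 * pi)\<bar> + pi / 2 * (1 + 1 / d) + L"] by simp
    also have "\<dots> \<le> C * (1 + norm s)"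
    proof -
      have "A * x + 2 * G * x \<le> (A + 2 * G + 1) * x" if "x \<ge> 0" for A x :: real
        using that by (simp add: algebra_simps)
      from this[of "1 + norm s" "\<bar>ln (2 * pi)\<bar> + pi / 2 * (1 + 1 / d) + L"] show ?thesis
        by (simp only: C_def add_ac) simp
    qed
    finally show "zeta s \<noteq> 0 \<and> norm (deriv zeta s / zeta s) \<le> C * (1 + norm s)" using z by blast
  qed
qed

section \<open>Trivial and nontrivial zeros\<close>

lemma sin_half_eq_0_iff_left:
  assumes "Re s < 0"
  shows "sin (of_real pi * s / 2) = 0 \<longleftrightarrow> (\<exists>k\<ge>1. s = - 2 * of_nat k)"
proof
  assume "sin (of_real pi * s / 2) = 0"
  then obtain n :: int where "of_real pi * s / 2 = complex_of_real (real_of_int n * pi)"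
    by (auto simp: sin_eq_0)
  hence s: "s = 2 * of_int n" by (simp add: field_simps)
  hence "n < 0" using assms by simp
  hence "s = - 2 * of_nat (nat (- n))" "nat (- n) \<ge> 1" using s by auto
  thus "\<exists>k\<ge>1. s = - 2 * of_nat k" by blast
next
  assume "\<exists>k\<ge>1. s = - 2 * of_nat k"
  then obtain k :: nat where "s = - 2 * of_nat k" by blast
  hence "of_real pi * s / 2 = complex_of_real (real_of_int (- int k) * pi)" by simp
  thus "sin (of_real pi * s / 2) = 0" unfolding sin_eq_0 by blast
qed

lemma nontrivial_zeros_eq:
  "nontrivial_zeros = {\<rho>. 0 \<le> Re \<rho> \<and> Re \<rho> \<le> 1 \<and> \<rho> \<noteq> 1 \<and> zeta \<rho> = 0}"
proof -
  have "0 \<le> Re \<rho> \<and> Re \<rho> \<le> 1" if "\<rho> \<in> nontrivial_zeros" for \<rho>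
  proof -
    have r: "zeta \<rho> = 0" "\<And>k. k \<ge> 1 \<Longrightarrow> \<rho> \<noteq> - 2 * of_nat k"
      using that by (auto simp: nontrivial_zeros_def)
    show ?thesis
      using zeta_neq_0_right[of \<rho>] r zeta_eq_0_iff_left[of \<rho>] sin_half_eq_0_iff_left[of \<rho>] by force
  qed
  moreover have "\<rho> \<noteq> - 2 * of_nat k" if "0 \<le> Re \<rho>" "k \<ge> 1" for \<rho> k
    using that by auto
  ultimately show ?thesis by (auto simp: nontrivial_zeros_def)
qed

text \<open>In the functional equation the sine has a simple zero and the cofactor Q does not
  vanish, so the trivial zeros are simple. Their residues therefore enter the explicit formula with
  weight 1.\<close>

lemma deriv_zeta_trivial_zero:
  assumes "k \<ge> 1"
  shows "zeta (- 2 * of_nat k) = 0" "deriv zeta (- 2 * of_nat k) \<noteq> 0"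
proof -
  define s :: complex where "s = - 2 * of_nat k"
  have s: "Re s < 0" using assms by (simp add: s_def)
  have sin: "sin (of_real pi * s / 2) = 0"
    using sin_half_eq_0_iff_left[OF s] assms s_def by blast
  thus "zeta (- 2 * of_nat k) = 0" using zeta_eq_0_iff_left[OF s] by (simp add: s_def)
  define Q where "Q = (\<lambda>s. 2 * (2 * of_real pi) powr (s - 1) * Gamma (1 - s) * zeta (1 - s))"
  have nI: "1 - z \<notin> \<int>\<^sub>\<le>\<^sub>0" if "Re z < 0" for z
    using that by (auto elim!: nonpos_Ints_cases dest!: arg_cong[of _ _ Re])
  have "zeta \<circ> (\<lambda>s. 1 - s) holomorphic_on {s. Re s < 0}"
    by (rule holomorphic_on_compose_gen[OF _ holomorphic_zeta]) (auto intro!: holomorphic_intros)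
  hence "Q holomorphic_on {s. Re s < 0}"
    unfolding Q_def o_def using nI by (intro holomorphic_intros) auto
  hence dQ: "(Q has_field_derivative deriv Q s) (at s)"
    using s by (intro holomorphic_derivI[OF _ open_halfspace_Re_lt]) auto
  have Qs: "Q s \<noteq> 0"
    using nI[OF s] zeta_neq_0_right[of "1 - s"] s by (auto simp: Q_def Gamma_eq_zero_iff)
  have D: "((\<lambda>s. Q s * sin (of_real pi * s / 2)) has_field_derivative
          Q s * (of_real pi / 2 * cos (of_real pi * s / 2))) (at s)"
    using sin by (auto intro!: derivative_eq_intros dQ)
  have "(zeta has_field_derivative Q s * (of_real pi / 2 * cos (of_real pi * s / 2))) (at s)"
    by (rule has_field_derivative_transform_within_open[OF D open_halfspace_Re_lt[of 0]])
       (use s in \<open>auto simp: zeta_functional_equation Q_def\<close>)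
  hence "deriv zeta s = Q s * (of_real pi / 2 * cos (of_real pi * s / 2))" by (rule DERIV_imp_deriv)
  moreover have "cos (of_real pi * s / 2) \<noteq> 0"
    using sin sin_cos_squared_add[of "of_real pi * s / 2"] by auto
  ultimately have "deriv zeta s \<noteq> 0" using Qs by (simp only: mult_eq_0_iff) auto
  thus "deriv zeta (- 2 * of_nat k) \<noteq> 0" unfolding s_def .
qed

text \<open>The function (s - 1) * zeta s with its removable singularity at 1 filled in.\<close>

definition zeta_reg :: "complex \<Rightarrow> complex" where
  "zeta_reg s = 1 + (s - 1) * (1 / 2 + trap_sum s)"

lemma holomorphic_zeta_reg: "zeta_reg holomorphic_on {s. Re s > -1}"
  unfolding zeta_reg_def[abs_def] by (intro holomorphic_intros holomorphic_trap_sum)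

lemma zeta_reg_eq: "Re s > -1 \<Longrightarrow> s \<noteq> 1 \<Longrightarrow> zeta_reg s = (s - 1) * zeta s"
  by (simp add: zeta_reg_def zeta_eq_right zeta_right_def field_simps)

lemma zeta_reg_1 [simp]: "zeta_reg 1 = 1"
  by (simp add: zeta_reg_def)

text \<open>For B \<ge> 0 the compact box contains the pole at 1, so the zeros are counted for
  \<open>zeta_reg\<close>, which is holomorphic there and has the value 1.\<close>

lemma finite_nontrivial_zeros_bounded: "finite {\<rho> \<in> nontrivial_zeros. \<bar>Im \<rho>\<bar> \<le> B}"
proof -
  let ?S = "{s. Re s > -1}" and ?K = "cbox (Complex 0 (- B)) (Complex 1 B)"
  have K: "?K \<subseteq> ?S" by (auto simp: in_cbox_complex_iff)
  have sub: "{\<rho> \<in> nontrivial_zeros. \<bar>Im \<rho>\<bar> \<le> B} \<subseteq> {z \<in> ?K. zeta_reg z = 0}"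
    using zeta_reg_eq by (auto simp: nontrivial_zeros_eq in_cbox_complex_iff)
  show ?thesis
  proof (cases "zeta_reg constant_on ?S")
    case True
    have "(1::complex) \<in> ?S" by simp
    with True have "zeta_reg z = 1" if "z \<in> ?S" for z
      using that zeta_reg_1 unfolding constant_on_def by metis
    hence "{z \<in> ?K. zeta_reg z = 0} = {}" using K by auto
    hence "finite {z \<in> ?K. zeta_reg z = 0}" by (simp only: finite.emptyI)
    thus ?thesis by (rule finite_subset[OF sub])
  next
    case False
    have "finite {z \<in> ?K. zeta_reg z = 0}"
      by (rule holomorphic_compact_finite_zeros[OF holomorphic_zeta_reg open_halfspace_Re_gt
            convex_connected[OF convex_halfspace_Re_gt] _ K False]) (rule compact_cbox)
    thus ?thesis using sub finite_subset by blast
  qed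
qed

lemma zorder_zeta_pos:
  assumes "\<rho> \<noteq> 1" "zeta \<rho> = 0"
  shows "zorder zeta \<rho> > 0"
proof -
  have "zeta 3 \<noteq> 0" by (rule zeta_neq_0_right) auto
  hence "\<exists>w\<in>- {1}. zeta w \<noteq> 0" by (intro bexI[of _ 3]) auto
  from zorder_exist_zero[OF holomorphic_zeta _ _ _ this, of \<rho>] assms
  show ?thesis using connected_punctured_universe[of "1::complex"] by auto
qed

text \<open>
  Any polynomial bound would do below, since \<open>\<Gamma>\<close> decays faster than every power on vertical lines.
\<close>
lemma zeta_local_bounds:
  obtains K where "K > 0"
    "\<And>T. \<bar>T\<bar> \<ge> 13 \<Longrightarrow> finite {\<rho> \<in> cball (Complex 3 T) 4. zeta \<rho> = 0}"
    "\<And>T. \<bar>T\<bar> \<ge> 13 \<Longrightarrow> (\<Sum>\<rho> | \<rho> \<in> cball (Complex 3 T) 4 \<and> zeta \<rho> = 0. real (nat (zorder zeta \<rho>))) \<le> K * (1 + \<bar>T\<bar>)"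
    "\<And>T s. \<bar>T\<bar> \<ge> 13 \<Longrightarrow> s \<in> cball (Complex 3 T) (18/5) \<Longrightarrow> zeta s \<noteq> 0 \<Longrightarrow>
       norm (deriv zeta s / zeta s - (\<Sum>\<rho> | \<rho> \<in> cball (Complex 3 T) 4 \<and> zeta \<rho> = 0. of_nat (nat (zorder zeta \<rho>)) / (s - \<rho>)))
         \<le> K * (1 + \<bar>T\<bar>)"
proof -
  obtain C where C: "C \<ge> 1" "\<And>s. -9 \<le> Re s \<Longrightarrow> Re s \<le> 15 \<Longrightarrow> \<bar>Im s\<bar> \<ge> 1 \<Longrightarrow> norm (zeta s) \<le> C * exp (2 * \<bar>Im s\<bar>)"
    using zeta_growth by blast
  \<comment> \<open>Chosen so that ln (6 C) + 2 (|T| + 12), the logarithm of the quotient of maximum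
    and central value, is at most B (1 + |T|).\<close>
  define B where "B = ln (6 * C) + 26"
  have lnC: "ln (6 * C) \<ge> 0" using C by simp
  \<comment> \<open>400 = 16 * 4 / (4 - 18/5)^2 is the constant of Landau's lemma for r1 = 4 and r =
    18/5.\<close>
  define K where "K = 400 * (B + 1)"
  have K: "K > 0" using lnC by (simp add: K_def B_def)
  define Z where "Z = (\<lambda>T. {\<rho> \<in> cball (Complex 3 T) 4. zeta \<rho> = 0})"
  have main: "finite (Z T) \<and> (\<Sum>\<rho>\<in>Z T. real (nat (zorder zeta \<rho>))) \<le> K * (1 + \<bar>T\<bar>) \<and>
      (\<forall>s\<in>cball (Complex 3 T) (18/5). zeta s \<noteq> 0 \<longrightarrow>
         norm (deriv zeta s / zeta s - (\<Sum>\<rho>\<in>Z T. of_nat (nat (zorder zeta \<rho>)) / (s - \<rho>))) \<le> K * (1 + \<bar>T\<bar>))"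
    if T: "\<bar>T\<bar> \<ge> 13" for T
  proof -
    define z0 where "z0 = Complex 3 T"
    have ball: "\<bar>Re z - 3\<bar> \<le> 12" "\<bar>Im z - T\<bar> \<le> 12" if "z \<in> cball z0 12" for z
      using that abs_Re_le_cmod[of "z - z0"] abs_Im_le_cmod[of "z - z0"]
      by (auto simp: z0_def dist_norm norm_minus_commute)
    define M where "M = C * exp (2 * (\<bar>T\<bar> + 12))"
    have Im1: "\<bar>Im z\<bar> \<ge> 1" if "z \<in> cball z0 12" for z using ball(2)[OF that] T by linarith
    have sub: "cball z0 12 \<subseteq> - {1}" using Im1 by fastforce
    have con: "connected (- {1 :: complex})" by (rule connected_punctured_universe) auto
    have M: "norm (zeta z) \<le> M" if z: "z \<in> cball z0 12" for z
    proof -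
      have "norm (zeta z) \<le> C * exp (2 * \<bar>Im z\<bar>)"
        using ball[OF z] Im1[OF z] by (intro C(2)) linarith+
      also have "\<dots> \<le> M" unfolding M_def using C(1) ball(2)[OF z] by (intro mult_left_mono) auto
      finally show ?thesis .
    qed
    have z06: "norm (zeta z0) \<ge> 1 / 6" by (rule norm_zeta_ge) (simp add: z0_def)
    hence z0nz: "zeta z0 \<noteq> 0" by auto
    have Mpos: "M > 0" using C(1) by (simp add: M_def)
    have "ln (M / norm (zeta z0)) \<le> ln (M * 6)"
    proof (subst ln_le_cancel_iff)
      have "M / norm (zeta z0) \<le> M / (1 / 6)" using z06 Mpos by (intro divide_left_mono) auto
      thus "M / norm (zeta z0) \<le> M * 6" by simp
    qed (use Mpos z06 z0nz in auto)
    also have "\<dots> = ln (6 * C) + (2 * (\<bar>T\<bar> + 12))"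
      unfolding M_def using C(1) by (simp add: ln_mult)
    also have "\<dots> \<le> B * (1 + \<bar>T\<bar>)"
    proof -
      have "ln (6 * C) + (2 * (\<bar>T\<bar> + 12)) \<le> B + B * \<bar>T\<bar>"
        using mult_right_mono[of 2 B "\<bar>T\<bar>"] lnC by (simp add: B_def)
      thus ?thesis by (simp add: algebra_simps)
    qed
    finally have A: "ln (M / norm (zeta z0)) \<le> B * (1 + \<bar>T\<bar>)" .
    have ZT: "{\<rho> \<in> cball z0 4. zeta \<rho> = 0} = Z T" by (simp add: Z_def z0_def)
    have op: "open (- {1 :: complex})" by auto
    \<comment> \<open>Around 3 + \<i> T, radius 4 catches every zero of the critical strip with |Im
      \<rho> - T| \<le> 1, radius 18/5 reaches past Re s = -1/2 on the horizontal through the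
      centre, and 12 = 3 * 4 is the outer radius. With |T| \<ge> 13 the outer disc stays in |Im s|
      \<ge> 1, off the pole.\<close>
    have r: "(4::real) > 0" "3 * 4 \<le> (12::real)" "0 \<le> (18/5::real)" "18/5 < (4::real)" by auto
    note LL = Landau_log_deriv[where M = M, OF holomorphic_zeta op con sub _ z0nz r, unfolded ZT]
    have f: "finite (Z T)" by (rule LL(1)) (rule M)
    have LL2: "(\<Sum>\<rho>\<in>Z T. real (nat (zorder zeta \<rho>))) * ln 2 \<le> ln (M / norm (zeta z0))"
      by (rule LL(2)) (rule M)
    have "(\<Sum>\<rho>\<in>Z T. real (nat (zorder zeta \<rho>))) * ln 2 \<le> B * (1 + \<bar>T\<bar>)"
      using LL2 A by linarith
    moreover have "ln 2 \<ge> (1/2::real)"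
    proof -
      have "exp (1/2::real) ^ 2 \<le> 4"
        using exp_le by (simp add: exp_double[symmetric])
      hence "exp (1/2::real) \<le> 2" using power2_le_imp_le[of "exp (1/2::real)" 2] by simp
      thus ?thesis using ln_ge_iff[of 2 "1/2"] by simp
    qed
    moreover have "(\<Sum>\<rho>\<in>Z T. real (nat (zorder zeta \<rho>))) \<ge> 0" by (intro sum_nonneg) auto
    ultimately have "(\<Sum>\<rho>\<in>Z T. real (nat (zorder zeta \<rho>))) * (1/2) \<le> B * (1 + \<bar>T\<bar>)"
      by (meson mult_left_mono order_trans)
    moreover have "2 * B * (1 + \<bar>T\<bar>) \<le> K * (1 + \<bar>T\<bar>)"
      using lnC by (intro mult_right_mono) (auto simp: K_def B_def)
    ultimately have g: "(\<Sum>\<rho>\<in>Z T. real (nat (zorder zeta \<rho>))) \<le> K * (1 + \<bar>T\<bar>)" by linarith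
    have bd: "16 * 4 / (4 - 18/5)\<^sup>2 * (ln (M / norm (zeta z0)) + 1) \<le> K * (1 + \<bar>T\<bar>)"
    proof -
      have "16 * 4 / (4 - 18/5)\<^sup>2 * (ln (M / norm (zeta z0)) + 1) = 400 * (ln (M / norm (zeta z0)) + 1)"
        by (simp add: power2_eq_square)
      also have "\<dots> \<le> 400 * (B * (1 + \<bar>T\<bar>) + 1 * (1 + \<bar>T\<bar>))" using A by simp
      also have "\<dots> = K * (1 + \<bar>T\<bar>)" by (simp add: K_def algebra_simps)
      finally show ?thesis .
    qed
    have h: "norm (deriv zeta s / zeta s - (\<Sum>\<rho>\<in>Z T. of_nat (nat (zorder zeta \<rho>)) / (s - \<rho>))) \<le> K * (1 + \<bar>T\<bar>)"
      if "s \<in> cball z0 (18/5)" "zeta s \<noteq> 0" for s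
    proof -
      have "norm (deriv zeta s / zeta s - (\<Sum>\<rho>\<in>Z T. of_nat (nat (zorder zeta \<rho>)) / (s - \<rho>)))
              \<le> 16 * 4 / (4 - 18/5)\<^sup>2 * (ln (M / norm (zeta z0)) + 1)"
        by (rule LL(3)[OF _ that]) (rule M)
      thus ?thesis using bd by (rule order_trans)
    qed
    show ?thesis using f g h by (auto simp: z0_def)
  qed
  show ?thesis
    by (rule that[OF K]) (use main in \<open>auto simp: Z_def\<close>)
qed

section \<open>Distribution of the zeros\<close>

lemma zero_in_strip:
  assumes "zeta \<rho> = 0" "Im \<rho> \<noteq> 0"
  shows "\<rho> \<in> nontrivial_zeros" "0 \<le> Re \<rho>" "Re \<rho> \<le> 1"
proof -
  show *: "\<rho> \<in> nontrivial_zeros" using assms by (auto simp: nontrivial_zeros_def)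
  show "0 \<le> Re \<rho>" "Re \<rho> \<le> 1" using * by (auto simp: nontrivial_zeros_eq)
qed

lemma zero_in_cball:
  assumes "zeta \<rho> = 0" "\<bar>Im \<rho> - t\<bar> \<le> 1" "\<bar>t\<bar> \<ge> 13"
  shows "\<rho> \<in> {\<rho> \<in> cball (Complex 3 t) 4. zeta \<rho> = 0}"
proof -
  have "Im \<rho> \<noteq> 0" using assms by auto
  note strip = zero_in_strip[OF assms(1) this]
  have "norm (Complex 3 t - \<rho>) \<le> \<bar>Re (Complex 3 t - \<rho>)\<bar> + \<bar>Im (Complex 3 t - \<rho>)\<bar>" by (rule cmod_le)
  also have "\<dots> \<le> 3 + 1" using strip assms by (intro add_mono) auto
  finally show ?thesis using assms by (simp add: dist_norm)
qed

lemma nat_zorder_ge_1: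
  assumes "zeta \<rho> = 0" "\<rho> \<noteq> 1"
  shows "real (nat (zorder zeta \<rho>)) \<ge> 1"
  using zorder_zeta_pos[of \<rho>] assms by linarith

text \<open>Among \<open>n + 1\<close> subintervals of equal length one contains none of \<open>n\<close> given points.\<close>
lemma exists_point_away_from_finite:
  fixes Y :: "real set"
  assumes "finite Y"
  obtains t where "a \<le> t" "t \<le> a + 1" "\<And>y. y \<in> Y \<or> y < a \<or> y > a + 1 \<Longrightarrow> \<bar>y - t\<bar> \<ge> 1 / (2 * (real (card Y) + 1))"
proof -
  define n where "n = card Y"
  define f where "f = (\<lambda>y. nat \<lfloor>(y - a) * (real n + 1)\<rfloor>)"
  have "card (f ` Y) < card {0..n}"
    using card_image_le[OF assms, of f] by (simp add: n_def)
  hence "\<not> {0..n} \<subseteq> f ` Y"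
    using assms by (meson card_mono finite_imageI not_less)
  then obtain j where j: "j \<le> n" "j \<notin> f ` Y" by (metis atLeastAtMost_iff subsetI)
  \<comment> \<open>The midpoint of subinterval number j, into which f sends no point of Y. Its
    distance to the ends of [a, a + 1] is at least half a subinterval too, which takes care of the
    points outside.\<close>
  define t where "t = a + (real j + 1/2) / (real n + 1)"
  have e: "(t - a) * (real n + 1) = real j + 1/2" by (simp add: t_def)
  have n1: "real n + 1 > 0" by simp
  have lower: "t \<ge> a + 1 / (2 * (real n + 1))"
    unfolding t_def by (simp add: field_simps)
  have upper: "t \<le> a + 1 - 1 / (2 * (real n + 1))"
  proof -
    have "(real j + 1/2) / (real n + 1) \<le> (real n + 1/2) / (real n + 1)"
      using j(1) by (intro divide_right_mono) auto
    also have "\<dots> = 1 - 1 / (2 * (real n + 1))" by (simp add: field_simps)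
    finally show ?thesis by (simp add: t_def)
  qed
  have pos: "1 / (2 * (real n + 1)) > 0" by simp
  show ?thesis
  proof (rule that[of t])
    show "a \<le> t" "t \<le> a + 1" using lower upper pos by linarith+
    fix y assume y: "y \<in> Y \<or> y < a \<or> y > a + 1"
    show "\<bar>y - t\<bar> \<ge> 1 / (2 * (real (card Y) + 1))"
    proof (rule ccontr)
      assume "\<not> ?thesis"
      hence lt: "\<bar>y - t\<bar> < 1 / (2 * (real n + 1))" by (simp add: n_def)
      hence "y \<ge> a" "y \<le> a + 1" using lower upper by linarith+
      hence "y \<in> Y" using y by auto
      have "\<bar>y - t\<bar> * (real n + 1) < 1 / (2 * (real n + 1)) * (real n + 1)"
        using lt n1 by (rule mult_strict_right_mono)
      also have "1 / (2 * (real n + 1)) * (real n + 1) = 1 / 2" using n1 by (simp add: divide_simps)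
      finally have "\<bar>(y - t) * (real n + 1)\<bar> < 1 / 2" using n1 by (simp only: abs_mult abs_of_pos)
      moreover have "(y - a) * (real n + 1) = (y - t) * (real n + 1) + (real j + 1/2)"
        unfolding e[symmetric] by (simp add: algebra_simps)
      ultimately have "real j < (y - a) * (real n + 1)" "(y - a) * (real n + 1) < real j + 1" by linarith+
      hence "\<lfloor>(y - a) * (real n + 1)\<rfloor> = int j" by linarith
      hence "f y = j" by (simp add: f_def)
      thus False using \<open>y \<in> Y\<close> j(2) by blast
    qed
  qed
qed

text \<open>The zeros with |Im \<rho>| in [k, k + 1] lie in the two discs around 3 + \<i> k and 3 -
  \<i> k, so there are only O(k) of them and some height misses all by a multiple of 1 / k. Working
  with |Im \<rho>| makes the same height serve the upper and the lower side of a rectangle.\<close>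

lemma zero_free_heights:
  obtains K T where "K > 0" "\<And>k::nat. real k \<le> T k \<and> T k \<le> real k + 1"
    "\<And>k \<rho>. k \<ge> 14 \<Longrightarrow> zeta \<rho> = 0 \<Longrightarrow> \<bar>\<bar>Im \<rho>\<bar> - T k\<bar> \<ge> 1 / (K * (1 + real k))"
proof -
  obtain K0 where K0: "K0 > 0"
    "\<And>T. \<bar>T\<bar> \<ge> 13 \<Longrightarrow> finite {\<rho> \<in> cball (Complex 3 T) 4. zeta \<rho> = 0}"
    "\<And>T. \<bar>T\<bar> \<ge> 13 \<Longrightarrow> (\<Sum>\<rho> | \<rho> \<in> cball (Complex 3 T) 4 \<and> zeta \<rho> = 0. real (nat (zorder zeta \<rho>))) \<le> K0 * (1 + \<bar>T\<bar>)"
    "\<And>T s. \<bar>T\<bar> \<ge> 13 \<Longrightarrow> s \<in> cball (Complex 3 T) (18/5) \<Longrightarrow> zeta s \<noteq> 0 \<Longrightarrow>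
       norm (deriv zeta s / zeta s - (\<Sum>\<rho> | \<rho> \<in> cball (Complex 3 T) 4 \<and> zeta \<rho> = 0. of_nat (nat (zorder zeta \<rho>)) / (s - \<rho>)))
         \<le> K0 * (1 + \<bar>T\<bar>)"
    using zeta_local_bounds by blast
  define K where "K = 8 * K0 + 2"
  have card: "real (card {\<rho> \<in> cball (Complex 3 t) 4. zeta \<rho> = 0}) \<le> K0 * (1 + \<bar>t\<bar>)" if "\<bar>t\<bar> \<ge> 13" for t
  proof -
    have "real (card {\<rho> \<in> cball (Complex 3 t) 4. zeta \<rho> = 0}) = (\<Sum>\<rho> | \<rho> \<in> cball (Complex 3 t) 4 \<and> zeta \<rho> = 0. 1)" by simp
    also have "\<dots> \<le> (\<Sum>\<rho> | \<rho> \<in> cball (Complex 3 t) 4 \<and> zeta \<rho> = 0. real (nat (zorder zeta \<rho>)))"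
    proof (rule sum_mono)
      fix \<rho> assume r: "\<rho> \<in> {\<rho> \<in> cball (Complex 3 t) 4. zeta \<rho> = 0}"
      have "\<rho> \<noteq> 1"
      proof
        assume "\<rho> = 1"
        hence "norm (Complex 3 t - 1) \<le> 4" using r by (auto simp: dist_norm)
        hence "\<bar>Im (Complex 3 t - 1)\<bar> \<le> 4" using abs_Im_le_cmod order_trans by blast
        thus False using that by simp
      qed
      thus "1 \<le> real (nat (zorder zeta \<rho>))" using r by (intro nat_zorder_ge_1) auto
    qed
    also have "\<dots> \<le> K0 * (1 + \<bar>t\<bar>)" by (rule K0(3)[OF that])
    finally show ?thesis .
  qed
  have "\<exists>t. real k \<le> t \<and> t \<le> real k + 1 \<and>
      (k \<ge> 14 \<longrightarrow> (\<forall>\<rho>. zeta \<rho> = 0 \<longrightarrow> \<bar>\<bar>Im \<rho>\<bar> - t\<bar> \<ge> 1 / (K * (1 + real k))))" for k :: nat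
  proof (cases "k \<ge> 14")
    case True
    define Z where "Z = {\<rho>. zeta \<rho> = 0 \<and> real k \<le> \<bar>Im \<rho>\<bar> \<and> \<bar>Im \<rho>\<bar> \<le> real k + 1}"
    define A where "A = {\<rho> \<in> cball (Complex 3 (real k)) 4. zeta \<rho> = 0}"
    define B where "B = {\<rho> \<in> cball (Complex 3 (- real k)) 4. zeta \<rho> = 0}"
    have fin: "finite A" "finite B" unfolding A_def B_def using True by (intro K0(2); simp)+
    have sub: "Z \<subseteq> A \<union> B"
    proof
      fix \<rho> assume r: "\<rho> \<in> Z"
      show "\<rho> \<in> A \<union> B"
      proof (cases "Im \<rho> \<ge> 0")
        case True
        hence "\<rho> \<in> A" unfolding A_def using r \<open>k \<ge> 14\<close> by (intro zero_in_cball) (auto simp: Z_def)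
        thus ?thesis by simp
      next
        case False
        hence "\<rho> \<in> B" unfolding B_def using r \<open>k \<ge> 14\<close> by (intro zero_in_cball) (auto simp: Z_def)
        thus ?thesis by simp
      qed
    qed
    hence finZ: "finite Z" using fin finite_subset by blast
    define Y where "Y = (\<lambda>\<rho>. \<bar>Im \<rho>\<bar>) ` Z"
    have finY: "finite Y" using finZ by (simp add: Y_def)
    have "card Y \<le> card Z" unfolding Y_def using finZ by (rule card_image_le)
    also have "card Z \<le> card (A \<union> B)" using sub fin by (intro card_mono) auto
    also have "\<dots> \<le> card A + card B" by (rule card_Un_le)
    finally have "real (card Y) \<le> real (card A) + real (card B)" by linarith
    also have "\<dots> \<le> K0 * (1 + real k) + K0 * (1 + real k)"
      using card[of "real k"] card[of "- real k"] True by (intro add_mono) (auto simp: A_def B_def)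
    finally have cY: "real (card Y) \<le> 2 * K0 * (1 + real k)" by simp
    obtain t where t: "real k \<le> t" "t \<le> real k + 1"
      "\<And>y. y \<in> Y \<or> y < real k \<or> y > real k + 1 \<Longrightarrow> \<bar>y - t\<bar> \<ge> 1 / (2 * (real (card Y) + 1))"
      using exists_point_away_from_finite[OF finY] by blast
    have "1 / (K * (1 + real k)) \<le> 1 / (2 * (real (card Y) + 1))"
    proof (rule divide_left_mono)
      have "2 * (real (card Y) + 1) \<le> 4 * K0 * (1 + real k) + 2 * (1 + real k)" using cY by simp
      also have "\<dots> \<le> 8 * K0 * (1 + real k) + 2 * (1 + real k)"
        using K0(1) by (intro add_mono mult_right_mono) auto
      also have "\<dots> = K * (1 + real k)" by (simp add: K_def algebra_simps)
      finally show "2 * (real (card Y) + 1) \<le> K * (1 + real k)" .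
    qed (use K0(1) in \<open>auto simp: K_def\<close>)
    moreover have "\<bar>Im \<rho>\<bar> \<in> Y \<or> \<bar>Im \<rho>\<bar> < real k \<or> \<bar>Im \<rho>\<bar> > real k + 1" if "zeta \<rho> = 0" for \<rho>
      using that by (auto simp: Y_def Z_def)
    ultimately show ?thesis using t order_trans by blast
  qed (auto intro!: exI[of _ "real k"])
  then obtain T where "\<And>k. real k \<le> T k \<and> T k \<le> real k + 1 \<and>
      (k \<ge> 14 \<longrightarrow> (\<forall>\<rho>. zeta \<rho> = 0 \<longrightarrow> \<bar>\<bar>Im \<rho>\<bar> - T k\<bar> \<ge> 1 / (K * (1 + real k))))" by metis
  moreover have "K > 0" using K0(1) by (simp add: K_def)
  ultimately show ?thesis using that[of K T] by blast
qed

text \<open>Landau's lemma leaves a sum over O(k) zeros, counted with multiplicity, and the choice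
  of the height bounds each term by O(k); this is the square. For Re s \<le> -1/2 the large
  imaginary part keeps the sine away from 0, and the bound for the left half-plane applies.\<close>

lemma log_deriv_zeta_at_heights:
  obtains C T where "C > 0" "\<And>k::nat. real k \<le> T k \<and> T k \<le> real k + 1"
    "\<And>k s. k \<ge> 14 \<Longrightarrow> \<bar>Im s\<bar> = T k \<Longrightarrow> Re s \<le> 3 \<Longrightarrow>
       zeta s \<noteq> 0 \<and> norm (deriv zeta s / zeta s) \<le> C * (1 + norm s)\<^sup>2"
proof -
  obtain K T where K: "K > 0" and T: "\<And>k::nat. real k \<le> T k \<and> T k \<le> real k + 1"
    and zf: "\<And>k \<rho>. k \<ge> 14 \<Longrightarrow> zeta \<rho> = 0 \<Longrightarrow> \<bar>\<bar>Im \<rho>\<bar> - T k\<bar> \<ge> 1 / (K * (1 + real k))"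
    using zero_free_heights by blast
  obtain K0 where K0: "K0 > 0"
    "\<And>T. \<bar>T\<bar> \<ge> 13 \<Longrightarrow> finite {\<rho> \<in> cball (Complex 3 T) 4. zeta \<rho> = 0}"
    "\<And>T. \<bar>T\<bar> \<ge> 13 \<Longrightarrow> (\<Sum>\<rho> | \<rho> \<in> cball (Complex 3 T) 4 \<and> zeta \<rho> = 0. real (nat (zorder zeta \<rho>))) \<le> K0 * (1 + \<bar>T\<bar>)"
    "\<And>T s. \<bar>T\<bar> \<ge> 13 \<Longrightarrow> s \<in> cball (Complex 3 T) (18/5) \<Longrightarrow> zeta s \<noteq> 0 \<Longrightarrow>
       norm (deriv zeta s / zeta s - (\<Sum>\<rho> | \<rho> \<in> cball (Complex 3 T) 4 \<and> zeta \<rho> = 0. of_nat (nat (zorder zeta \<rho>)) / (s - \<rho>)))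
         \<le> K0 * (1 + \<bar>T\<bar>)"
    using zeta_local_bounds by blast
  obtain C1 where C1: "C1 > 0"
    "\<And>s. Re s \<le> -1/2 \<Longrightarrow> norm (sin (of_real pi * s / 2)) \<ge> 1/2 \<Longrightarrow>
       zeta s \<noteq> 0 \<and> norm (deriv zeta s / zeta s) \<le> C1 * (1 + norm s)"
    using log_deriv_zeta_left_bound[of "1/2"] by auto
  define C where "C = C1 + K0 * K + K0"
  have C: "C > 0" using C1(1) K0(1) K by (simp add: C_def add_pos_pos)
  show ?thesis
  proof (rule that[OF C T])
    fix k :: nat and s assume k: "k \<ge> 14" and s: "\<bar>Im s\<bar> = T k" "Re s \<le> 3"
    have Tk: "T k \<ge> 14" using T[of k] k by linarith
    have ns: "real k \<le> norm s" using abs_Im_le_cmod[of s] s T[of k] by linarith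
    show "zeta s \<noteq> 0 \<and> norm (deriv zeta s / zeta s) \<le> C * (1 + norm s)\<^sup>2"
    proof (cases "Re s \<le> -1/2")
      case True
      have "\<bar>Im (of_real pi * s / 2)\<bar> \<ge> 1"
      proof -
        have "1 * 1 \<le> (pi / 2) * \<bar>Im s\<bar>" using pi_ge_two Tk s by (intro mult_mono) auto
        thus ?thesis by (simp add: abs_mult)
      qed
      hence "norm (sin (of_real pi * s / 2)) \<ge> 1/2" by (rule norm_sin_ge_half)
      from C1(2)[OF True this] have 1: "zeta s \<noteq> 0" "norm (deriv zeta s / zeta s) \<le> C1 * (1 + norm s)" by auto
      note 1(2)
      also have "C1 * (1 + norm s) \<le> C * (1 + norm s)\<^sup>2"
      proof (rule mult_mono)
        show "C1 \<le> C" using K0(1) K by (simp add: C_def)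
        show "1 + norm s \<le> (1 + norm s)\<^sup>2" by (rule self_le_power) auto
      qed (use C in auto)
      finally show ?thesis using 1(1) by blast
    next
      case False
      have T13: "\<bar>Im s\<bar> \<ge> 13" using s Tk by simp
      have zs: "zeta s \<noteq> 0"
      proof
        assume "zeta s = 0"
        from zf[OF k this] s have "1 / (K * (1 + real k)) \<le> 0" by simp
        moreover have "1 / (K * (1 + real k)) > 0" using K by simp
        ultimately show False by linarith
      qed
      let ?Z = "{\<rho>. \<rho> \<in> cball (Complex 3 (Im s)) 4 \<and> zeta \<rho> = 0}"
      have "dist (Complex 3 (Im s)) s = \<bar>Re (Complex 3 (Im s) - s)\<bar>"
        by (simp add: dist_norm cmod_def)
      also have "\<dots> \<le> 18/5" using s False by simp
      finally have "s \<in> cball (Complex 3 (Im s)) (18/5)" by simp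
      from K0(4)[OF T13 this zs]
      have a: "norm (deriv zeta s / zeta s - (\<Sum>\<rho>\<in>?Z. of_nat (nat (zorder zeta \<rho>)) / (s - \<rho>))) \<le> K0 * (1 + \<bar>Im s\<bar>)"
        by simp
      have "norm (\<Sum>\<rho>\<in>?Z. of_nat (nat (zorder zeta \<rho>)) / (s - \<rho>)) \<le> (\<Sum>\<rho>\<in>?Z. real (nat (zorder zeta \<rho>)) * (K * (1 + real k)))"
      proof (rule sum_norm_le)
        fix \<rho> assume "\<rho> \<in> ?Z"
        hence "1 / (K * (1 + real k)) \<le> \<bar>\<bar>Im \<rho>\<bar> - \<bar>Im s\<bar>\<bar>" using zf[OF k, of \<rho>] s by simp
        also have "\<dots> \<le> \<bar>Im (s - \<rho>)\<bar>" by simp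
        also have "\<dots> \<le> norm (s - \<rho>)" by (rule abs_Im_le_cmod)
        finally have n: "1 / (K * (1 + real k)) \<le> norm (s - \<rho>)" .
        have p: "1 / (K * (1 + real k)) > 0" using K by simp
        have "norm (of_nat (nat (zorder zeta \<rho>)) / (s - \<rho>)) = real (nat (zorder zeta \<rho>)) / norm (s - \<rho>)"
          by (simp add: norm_divide)
        also have "\<dots> \<le> real (nat (zorder zeta \<rho>)) / (1 / (K * (1 + real k)))"
          using n p by (intro divide_left_mono mult_pos_pos) auto
        finally show "norm (of_nat (nat (zorder zeta \<rho>)) / (s - \<rho>)) \<le> real (nat (zorder zeta \<rho>)) * (K * (1 + real k))"
          by simp
      qed
      also have "\<dots> = (\<Sum>\<rho>\<in>?Z. real (nat (zorder zeta \<rho>))) * (K * (1 + real k))"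
        by (simp add: sum_distrib_right)
      also have "\<dots> \<le> (K0 * (1 + \<bar>Im s\<bar>)) * (K * (1 + real k))"
        using K0(3)[OF T13] K by (intro mult_right_mono) auto
      also have "\<dots> \<le> (K0 * (1 + norm s)) * (K * (1 + norm s))"
        using K0(1) K ns abs_Im_le_cmod[of s] by (intro mult_mono) auto
      finally have b: "norm (\<Sum>\<rho>\<in>?Z. of_nat (nat (zorder zeta \<rho>)) / (s - \<rho>)) \<le> K0 * K * (1 + norm s)\<^sup>2"
        by (simp add: power2_eq_square mult_ac)
      have "norm (deriv zeta s / zeta s) \<le> norm (deriv zeta s / zeta s - (\<Sum>\<rho>\<in>?Z. of_nat (nat (zorder zeta \<rho>)) / (s - \<rho>))) +
              norm (\<Sum>\<rho>\<in>?Z. of_nat (nat (zorder zeta \<rho>)) / (s - \<rho>))"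
        using norm_triangle_ineq[of "deriv zeta s / zeta s - (\<Sum>\<rho>\<in>?Z. of_nat (nat (zorder zeta \<rho>)) / (s - \<rho>))"
             "\<Sum>\<rho>\<in>?Z. of_nat (nat (zorder zeta \<rho>)) / (s - \<rho>)"] by (simp only: diff_add_cancel)
      also have "\<dots> \<le> K0 * (1 + \<bar>Im s\<bar>) + K0 * K * (1 + norm s)\<^sup>2" using a b by (rule add_mono)
      also have "K0 * (1 + \<bar>Im s\<bar>) \<le> K0 * (1 + norm s)\<^sup>2"
      proof (rule mult_left_mono)
        have "1 + \<bar>Im s\<bar> \<le> 1 + norm s" using abs_Im_le_cmod[of s] by simp
        also have "1 + norm s \<le> (1 + norm s)\<^sup>2" by (rule self_le_power) auto
        finally show "1 + \<bar>Im s\<bar> \<le> (1 + norm s)\<^sup>2" .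
      qed (use K0(1) in auto)
      also have "K0 * (1 + norm s)\<^sup>2 + K0 * K * (1 + norm s)\<^sup>2 = (K0 * K + K0) * (1 + norm s)\<^sup>2"
        by (simp only: distrib_right)
      also have "\<dots> \<le> C * (1 + norm s)\<^sup>2"
        using C1(1) by (intro mult_right_mono) (auto simp: C_def)
      finally show ?thesis using zs by simp
    qed
  qed
qed

section \<open>Vertical lines avoiding the trivial zeros\<close>

text \<open>Raising k by 2 shifts the argument by pi and only changes the sign, so everything
  reduces to k = 0 (sine) and k = 1 (cosine).\<close>

lemma abs_sin_shift_ge:
  fixes x :: real
  shows "\<bar>sin (pi * (real k + x) / 2)\<bar> \<ge> min \<bar>sin (pi * x / 2)\<bar> \<bar>cos (pi * x / 2)\<bar>"
proof (induction k arbitrary: x rule: induct_nat_012)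
  case 1
  have "sin (pi * (real 1 + x) / 2) = cos (pi * x / 2)"
    by (simp add: distrib_left add_divide_distrib sin_add)
  thus ?case by simp
next
  case (ge2 n)
  have "pi * (real (Suc (Suc n)) + x) / 2 = pi * (real n + x) / 2 + pi" by (simp add: field_simps)
  thus ?case using ge2(1)[of x] by (simp only: sin_periodic_pi abs_minus_cancel)
qed auto

lemma sin_cos_half_pos:
  fixes x :: real
  assumes "x \<notin> \<int>"
  shows "min \<bar>sin (pi * x / 2)\<bar> \<bar>cos (pi * x / 2)\<bar> > 0"
proof -
  have "sin (pi * x / 2) \<noteq> 0 \<and> cos (pi * x / 2) \<noteq> 0"
  proof (rule ccontr)
    assume "\<not> ?thesis"
    hence "sin (pi * x) = 0" using sin_double[of "pi * x / 2"] by auto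
    then obtain n :: int where "pi * x = real_of_int n * pi" by (auto simp: sin_zero_iff_int2)
    hence "x = real_of_int n" by simp
    thus False using assms by auto
  qed
  thus ?thesis by simp
qed

text \<open>The abscissae -(k + x) keep a fixed distance from the even integers, so one constant
  serves all k. The lemma is needed for the left sides of the rectangles and, with x = \<alpha> - 1,
  for the values of zeta'/zeta in the second series of R.\<close>

lemma log_deriv_zeta_left_arithmetic:
  fixes x :: real
  assumes "x \<notin> \<int>"
  obtains C where "C > 0"
    "\<And>s k. Re s = - (real k + x) \<Longrightarrow> Re s \<le> -1/2 \<Longrightarrow>
       zeta s \<noteq> 0 \<and> norm (deriv zeta s / zeta s) \<le> C * (1 + norm s)"
proof -
  define d where "d = min \<bar>sin (pi * x / 2)\<bar> \<bar>cos (pi * x / 2)\<bar>"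
  have d: "d > 0" unfolding d_def by (rule sin_cos_half_pos[OF assms])
  obtain C where C: "C > 0"
    "\<And>s. Re s \<le> -1/2 \<Longrightarrow> norm (sin (of_real pi * s / 2)) \<ge> d \<Longrightarrow>
       zeta s \<noteq> 0 \<and> norm (deriv zeta s / zeta s) \<le> C * (1 + norm s)"
    using log_deriv_zeta_left_bound[OF d] by blast
  show ?thesis
  proof (rule that[OF C(1)])
    fix s and k :: nat assume s: "Re s = - (real k + x)" "Re s \<le> -1/2"
    have "d \<le> \<bar>sin (pi * (real k + x) / 2)\<bar>" unfolding d_def by (rule abs_sin_shift_ge)
    also have "\<dots> = \<bar>sin (Re (of_real pi * s / 2))\<bar>"
    proof -
      have "Re (of_real pi * s / 2) = pi * Re s / 2" by simp
      also have "\<dots> = - (pi * (real k + x) / 2)"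
        unfolding s(1) by (simp only: mult_minus_right divide_minus_left)
      finally have "Re (of_real pi * s / 2) = - (pi * (real k + x) / 2)" .
      thus ?thesis by (simp only: sin_minus abs_minus_cancel)
    qed
    also have "\<dots> \<le> norm (sin (of_real pi * s / 2))" by (rule norm_sin_ge_sin_Re)
    finally show "zeta s \<noteq> 0 \<and> norm (deriv zeta s / zeta s) \<le> C * (1 + norm s)" by (rule C(2)[OF s(2)])
  qed
qed

section \<open>Absolute convergence over the nontrivial zeros\<close>

text \<open>Grouped by the integer part k of |Im \<rho>|, the zeros of one group have total
  multiplicity O(k), so the cubic decay of g leaves a multiple of the sum of 1 / (k + 1)^2, which
  bounds all finite partial sums. Below height 14 there are only finitely many zeros.\<close>

lemma zero_sum_summable:
  fixes g :: "complex \<Rightarrow> complex"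
  assumes g: "\<And>\<rho>. \<rho> \<in> nontrivial_zeros \<Longrightarrow> \<bar>Im \<rho>\<bar> \<ge> 14 \<Longrightarrow> norm (g \<rho>) \<le> C / (1 + \<bar>Im \<rho>\<bar>) ^ 3"
  shows "(\<lambda>\<rho>. of_int (zorder zeta \<rho>) * g \<rho>) summable_on nontrivial_zeros"
proof -
  define A where "A = {\<rho> \<in> nontrivial_zeros. \<bar>Im \<rho>\<bar> \<le> 14}"
  define B where "B = {\<rho> \<in> nontrivial_zeros. \<bar>Im \<rho>\<bar> > 14}"
  obtain K0 where K0: "K0 > 0"
    "\<And>T. \<bar>T\<bar> \<ge> 13 \<Longrightarrow> finite {\<rho> \<in> cball (Complex 3 T) 4. zeta \<rho> = 0}"
    "\<And>T. \<bar>T\<bar> \<ge> 13 \<Longrightarrow> (\<Sum>\<rho> | \<rho> \<in> cball (Complex 3 T) 4 \<and> zeta \<rho> = 0. real (nat (zorder zeta \<rho>))) \<le> K0 * (1 + \<bar>T\<bar>)"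
    "\<And>T s. \<bar>T\<bar> \<ge> 13 \<Longrightarrow> s \<in> cball (Complex 3 T) (18/5) \<Longrightarrow> zeta s \<noteq> 0 \<Longrightarrow>
       norm (deriv zeta s / zeta s - (\<Sum>\<rho> | \<rho> \<in> cball (Complex 3 T) 4 \<and> zeta \<rho> = 0. of_nat (nat (zorder zeta \<rho>)) / (s - \<rho>)))
         \<le> K0 * (1 + \<bar>T\<bar>)"
    using zeta_local_bounds by blast
  define h where "h = (\<lambda>\<rho>. of_int (zorder zeta \<rho>) * g \<rho>)"
  define m where "m = (\<lambda>\<rho>. real (nat (zorder zeta \<rho>)))"
  have hle: "norm (h \<rho>) \<le> m \<rho> * (\<bar>C\<bar> / (1 + \<bar>Im \<rho>\<bar>) ^ 3)" if "\<rho> \<in> B" for \<rho>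
  proof -
    have "zorder zeta \<rho> > 0" using that by (intro zorder_zeta_pos) (auto simp: B_def nontrivial_zeros_eq)
    hence "norm (h \<rho>) = m \<rho> * norm (g \<rho>)" by (simp add: h_def m_def norm_mult)
    also have "norm (g \<rho>) \<le> C / (1 + \<bar>Im \<rho>\<bar>) ^ 3" using that by (intro g) (auto simp: B_def)
    also have "\<dots> \<le> \<bar>C\<bar> / (1 + \<bar>Im \<rho>\<bar>) ^ 3" by (intro divide_right_mono) auto
    finally show ?thesis by (simp add: m_def mult_left_mono)
  qed
  define S where "S = (\<Sum>k. 2 * K0 * \<bar>C\<bar> * (1 / (real (Suc k))\<^sup>2))"
  have sq: "summable (\<lambda>k. 2 * K0 * \<bar>C\<bar> * (1 / (real (Suc k))\<^sup>2))"
    using inverse_squares_sums by (intro summable_mult) (auto simp: sums_iff add_ac)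
  have "(\<lambda>\<rho>. norm (h \<rho>)) summable_on B"
  proof (rule nonneg_bdd_above_summable_on)
    show "bdd_above (sum (\<lambda>\<rho>. norm (h \<rho>)) ` {F. F \<subseteq> B \<and> finite F})"
    proof (rule bdd_aboveI2)
      fix F assume "F \<in> {F. F \<subseteq> B \<and> finite F}"
      hence F: "F \<subseteq> B" "finite F" by auto
      define w where "w = (\<lambda>\<rho>. nat \<lfloor>\<bar>Im \<rho>\<bar>\<rfloor>)"
      obtain N where N: "w ` F \<subseteq> {..<N}" using F(2) finite_nat_bounded[of "w ` F"] by auto
      have "(\<Sum>\<rho>\<in>F. norm (h \<rho>)) = (\<Sum>k<N. \<Sum>\<rho> | \<rho> \<in> F \<and> w \<rho> = k. norm (h \<rho>))"
        using F N by (intro sum.group[symmetric]) auto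
      also have "\<dots> \<le> (\<Sum>k<N. 2 * K0 * \<bar>C\<bar> * (1 / (real (Suc k))\<^sup>2))"
      proof (rule sum_mono)
        fix k assume "k \<in> {..<N}"
        let ?F = "{\<rho>. \<rho> \<in> F \<and> w \<rho> = k}"
        show "(\<Sum>\<rho>\<in>?F. norm (h \<rho>)) \<le> 2 * K0 * \<bar>C\<bar> * (1 / (real (Suc k))\<^sup>2)"
        proof (cases "k \<ge> 14")
          case False
          have "\<rho> \<notin> ?F" for \<rho>
          proof
            assume "\<rho> \<in> ?F"
            hence "\<bar>Im \<rho>\<bar> > 14" "w \<rho> = k" using F by (auto simp: B_def)
            thus False using False unfolding w_def by linarith
          qed
          hence "?F = {}" by blast
          thus ?thesis using K0(1) by (simp only: sum.empty) simp
        next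
          case True
          define P where "P = {\<rho> \<in> cball (Complex 3 (real k)) 4. zeta \<rho> = 0}"
          define Q where "Q = {\<rho> \<in> cball (Complex 3 (- real k)) 4. zeta \<rho> = 0}"
          have fin: "finite P" "finite Q" unfolding P_def Q_def using True by (intro K0(2); simp)+
          have sub: "?F \<subseteq> P \<union> Q"
          proof
            fix \<rho> assume r: "\<rho> \<in> ?F"
            hence z: "zeta \<rho> = 0" using F by (auto simp: B_def nontrivial_zeros_def)
            have wk: "real k \<le> \<bar>Im \<rho>\<bar>" "\<bar>Im \<rho>\<bar> < real k + 1" using r unfolding w_def by auto
            show "\<rho> \<in> P \<union> Q"
            proof (cases "Im \<rho> \<ge> 0")
              case True
              hence "\<rho> \<in> P" unfolding P_def using z wk \<open>k \<ge> 14\<close> by (intro zero_in_cball) auto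
              thus ?thesis by simp
            next
              case False
              hence "\<rho> \<in> Q" unfolding Q_def using z wk \<open>k \<ge> 14\<close> by (intro zero_in_cball) auto
              thus ?thesis by simp
            qed
          qed
          have "(\<Sum>\<rho>\<in>?F. norm (h \<rho>)) \<le> (\<Sum>\<rho>\<in>?F. m \<rho> * (\<bar>C\<bar> / (real (Suc k)) ^ 3))"
          proof (rule sum_mono)
            fix \<rho> assume r: "\<rho> \<in> ?F"
            have wk: "real k \<le> \<bar>Im \<rho>\<bar>" using r unfolding w_def by auto
            have "norm (h \<rho>) \<le> m \<rho> * (\<bar>C\<bar> / (1 + \<bar>Im \<rho>\<bar>) ^ 3)" using r F by (intro hle) auto
            also have "\<dots> \<le> m \<rho> * (\<bar>C\<bar> / (real (Suc k)) ^ 3)"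
              using wk by (intro mult_left_mono divide_left_mono power_mono mult_pos_pos zero_less_power) (auto simp: m_def)
            finally show "norm (h \<rho>) \<le> m \<rho> * (\<bar>C\<bar> / (real (Suc k)) ^ 3)" .
          qed
          also have "\<dots> \<le> (\<Sum>\<rho>\<in>P \<union> Q. m \<rho> * (\<bar>C\<bar> / (real (Suc k)) ^ 3))"
            using sub fin by (intro sum_mono2) (auto simp: m_def)
          also have "\<dots> = (\<Sum>\<rho>\<in>P \<union> Q. m \<rho>) * (\<bar>C\<bar> / (real (Suc k)) ^ 3)"
            by (rule sum_distrib_right[symmetric])
          also have "(\<Sum>\<rho>\<in>P \<union> Q. m \<rho>) \<le> (\<Sum>\<rho>\<in>P. m \<rho>) + (\<Sum>\<rho>\<in>Q. m \<rho>)"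
            using sum.union_inter[OF fin, of m] sum_nonneg[of "P \<inter> Q" m] by (simp add: m_def)
          also have "\<dots> \<le> K0 * (1 + real k) + K0 * (1 + real k)"
            using K0(3)[of "real k"] K0(3)[of "- real k"] True by (intro add_mono) (auto simp: P_def Q_def m_def)
          finally have "(\<Sum>\<rho>\<in>?F. norm (h \<rho>)) \<le> (K0 * (1 + real k) + K0 * (1 + real k)) * (\<bar>C\<bar> / (real (Suc k)) ^ 3)"
            by (simp add: divide_right_mono mult_right_mono)
          also have "\<dots> = 2 * K0 * \<bar>C\<bar> * (real (Suc k) / (real (Suc k)) ^ 3)" by (simp add: field_simps)
          also have "real (Suc k) / (real (Suc k)) ^ 3 = 1 / (real (Suc k))\<^sup>2"
            by (simp add: power2_eq_square power3_eq_cube)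
          finally show ?thesis .
        qed
      qed
      also have "\<dots> \<le> S" unfolding S_def
        using K0(1) by (intro sum_le_suminf sq) auto
      finally show "(\<Sum>\<rho>\<in>F. norm (h \<rho>)) \<le> S" .
    qed
  qed auto
  hence "h summable_on B" by (rule Infinite_Sum.abs_summable_summable)
  moreover have "h summable_on A"
    using finite_nontrivial_zeros_bounded[of 14] by (intro summable_on_finite) (simp add: A_def)
  ultimately have "h summable_on (A \<union> B)" by (intro summable_on_Un_disjoint) (auto simp: A_def B_def)
  also have "A \<union> B = nontrivial_zeros" by (auto simp: A_def B_def)
  finally show ?thesis by (simp add: h_def)
qed

section \<open>Residues and rectangular contours\<close>

text \<open>An integer exponent n treats zeros (n the multiplicity) and the pole at 1 (n = -1) in
  one go. Near z the function equals (p'/p * (w - z) + n) * H / (w - z), whose numerator is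
  holomorphic.\<close>

lemma residue_log_deriv_times:
  assumes r: "r > 0" and p: "p holomorphic_on ball z r" "p z \<noteq> 0"
    and H: "H holomorphic_on ball z r"
    and f: "\<And>w. w \<in> ball z r - {z} \<Longrightarrow> f w = p w * (w - z) powi n"
  shows "residue (\<lambda>s. deriv f s / f s * H s) z = of_int n * H z"
proof -
  have "continuous_on (ball z r) p" using p(1) by (rule holomorphic_on_imp_continuous_on)
  hence "isCont p z" using r by (simp add: continuous_on_eq_continuous_at)
  then obtain e where e: "e > 0" "\<And>w. dist z w < e \<Longrightarrow> p w \<noteq> 0"
    using continuous_at_avoid[of z p 0] p(2) by blast
  define d where "d = min r e"
  have d: "d > 0" "ball z d \<subseteq> ball z r" "\<And>w. w \<in> ball z d \<Longrightarrow> p w \<noteq> 0"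
    using r e by (auto simp: d_def)
  have pd: "p holomorphic_on ball z d" and Hd: "H holomorphic_on ball z d"
    using p H d(2) holomorphic_on_subset by blast+
  define q where "q = (\<lambda>w. (deriv p w / p w * (w - z) + of_int n) * H w)"
  have q: "q holomorphic_on ball z d"
    unfolding q_def using d(3) by (intro holomorphic_intros pd Hd) auto
  have eq: "deriv f w / f w * H w = q w / (w - z)" if w: "w \<in> ball z d - {z}" for w
  proof -
    have wz: "w \<noteq> z" "p w \<noteq> 0" using w d by auto
    have "open (ball z r - {z})" by auto
    have dp: "(p has_field_derivative deriv p w) (at w)"
      using w d by (intro holomorphic_derivI[OF p(1)]) auto
    have "((\<lambda>w. p w * (w - z) powi n) has_field_derivative
            deriv p w * (w - z) powi n + p w * (of_int n * (w - z) powi (n - 1))) (at w)"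
      using wz by (auto intro!: derivative_eq_intros dp simp: algebra_simps)
    hence "(f has_field_derivative
            deriv p w * (w - z) powi n + p w * (of_int n * (w - z) powi (n - 1))) (at w)"
      by (rule has_field_derivative_transform_within_open[OF _ \<open>open (ball z r - {z})\<close>])
         (use w d f in auto)
    hence "deriv f w = deriv p w * (w - z) powi n + p w * (of_int n * (w - z) powi (n - 1))"
      by (rule DERIV_imp_deriv)
    also have "(w - z) powi (n - 1) = (w - z) powi n / (w - z)"
      using wz by (simp add: power_int_diff)
    finally have "deriv f w = deriv p w * (w - z) powi n + p w * (of_int n * ((w - z) powi n / (w - z)))" .
    note dfw = this
    have "deriv f w = p w * (w - z) powi n * (deriv p w / p w + of_int n / (w - z))"
    proof -
      have "A * Q + B * (N * (Q / Z)) = B * Q * (A / B + N / Z)" if "B \<noteq> 0" for A B N Q Z :: complex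
        using that by (simp add: distrib_left)
      thus ?thesis using wz(2) dfw by simp
    qed
    moreover have "f w = p w * (w - z) powi n" using w d by (intro f) auto
    moreover have "p w * (w - z) powi n \<noteq> 0" using wz by simp
    ultimately have "deriv f w / f w = deriv p w / p w + of_int n / (w - z)" by simp
    also have "\<dots> = (deriv p w / p w * (w - z) + of_int n) / (w - z)"
      using wz by (simp add: add_divide_distrib)
    finally show ?thesis by (simp add: q_def)
  qed
  have "eventually (\<lambda>w. w \<in> ball z d - {z}) (at z)"
    using d(1) eventually_at_in_open'[of "ball z d" z] by (auto elim!: eventually_mono simp: eventually_at_filter intro: eventually_at_in_open)
  hence "eventually (\<lambda>w. deriv f w / f w * H w = q w / (w - z)) (at z)"
    by eventually_elim (rule eq)
  hence "residue (\<lambda>s. deriv f s / f s * H s) z = residue (\<lambda>w. q w / (w - z)) z"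
    by (intro residue_cong refl)
  also have "\<dots> = q z" using d(1) by (intro residue_simple[OF open_ball _ q]) auto
  finally show ?thesis by (simp add: q_def)
qed

lemma contour_integral_rectpath_split:
  assumes "continuous_on (path_image (rectpath a b)) f" "Re a \<le> Re b" "Im a \<le> Im b"
  shows "contour_integral (rectpath a b) f =
    contour_integral (linepath a (Complex (Re b) (Im a))) f +
    contour_integral (linepath (Complex (Re b) (Im a)) b) f +
    contour_integral (linepath b (Complex (Re a) (Im b))) f +
    contour_integral (linepath (Complex (Re a) (Im b)) a) f"
proof -
  have "f contour_integrable_on linepath a (Complex (Re b) (Im a))"
    "f contour_integrable_on linepath (Complex (Re b) (Im a)) b"
    "f contour_integrable_on linepath b (Complex (Re a) (Im b))"
    "f contour_integrable_on linepath (Complex (Re a) (Im b)) a"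
    by (intro contour_integrable_continuous_linepath continuous_on_subset[OF assms(1)];
        auto simp: rectpath_def Let_def path_image_join)+
  thus ?thesis by (simp add: rectpath_def Let_def contour_integrable_join valid_path_join add_ac)
qed

section \<open>Shifting the line of integration\<close>

text \<open>The left, upper and lower sides lie outside the disc of radius k, so G is O(k^-2) on
  them, while their total length is O(k). What survives of the residue theorem is the right
  side.\<close>

lemma rectangle_residue_limit:
  fixes X T :: "nat \<Rightarrow> real" and c :: real
  assumes hol: "G holomorphic_on - P" and fin: "\<And>B. finite {p \<in> P. norm p \<le> B}"
    and X: "\<And>k. real k \<le> X k \<and> X k \<le> real k + 1" and T: "\<And>k. real k \<le> T k \<and> T k \<le> real k + 1"
    and right: "\<And>s. Re s = c \<Longrightarrow> s \<notin> P"
    and bound: "\<And>k s. k \<ge> k0 \<Longrightarrow> Re s \<le> c \<Longrightarrow> \<bar>Im s\<bar> = T k \<or> Re s = - X k \<Longrightarrow>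
       s \<notin> P \<and> norm (G s) \<le> C / (1 + norm s)\<^sup>2"
  shows "(\<lambda>k. contour_integral (linepath (Complex c (- T k)) (Complex c (T k))) G -
     2 * of_real pi * \<i> * (\<Sum>p \<in> P \<inter> box (Complex (- X k) (- T k)) (Complex c (T k)). residue G p)) \<longlonglongrightarrow> 0"
proof -
  define F where "F = (\<lambda>k. contour_integral (linepath (Complex c (- T k)) (Complex c (T k))) G -
     2 * of_real pi * \<i> * (\<Sum>p \<in> P \<inter> box (Complex (- X k) (- T k)) (Complex c (T k)). residue G p))"
  have "norm (F k) \<le> \<bar>C\<bar> / (1 + real k)\<^sup>2 * (4 * (1 + real k) + 2 * \<bar>c\<bar>)"
    if k: "k \<ge> k0" "real k \<ge> \<bar>c\<bar>" "k \<ge> 1" for k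
  proof -
    define a where "a = Complex (- X k) (- T k)"
    define b where "b = Complex c (T k)"
    have Xk: "X k \<ge> \<bar>c\<bar>" "T k > 0" "X k > 0" using X[of k] T[of k] k by linarith+
    have ab: "Re a \<le> Re b" "Im a \<le> Im b" "Re a = - X k" "Re b = c" "Im a = - T k" "Im b = T k"
      using Xk by (auto simp: a_def b_def)
    have nP: "s \<notin> P" if "s \<in> path_image (rectpath a b)" for s
    proof (cases "Re s = c")
      case True thus ?thesis by (rule right)
    next
      case False
      with that have "Re s \<le> c" "\<bar>Im s\<bar> = T k \<or> Re s = - X k"
        using ab Xk by (auto simp: path_image_rectpath)
      thus ?thesis using bound[OF k(1)] by blast
    qed
    have cont: "continuous_on (path_image (rectpath a b)) G"
      using nP by (intro holomorphic_on_imp_continuous_on holomorphic_on_subset[OF hol]) auto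
    \<comment> \<open>A slightly larger open box, because the residue theorem wants the contour
      inside an open connected set with finitely many singularities. Those in S outside the
      rectangle have winding number 0.\<close>
    define S where "S = box (a - Complex 1 1) (b + Complex 1 1)"
    have sub: "cbox a b \<subseteq> S" by (auto simp: S_def in_cbox_complex_iff in_box_complex_iff)
    have "bounded S" unfolding S_def by (rule bounded_box)
    then obtain B where B: "\<And>s. s \<in> S \<Longrightarrow> norm s \<le> B" by (auto simp: bounded_iff)
    have finS: "finite (P \<inter> S)" by (rule finite_subset[OF _ fin[of B]]) (use B in auto)
    have "contour_integral (rectpath a b) G =
       2 * pi * \<i> * (\<Sum>p\<in>P \<inter> S. winding_number (rectpath a b) p * residue G p)"
    proof (rule Residue_theorem)
      show "open S" "connected S" by (auto simp: S_def intro: convex_connected convex_box)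
      show "G holomorphic_on S - P \<inter> S" by (rule holomorphic_on_subset[OF hol]) auto
      show "path_image (rectpath a b) \<subseteq> S - P \<inter> S"
        using nP path_image_rectpath_subset_cbox[OF ab(1,2)] sub by blast
      show "\<forall>z. z \<notin> S \<longrightarrow> winding_number (rectpath a b) z = 0"
        using sub winding_number_rectpath_outside[OF ab(1,2)] by blast
    qed (use finS in auto)
    also have "(\<Sum>p\<in>P \<inter> S. winding_number (rectpath a b) p * residue G p) = (\<Sum>p\<in>P \<inter> box a b. residue G p)"
    proof (rule sum.mono_neutral_cong_right[OF finS])
      show "P \<inter> box a b \<subseteq> P \<inter> S" using sub box_subset_cbox[of a b] by blast
      show "\<forall>p\<in>P \<inter> S - P \<inter> box a b. winding_number (rectpath a b) p * residue G p = 0"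
      proof
        fix p assume p: "p \<in> P \<inter> S - P \<inter> box a b"
        hence "p \<notin> path_image (rectpath a b)" using nP by blast
        hence "p \<notin> cbox a b" using p by (auto simp: path_image_rectpath_cbox_minus_box[OF ab(1,2)])
        thus "winding_number (rectpath a b) p * residue G p = 0"
          by (simp add: winding_number_rectpath_outside[OF ab(1,2)])
      qed
    qed (auto simp: winding_number_rectpath)
    finally have eq: "contour_integral (rectpath a b) G = 2 * pi * \<i> * (\<Sum>p\<in>P \<inter> box a b. residue G p)" .
    define D where "D = \<bar>C\<bar> / (1 + real k)\<^sup>2"
    have D: "D \<ge> 0" by (simp add: D_def)
    have bd: "norm (contour_integral (linepath u v) G) \<le> D * norm (v - u)"
      if uv: "closed_segment u v \<subseteq> path_image (rectpath a b)"
        "\<And>s. s \<in> closed_segment u v \<Longrightarrow> \<bar>Im s\<bar> = T k \<or> Re s = - X k" for u v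
    proof (rule contour_integral_bound_linepath)
      show "G contour_integrable_on linepath u v"
        by (intro contour_integrable_continuous_linepath continuous_on_subset[OF cont] uv(1))
      fix s assume s: "s \<in> closed_segment u v"
      hence "Re s \<le> c" using uv(1) path_image_rectpath_subset_cbox[OF ab(1,2)] ab
        by (auto simp: in_cbox_complex_iff)
      hence "norm (G s) \<le> C / (1 + norm s)\<^sup>2" using bound[OF k(1) _ uv(2)[OF s]] by blast
      also have "\<dots> \<le> \<bar>C\<bar> / (1 + norm s)\<^sup>2" by (intro divide_right_mono) auto
      also have "\<dots> \<le> D"
      proof -
        have "norm s \<ge> real k"
          using uv(2)[OF s] X[of k] T[of k] abs_Re_le_cmod[of s] abs_Im_le_cmod[of s] by fastforce
        thus ?thesis unfolding D_def
          by (intro divide_left_mono power_mono mult_pos_pos zero_less_power) auto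
      qed
      finally show "norm (G s) \<le> D" .
    qed (rule D)
    let ?br = "Complex c (- T k)" and ?tl = "Complex (- X k) (T k)"
    have split: "contour_integral (rectpath a b) G = contour_integral (linepath a ?br) G +
        contour_integral (linepath ?br b) G + contour_integral (linepath b ?tl) G + contour_integral (linepath ?tl a) G"
      using contour_integral_rectpath_split[OF cont ab(1,2)] ab by simp
    have pi: "path_image (rectpath a b) = closed_segment a ?br \<union> closed_segment ?br b \<union> closed_segment b ?tl \<union> closed_segment ?tl a"
      using ab by (simp add: rectpath_def Let_def path_image_join Un_assoc)
    have 1: "norm (contour_integral (linepath a ?br) G) \<le> D * norm (?br - a)"
      by (rule bd, use pi in blast) (use Xk in \<open>auto simp: a_def closed_segment_same_Im\<close>)
    have 2: "norm (contour_integral (linepath b ?tl) G) \<le> D * norm (?tl - b)"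
      by (rule bd, use pi in blast) (use Xk in \<open>auto simp: b_def closed_segment_same_Im\<close>)
    have 3: "norm (contour_integral (linepath ?tl a) G) \<le> D * norm (a - ?tl)"
      by (rule bd) (use pi in \<open>auto simp: a_def closed_segment_same_Re\<close>)
    have "?br - a = of_real (c + X k)" "?tl - b = - of_real (c + X k)" "a - ?tl = - (\<i> * of_real (2 * T k))"
      by (auto simp: a_def b_def complex_eq_iff)
    hence n: "norm (?br - a) = c + X k" "norm (?tl - b) = c + X k" "norm (a - ?tl) = 2 * T k"
      using Xk by (simp_all only: norm_minus_cancel norm_mult norm_of_real norm_ii)
    have "F k = contour_integral (linepath ?br b) G - contour_integral (rectpath a b) G"
      unfolding F_def eq by (simp add: a_def b_def)
    also have "\<dots> = - (contour_integral (linepath a ?br) G + contour_integral (linepath b ?tl) G + contour_integral (linepath ?tl a) G)"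
      unfolding split by simp
    finally have "norm (F k) \<le> norm (contour_integral (linepath a ?br) G) +
        norm (contour_integral (linepath b ?tl) G) + norm (contour_integral (linepath ?tl a) G)"
      by (simp only: norm_minus_cancel) (intro norm_triangle_le add_mono norm_triangle_ineq order_refl)
    also have "\<dots> \<le> D * (c + X k) + D * (c + X k) + D * (2 * T k)"
      using 1 2 3 unfolding n by (intro add_mono)
    also have "\<dots> = D * (2 * c + 2 * X k + 2 * T k)" by (simp add: algebra_simps)
    also have "\<dots> \<le> D * (4 * (1 + real k) + 2 * \<bar>c\<bar>)"
    proof (rule mult_left_mono[OF _ D])
      have "X k \<le> real k + 1" "T k \<le> real k + 1" "c \<le> \<bar>c\<bar>" using X[of k] T[of k] by auto
      thus "2 * c + 2 * X k + 2 * T k \<le> 4 * (1 + real k) + 2 * \<bar>c\<bar>" by (simp add: algebra_simps)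
    qed
    finally show ?thesis by (simp add: D_def)
  qed
  note F_le = this
  have "eventually (\<lambda>k. norm (F k) \<le> \<bar>C\<bar> / (1 + real k)\<^sup>2 * (4 * (1 + real k) + 2 * \<bar>c\<bar>)) sequentially"
    using eventually_ge_at_top[of k0] eventually_ge_at_top[of "nat \<lceil>\<bar>c\<bar>\<rceil>"] eventually_ge_at_top[of 1]
    by eventually_elim (rule F_le, auto simp: nat_le_iff ceiling_le_iff)
  moreover have "(\<lambda>k. \<bar>C\<bar> / (1 + real k)\<^sup>2 * (4 * (1 + real k) + 2 * \<bar>c\<bar>)) \<longlonglongrightarrow> 0"
    by real_asymp
  ultimately have "F \<longlonglongrightarrow> 0" by (rule Lim_null_comparison)
  thus ?thesis unfolding F_def .
qed

text \<open>\<open>Gamma_decay\<close> for a translated argument, by 1 + |s| \<le> (1 + |\<beta>|)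
  (1 + |s + \<beta>|).\<close>

lemma kernel_decay:
  fixes \<beta> d l :: real and m :: nat
  assumes d: "d > 0"
  obtains C where "C > 0"
    "\<And>s. Re s \<le> c \<Longrightarrow> (\<And>n::nat. norm (s + of_real \<beta> + of_nat n) \<ge> d) \<Longrightarrow>
       norm (exp (of_real l * s) * Gamma (s + of_real \<beta>)) \<le> C / (1 + norm s) ^ m"
proof -
  obtain C0 where C0: "C0 > 0" "\<And>s. Re s \<le> c + \<beta> \<Longrightarrow> (\<And>n::nat. norm (s + of_nat n) \<ge> d) \<Longrightarrow>
            norm (Gamma s) * exp (l * Re s) \<le> C0 / (1 + norm s) ^ m"
    using Gamma_decay[OF d, of "c + \<beta>" l m] by blast
  define C where "C = exp (- l * \<beta>) * C0 * (1 + \<bar>\<beta>\<bar>) ^ m"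
  have C: "C > 0" using C0(1) by (simp add: C_def add_pos_nonneg)
  show ?thesis
  proof (rule that[OF C])
    fix s assume s: "Re s \<le> c" "\<And>n::nat. norm (s + of_real \<beta> + of_nat n) \<ge> d"
    have g: "norm (Gamma (s + of_real \<beta>)) * exp (l * Re (s + of_real \<beta>)) \<le> C0 / (1 + norm (s + of_real \<beta>)) ^ m"
      using s by (intro C0(2)) auto
    have "norm (exp (of_real l * s)) = exp (l * Re s)" by (simp add: norm_exp_eq_Re)
    also have "\<dots> = exp (- l * \<beta>) * exp (l * Re (s + of_real \<beta>))"
      by (simp flip: exp_add add: algebra_simps)
    finally have "norm (exp (of_real l * s) * Gamma (s + of_real \<beta>)) =
        exp (- l * \<beta>) * (norm (Gamma (s + of_real \<beta>)) * exp (l * Re (s + of_real \<beta>)))"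
      by (simp add: norm_mult)
    also have "\<dots> \<le> exp (- l * \<beta>) * (C0 / (1 + norm (s + of_real \<beta>)) ^ m)"
      using g by (intro mult_left_mono) auto
    also have "\<dots> \<le> exp (- l * \<beta>) * (C0 * (1 + \<bar>\<beta>\<bar>) ^ m / (1 + norm s) ^ m)"
    proof (intro mult_left_mono)
      have "norm s \<le> norm (s + of_real \<beta>) + \<bar>\<beta>\<bar>"
        using norm_triangle_ineq4[of "s + of_real \<beta>" "of_real \<beta>"] by simp
      moreover have "0 \<le> \<bar>\<beta>\<bar> * norm (s + of_real \<beta>)" by simp
      ultimately have "1 + norm s \<le> 1 + norm (s + of_real \<beta>) + \<bar>\<beta>\<bar> + \<bar>\<beta>\<bar> * norm (s + of_real \<beta>)"
        by linarith
      also have "\<dots> = (1 + \<bar>\<beta>\<bar>) * (1 + norm (s + of_real \<beta>))" by (simp add: algebra_simps)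
      finally have "1 + norm s \<le> (1 + \<bar>\<beta>\<bar>) * (1 + norm (s + of_real \<beta>))" .
      hence "(1 + norm s) ^ m \<le> (1 + \<bar>\<beta>\<bar>) ^ m * (1 + norm (s + of_real \<beta>)) ^ m"
        unfolding power_mult_distrib[symmetric] by (intro power_mono) auto
      hence "C0 * (1 + norm s) ^ m \<le> C0 * (1 + \<bar>\<beta>\<bar>) ^ m * (1 + norm (s + of_real \<beta>)) ^ m"
        using C0(1) by (simp add: mult.assoc)
      moreover have "(1 + norm s) ^ m > 0" "(1 + norm (s + of_real \<beta>)) ^ m > 0"
        by (intro zero_less_power add_pos_nonneg; simp)+
      ultimately show "C0 / (1 + norm (s + of_real \<beta>)) ^ m \<le> C0 * (1 + \<bar>\<beta>\<bar>) ^ m / (1 + norm s) ^ m"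
        by (simp add: divide_le_eq le_divide_eq mult_ac pos_divide_le_eq pos_le_divide_eq)
    qed auto
    also have "\<dots> = C / (1 + norm s) ^ m" by (simp add: C_def)
    finally show "norm (exp (of_real l * s) * Gamma (s + of_real \<beta>)) \<le> C / (1 + norm s) ^ m" .
  qed
qed

text \<open>The boxes eventually contain every finite subset of P, and the residues are summable in
  the unordered sense; so the partial sums over boxes converge to the full sum, however the widths
  and heights are related.\<close>

lemma rectangle_residue_sum:
  fixes X T :: "nat \<Rightarrow> real" and c :: real
  assumes hol: "G holomorphic_on - P" and fin: "\<And>B. finite {p \<in> P. norm p \<le> B}"
    and X: "\<And>k. real k \<le> X k \<and> X k \<le> real k + 1" and T: "\<And>k. real k \<le> T k \<and> T k \<le> real k + 1"
    and P: "\<And>p. p \<in> P \<Longrightarrow> Re p < c" and summ: "residue G summable_on P"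
    and bound: "\<And>k s. k \<ge> k0 \<Longrightarrow> Re s \<le> c \<Longrightarrow> \<bar>Im s\<bar> = T k \<or> Re s = - X k \<Longrightarrow>
       s \<notin> P \<and> norm (G s) \<le> C / (1 + norm s)\<^sup>2"
  shows "(\<lambda>k. 1 / (2 * of_real pi * \<i>) * contour_integral (linepath (Complex c (- T k)) (Complex c (T k))) G)
           \<longlonglongrightarrow> infsum (residue G) P"
proof -
  define B where "B = (\<lambda>k. P \<inter> box (Complex (- X k) (- T k)) (Complex c (T k)))"
  have "filterlim B (finite_subsets_at_top P) sequentially"
    unfolding filterlim_finite_subsets_at_top
  proof (intro allI impI)
    fix Y assume Y: "finite Y \<and> Y \<subseteq> P"
    hence "bounded Y" by (intro finite_imp_bounded) auto
    then obtain M where M: "\<And>y. y \<in> Y \<Longrightarrow> norm y \<le> M" by (auto simp: bounded_iff)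
    have "finite (B k)" for k
    proof -
      have "bounded (B k)" unfolding B_def by (rule bounded_subset[OF bounded_box]) auto
      then obtain M' where "\<And>y. y \<in> B k \<Longrightarrow> norm y \<le> M'" by (auto simp: bounded_iff)
      hence "B k \<subseteq> {p \<in> P. norm p \<le> M'}" by (auto simp: B_def)
      thus ?thesis using fin finite_subset by blast
    qed
    moreover have "Y \<subseteq> B k" if k: "real k > M" for k
    proof
      fix y assume y: "y \<in> Y"
      have "\<bar>Re y\<bar> < real k" "\<bar>Im y\<bar> < real k"
        using M[OF y] k abs_Re_le_cmod[of y] abs_Im_le_cmod[of y] by linarith+
      hence "- X k < Re y" "- T k < Im y" "Im y < T k" using X[of k] T[of k] by linarith+
      moreover have "y \<in> P" "Re y < c" using Y y P by auto
      ultimately show "y \<in> B k" by (simp add: B_def in_box_complex_iff)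
    qed
    moreover have "B k \<subseteq> P" for k by (auto simp: B_def)
    moreover have "eventually (\<lambda>k. real k > M) sequentially"
      using filterlim_real_sequentially by (simp add: filterlim_at_top_dense)
    ultimately show "eventually (\<lambda>k. finite (B k) \<and> Y \<subseteq> B k \<and> B k \<subseteq> P) sequentially"
      by (auto elim!: eventually_mono)
  qed
  moreover have "(sum (residue G) \<longlongrightarrow> infsum (residue G) P) (finite_subsets_at_top P)"
    using summ unfolding has_sum_def[symmetric] by (rule has_sum_infsum)
  ultimately have 1: "(\<lambda>k. \<Sum>p\<in>B k. residue G p) \<longlonglongrightarrow> infsum (residue G) P"
    by (rule filterlim_compose[rotated])
  have right: "s \<notin> P" if "Re s = c" for s using P[of s] that by auto
  have "(\<lambda>k. contour_integral (linepath (Complex c (- T k)) (Complex c (T k))) G -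
     2 * of_real pi * \<i> * (\<Sum>p\<in>B k. residue G p)) \<longlonglongrightarrow> 0"
    unfolding B_def by (rule rectangle_residue_limit[OF hol fin X T right bound])
  from tendsto_add[OF tendsto_mult[OF tendsto_const[of "1 / (2 * of_real pi * \<i>)"] this] 1]
  show ?thesis by (simp add: right_diff_distrib)
qed

lemma has_sum_range_of_summable:
  fixes f :: "complex \<Rightarrow> complex"
  assumes "inj g" "summable (\<lambda>j::nat. norm (f (g j)))"
  shows "(f has_sum (\<Sum>j. f (g j))) (range g)"
proof -
  have "(\<lambda>j. f (g j)) sums (\<Sum>j. f (g j))" 
    by (rule summable_sums[OF summable_norm_cancel[OF assms(2)]])
  from norm_summable_imp_has_sum[OF assms(2) this] show ?thesis
    by (simp only: has_sum_reindex[OF assms(1)] o_def)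
qed

section \<open>Poles and residues of the shifted Gamma function\<close>

definition gamma_poles :: "real \<Rightarrow> complex set" where
  "gamma_poles \<beta> = range (\<lambda>j::nat. - of_real \<beta> - of_nat j)"

lemma inj_gamma_poles: "inj (\<lambda>j::nat. - of_real \<beta> - (of_nat j :: complex))"
  by (auto intro!: injI)

lemma gamma_poles_iff: "s \<in> gamma_poles \<beta> \<longleftrightarrow> s + of_real \<beta> \<in> \<int>\<^sub>\<le>\<^sub>0"
proof
  assume "s + of_real \<beta> \<in> \<int>\<^sub>\<le>\<^sub>0"
  then obtain n where "s + of_real \<beta> = - of_nat n" by (elim nonpos_Ints_cases')
  hence "s = - of_nat n - of_real \<beta>" by (simp add: eq_diff_eq)
  hence "s = - of_real \<beta> - of_nat n" by simp
  thus "s \<in> gamma_poles \<beta>" by (auto simp: gamma_poles_def)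
qed (auto simp: gamma_poles_def)

lemma not_gamma_pole:
  assumes "\<And>n::nat. norm (s + of_real \<beta> + of_nat n) \<ge> d" "d > 0"
  shows "s \<notin> gamma_poles \<beta>"
proof
  assume "s \<in> gamma_poles \<beta>"
  then obtain j :: nat where "s = - of_real \<beta> - of_nat j" by (auto simp: gamma_poles_def)
  thus False using assms(1)[of j] assms(2) by simp
qed

lemma finite_gamma_poles: "finite {p \<in> gamma_poles \<beta>. norm p \<le> B}"
proof -
  have "{p \<in> gamma_poles \<beta>. norm p \<le> B} \<subseteq> (\<lambda>j::nat. - of_real \<beta> - of_nat j) ` {..nat \<lceil>B + \<bar>\<beta>\<bar>\<rceil>}"
  proof
    fix p assume "p \<in> {p \<in> gamma_poles \<beta>. norm p \<le> B}"
    then obtain j :: nat where p: "p = - of_real \<beta> - of_nat j" "norm p \<le> B" by (auto simp: gamma_poles_def)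
    have "real j = norm (of_nat j :: complex)" by simp
    also have "of_nat j = - p - of_real \<beta>" using p by simp
    also have "norm (- p - of_real \<beta>) \<le> norm (- p) + norm (of_real \<beta> :: complex)" by (rule norm_triangle_ineq4)
    also have "\<dots> \<le> B + \<bar>\<beta>\<bar>" using p(2) by simp
    finally have "j \<le> nat \<lceil>B + \<bar>\<beta>\<bar>\<rceil>" by linarith
    thus "p \<in> (\<lambda>j::nat. - of_real \<beta> - of_nat j) ` {..nat \<lceil>B + \<bar>\<beta>\<bar>\<rceil>}" using p by auto
  qed
  thus ?thesis by (rule finite_subset) auto
qed

lemma residue_times_Gamma_shift:
  assumes "open A" "- of_real \<beta> - of_nat j \<in> A" "h holomorphic_on A"
  shows "residue (\<lambda>s. h s * Gamma (s + of_real \<beta>)) (- of_real \<beta> - of_nat j) =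
           h (- of_real \<beta> - of_nat j) * ((- 1) ^ j / fact j)"
proof -
  define p :: complex where "p = - of_real \<beta> - of_nat j"
  have "residue (\<lambda>s. h s * Gamma (s + of_real \<beta>)) p = h p * ((- 1) ^ j / fact j)"
  proof (rule residue_simple')
    \<comment> \<open>Distinct poles differ by nonzero integers, so the unit disc around p contains
      no other one.\<close>
    show "open (A \<inter> ball p 1)" "p \<in> A \<inter> ball p 1" using assms by (auto simp: p_def)
    have "w + of_real \<beta> \<notin> \<int>\<^sub>\<le>\<^sub>0" if "w \<in> A \<inter> ball p 1 - {p}" for w
    proof
      assume "w + of_real \<beta> \<in> \<int>\<^sub>\<le>\<^sub>0"
      then obtain n where n: "w + of_real \<beta> = - of_nat n" by (elim nonpos_Ints_cases')
      hence "w = - of_nat n - of_real \<beta>" by (simp add: eq_diff_eq)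
      hence w: "w = - of_real \<beta> - of_nat n" by simp
      have "p - w = of_int (int n - int j)" by (simp add: w p_def)
      moreover have "norm (p - w) < 1" using that by (simp add: dist_norm)
      ultimately have "\<bar>real_of_int (int n - int j)\<bar> < 1" by (metis norm_of_int)
      hence "n = j" by linarith
      thus False using that w by (simp add: p_def)
    qed
    thus "(\<lambda>s. h s * Gamma (s + of_real \<beta>)) holomorphic_on A \<inter> ball p 1 - {p}"
      by (intro holomorphic_intros holomorphic_on_subset[OF assms(3)]) auto
    have "isCont h p"
      using assms by (metis continuous_on_eq_continuous_at holomorphic_on_imp_continuous_on p_def)
    hence 1: "h \<midarrow>p\<rightarrow> h p" by (simp add: isCont_def)
    have "w + of_real \<beta> \<noteq> - of_nat j" if "w \<noteq> p" for w
    proof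
      assume "w + of_real \<beta> = - of_nat j"
      hence "w = - of_nat j - of_real \<beta>" by (simp add: eq_diff_eq)
      thus False using that by (simp add: p_def)
    qed
    hence "filterlim (\<lambda>w. w + of_real \<beta>) (at (- of_nat j)) (at p)"
      by (intro filterlim_atI) (auto intro!: tendsto_eq_intros always_eventually simp: p_def eventually_at_filter)
    from filterlim_compose[OF Gamma_residues this]
    have 2: "(\<lambda>w. Gamma (w + of_real \<beta>) * (w + of_real \<beta> + of_nat j)) \<midarrow>p\<rightarrow> (- 1) ^ j / fact j" .
    show "(\<lambda>w. h w * Gamma (w + of_real \<beta>) * (w - p)) \<midarrow>p\<rightarrow> h p * ((- 1) ^ j / fact j)"
      using tendsto_mult[OF 1 2] by (simp add: p_def algebra_simps)
  qed
  thus ?thesis by (simp add: p_def)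
qed

section \<open>Mellin inversion\<close>

text \<open>The Cahen-Mellin integral by residues alone: at -\<beta> - j the residue is exp (- l *
  \<beta>) * (- exp (- l)) ^ j / j!, and these add up to an exponential series. \<beta> > -1 puts
  all poles to the left of the line, and the last assumption keeps the left sides of the rectangles
  at distance \<theta> from them.\<close>

lemma mellin_inversion_exp:
  fixes \<beta> l \<theta> :: real
  assumes T: "\<And>k. real k \<le> T k \<and> T k \<le> real k + 1" and \<theta>: "0 < \<theta>" "\<theta> < 1" and \<beta>: "\<beta> > -1"
    and dist: "\<And>k n :: nat. \<bar>- (real k + \<theta>) + \<beta> + real n\<bar> \<ge> \<theta>"
  shows "(\<lambda>k. 1 / (2 * of_real pi * \<i>) * contour_integral (linepath (Complex 2 (- T k)) (Complex 2 (T k)))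
            (\<lambda>s. exp (of_real l * s) * Gamma (s + of_real \<beta>)))
         \<longlonglongrightarrow> of_real (exp (- l * \<beta>) * exp (- exp (- l)))"
proof -
  let ?G = "\<lambda>s. exp (of_real l * s) * Gamma (s + of_real \<beta>)"
  let ?p = "\<lambda>j::nat. - of_real \<beta> - (of_nat j :: complex)"
  obtain C where C: "C > 0"
    "\<And>s. Re s \<le> 2 \<Longrightarrow> (\<And>n::nat. norm (s + of_real \<beta> + of_nat n) \<ge> \<theta>) \<Longrightarrow>
       norm (exp (of_real l * s) * Gamma (s + of_real \<beta>)) \<le> C / (1 + norm s) ^ 2"
    using kernel_decay[OF \<theta>(1), of 2 \<beta> l 2] by blast
  have res: "residue ?G (?p j) = of_real (exp (- l * \<beta>)) * of_real ((- exp (- l)) ^ j / fact j)" for j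
  proof -
    have "residue ?G (?p j) = exp (of_real l * ?p j) * ((- 1) ^ j / fact j)"
      by (rule residue_times_Gamma_shift[of UNIV]) (auto intro!: holomorphic_intros)
    also have "exp (of_real l * ?p j) = of_real (exp (- l * \<beta>) * exp (- l) ^ j)"
      by (simp add: exp_of_real[symmetric] exp_of_nat_mult[symmetric] exp_add[symmetric] algebra_simps)
    finally show ?thesis by (simp add: power_mult_distrib[symmetric])
  qed
  have sums: "(\<lambda>j. of_real (exp (- l * \<beta>)) * complex_of_real ((- exp (- l)) ^ j / fact j)) sums
      (of_real (exp (- l * \<beta>)) * of_real (exp (- exp (- l))))"
  proof (intro sums_mult sums_of_real)
    show "(\<lambda>j. (- exp (- l)) ^ j / fact j) sums exp (- exp (- l))"
      using exp_converges[of "- exp (- l)"] by (simp add: divide_inverse mult.commute)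
  qed
  have "summable (\<lambda>j. norm (residue ?G (?p j)))"
  proof -
    have "summable (\<lambda>j. exp (- l * \<beta>) * (exp (- l) ^ j / fact j))"
      using summable_exp[of "exp (- l)"] by (intro summable_mult) (simp add: divide_inverse mult.commute)
    thus ?thesis unfolding res by (simp add: norm_mult norm_divide norm_power abs_mult power_abs)
  qed
  from has_sum_range_of_summable[OF inj_gamma_poles this]
  have hs: "(residue ?G has_sum (of_real (exp (- l * \<beta>)) * of_real (exp (- exp (- l))))) (gamma_poles \<beta>)"
    unfolding res gamma_poles_def sums_unique[OF sums, symmetric] .
  have "(\<lambda>k. 1 / (2 * of_real pi * \<i>) * contour_integral (linepath (Complex 2 (- T k)) (Complex 2 (T k))) ?G)
           \<longlonglongrightarrow> infsum (residue ?G) (gamma_poles \<beta>)"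
  proof (rule rectangle_residue_sum[OF _ finite_gamma_poles _ T, where X = "\<lambda>k. real k + \<theta>" and C = C and ?k0.0 = 1])
    show "?G holomorphic_on - gamma_poles \<beta>"
      by (intro holomorphic_intros) (auto simp: gamma_poles_iff)
    show "residue ?G summable_on gamma_poles \<beta>" using hs by (rule has_sum_imp_summable)
    show "Re p < 2" if "p \<in> gamma_poles \<beta>" for p using that \<beta> by (auto simp: gamma_poles_def)
    fix k :: nat and s assume k: "k \<ge> 1" and s: "Re s \<le> 2" "\<bar>Im s\<bar> = T k \<or> Re s = - (real k + \<theta>)"
    have d: "norm (s + of_real \<beta> + of_nat n) \<ge> \<theta>" for n :: nat
    proof (cases "\<bar>Im s\<bar> = T k")
      case True
      hence "\<bar>Im (s + of_real \<beta> + of_nat n)\<bar> \<ge> \<theta>" using T[of k] k \<theta> by simp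
      thus ?thesis using abs_Im_le_cmod order_trans by blast
    next
      case False
      hence "Re (s + of_real \<beta> + of_nat n) = - (real k + \<theta>) + \<beta> + real n" using s by simp
      hence "\<bar>Re (s + of_real \<beta> + of_nat n)\<bar> \<ge> \<theta>" using dist[of k n] by simp
      thus ?thesis using abs_Re_le_cmod order_trans by blast
    qed
    show "s \<notin> gamma_poles \<beta> \<and> norm (?G s) \<le> C / (1 + norm s)\<^sup>2"
      using not_gamma_pole[OF d \<theta>(1)] C(2)[OF s(1) d] by blast
  qed (use \<theta> in auto)
  thus ?thesis using hs by (simp add: infsumI)
qed

text \<open>A bound that does not depend on T, through the arctangent; it provides the majorant for
  exchanging the limit in T with a sum.\<close>

lemma norm_line_integral_le:
  fixes f :: "complex \<Rightarrow> complex"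
  assumes T: "T \<ge> 0" and M: "M \<ge> 0" and cont: "continuous_on {s. Re s = c} f"
    and f: "\<And>x. norm (f (Complex c x)) \<le> M / (1 + x\<^sup>2)"
  shows "norm (contour_integral (linepath (Complex c (- T)) (Complex c T)) f) \<le> M * pi"
proof (cases "T = 0")
  case True
  thus ?thesis using M by (simp add: contour_integral_trivial)
next
  case False
  hence "- T < T" using T by simp
  have "norm (contour_integral (linepath (Complex c (- T)) (Complex c T)) f) =
      norm (integral {- T..T} (\<lambda>x. f (Complex c x)))"
    using \<open>- T < T\<close> by (subst contour_integral_linepath_same_Re[where c = c]) (auto simp: norm_mult)
  also have "\<dots> \<le> integral {- T..T} (\<lambda>x. M / (1 + x\<^sup>2))"
  proof (rule integral_norm_bound_integral)
    show "(\<lambda>x. f (Complex c x)) integrable_on {- T..T}"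
      by (intro integrable_continuous_real continuous_on_compose2[OF cont] continuous_intros)
         (auto simp: Complex_eq intro!: continuous_intros)
    show "(\<lambda>x. M / (1 + x\<^sup>2)) integrable_on {- T..T}"
      by (intro integrable_continuous_real continuous_intros) (auto simp: add_nonneg_eq_0_iff)
  qed (use f in auto)
  also have "\<dots> = M * arctan T - M * arctan (- T)"
  proof (rule integral_unique, rule fundamental_theorem_of_calculus)
    fix x :: real
    show "((\<lambda>x. M * arctan x) has_vector_derivative M / (1 + x\<^sup>2)) (at x within {- T..T})"
      unfolding has_real_derivative_iff_has_vector_derivative[symmetric]
      by (auto intro!: derivative_eq_intros simp: divide_inverse)
  qed (use \<open>- T < T\<close> in auto)
  also have "\<dots> = M * (2 * arctan T)" by (simp add: arctan_minus)
  also have "\<dots> \<le> M * pi" using arctan_ubound[of T] M by (intro mult_left_mono) auto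
  finally show ?thesis .
qed

section \<open>The explicit formula\<close>

text \<open>
  The abscissae \<open>-(k + \<theta>)\<close> with \<open>\<theta>\<close> half the fractional part of \<open>\<alpha>\<close> stay away from the trivial
  zeros as well as from the poles \<open>1 - \<alpha> - j\<close> of the Gamma factor.
\<close>
lemma frac_half_distance:
  fixes \<alpha> :: real
  defines "\<theta> \<equiv> frac \<alpha> / 2"
  assumes "\<alpha> \<notin> \<int>"
  shows "0 < \<theta>" "\<theta> < 1 / 2" "\<theta> \<notin> \<int>" "\<bar>\<alpha> + of_int m - \<theta>\<bar> \<ge> \<theta>"
proof -
  have f: "0 < frac \<alpha>" "frac \<alpha> < 1" using assms frac_gt_0_iff frac_lt_1 by auto
  show \<theta>: "0 < \<theta>" "\<theta> < 1 / 2" using f by (auto simp: \<theta>_def)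
  show "\<theta> \<notin> \<int>"
  proof
    assume "\<theta> \<in> \<int>"
    then obtain n where "\<theta> = of_int n" by (elim Ints_cases)
    hence "0 < real_of_int n" "real_of_int n < 1" using \<theta> by simp_all
    thus False by simp
  qed
  define n where "n = \<lfloor>\<alpha>\<rfloor> + m"
  have e: "\<alpha> + of_int m - \<theta> = of_int n + \<theta>" by (simp add: n_def \<theta>_def frac_def field_simps)
  have "n \<ge> 0 \<or> n \<le> -1" by linarith
  hence n: "real_of_int n \<ge> 0 \<or> real_of_int n \<le> -1" by linarith
  show "\<bar>\<alpha> + of_int m - \<theta>\<bar> \<ge> \<theta>" unfolding e using n \<theta> by auto
qed

lemma frac_distance:
  fixes \<alpha> :: real
  shows "\<bar>\<alpha> + of_int m\<bar> \<ge> min (frac \<alpha>) (1 - frac \<alpha>)"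
proof -
  define n where "n = \<lfloor>\<alpha>\<rfloor> + m"
  have e: "\<alpha> + of_int m = of_int n + frac \<alpha>" by (simp add: n_def frac_def)
  have "n \<ge> 0 \<or> n \<le> -1" by linarith
  hence n: "real_of_int n \<ge> 0 \<or> real_of_int n \<le> -1" by linarith
  show ?thesis unfolding e using n frac_ge_0[of \<alpha>] by auto
qed

section \<open>The Mellin kernel and the residues\<close>

text \<open>For lam > 0 and \<alpha> > 0 this is the Mellin transform of the gamma weight, the
  integral of w(t) t^(s - 1) over t > 0 where it converges. The power of lam is written with exp, so
  that holomorphy in s is immediate.\<close>

definition mellin_kernel :: "real \<Rightarrow> real \<Rightarrow> complex \<Rightarrow> complex" where
  "mellin_kernel \<alpha> lam s =
     exp ((s - 1) * of_real (ln lam)) * Gamma (s + of_real (\<alpha> - 1)) / of_real (Gamma \<alpha>)"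

lemma mellin_kernel_alt:
  "mellin_kernel \<alpha> lam s = (of_real (exp (- ln lam)) / of_real (Gamma \<alpha>)) *
     (exp (of_real (ln lam) * s) * Gamma (s + of_real (\<alpha> - 1)))"
proof -
  have "exp ((s - 1) * of_real (ln lam)) = of_real (exp (- ln lam)) * exp (of_real (ln lam) * s)"
    by (simp add: exp_of_real[symmetric] exp_add[symmetric] algebra_simps)
  thus ?thesis by (simp add: mellin_kernel_def)
qed

lemma holomorphic_mellin_kernel:
  "A \<inter> gamma_poles (\<alpha> - 1) = {} \<Longrightarrow> mellin_kernel \<alpha> lam holomorphic_on A"
  unfolding mellin_kernel_alt[abs_def] using gamma_poles_iff[of _ "\<alpha> - 1"]
  by (intro holomorphic_intros) auto

lemma mellin_kernel_decay:
  assumes "d > 0"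
  obtains C where "C > 0"
    "\<And>s. Re s \<le> c \<Longrightarrow> (\<And>n::nat. norm (s + of_real (\<alpha> - 1) + of_nat n) \<ge> d) \<Longrightarrow>
       norm (mellin_kernel \<alpha> lam s) \<le> C / (1 + norm s) ^ m"
proof -
  obtain C0 where C0: "C0 > 0"
    "\<And>s. Re s \<le> c \<Longrightarrow> (\<And>n::nat. norm (s + of_real (\<alpha> - 1) + of_nat n) \<ge> d) \<Longrightarrow>
       norm (exp (of_real (ln lam) * s) * Gamma (s + of_real (\<alpha> - 1))) \<le> C0 / (1 + norm s) ^ m"
    using kernel_decay[OF assms] by blast
  define a where "a = norm (complex_of_real (exp (- ln lam)) / of_real (Gamma \<alpha>))"
  have a: "a \<ge> 0" by (simp add: a_def)
  show ?thesis
  proof (rule that[of "(a + 1) * C0"])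
    show "(a + 1) * C0 > 0" using C0(1) a by simp
    fix s assume s: "Re s \<le> c" "\<And>n::nat. norm (s + of_real (\<alpha> - 1) + of_nat n) \<ge> d"
    have "norm (mellin_kernel \<alpha> lam s) = a * norm (exp (of_real (ln lam) * s) * Gamma (s + of_real (\<alpha> - 1)))"
      unfolding mellin_kernel_alt a_def norm_mult ..
    also have "\<dots> \<le> (a + 1) * (C0 / (1 + norm s) ^ m)"
      using a C0(2)[OF s] by (intro mult_mono) auto
    finally show "norm (mellin_kernel \<alpha> lam s) \<le> (a + 1) * C0 / (1 + norm s) ^ m" by simp
  qed
qed

lemma norm_ge_if_Im:
  assumes "\<bar>Im s\<bar> \<ge> 1"
  shows "norm (s + of_real x + of_nat n) \<ge> 1"
proof -
  have "\<bar>Im (s + of_real x + of_nat n)\<bar> \<ge> 1" using assms by simp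
  thus ?thesis using abs_Im_le_cmod order_trans by blast
qed

lemma norm_ge_if_Re:
  assumes "\<bar>Re s + x + real n\<bar> \<ge> d"
  shows "norm (s + of_real x + of_nat n) \<ge> d"
proof -
  have "\<bar>Re (s + of_real x + of_nat n)\<bar> \<ge> d" using assms by simp
  thus ?thesis using abs_Re_le_cmod order_trans by blast
qed

text \<open>The main term 1. Near 1, zeta is \<open>zeta_reg\<close> times (w - 1)^-1, and the
  kernel at 1 is the total mass 1 of the gamma density. The radius min \<alpha> 1 avoids the Gamma
  poles, which start at 1 - \<alpha>.\<close>

lemma mellin_kernel_residue_zeta_1:
  assumes "\<alpha> > 0"
  shows "residue (\<lambda>s. deriv zeta s / zeta s * - mellin_kernel \<alpha> lam s) 1 = 1"
proof -
  define r where "r = min \<alpha> 1"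
  have r: "r > 0" using assms by (simp add: r_def)
  have Re: "\<bar>Re w - 1\<bar> < r" if "w \<in> ball 1 r" for w
    using that abs_Re_le_cmod[of "1 - w"] by (simp add: dist_norm abs_minus_commute)
  have "residue (\<lambda>s. deriv zeta s / zeta s * - mellin_kernel \<alpha> lam s) 1 = of_int (- 1) * - mellin_kernel \<alpha> lam 1"
  proof (rule residue_log_deriv_times[OF r])
    show "zeta_reg holomorphic_on ball 1 r"
      using Re by (intro holomorphic_on_subset[OF holomorphic_zeta_reg]) (force simp: r_def)
    have "w \<notin> gamma_poles (\<alpha> - 1)" if "w \<in> ball 1 r" for w
    proof
      assume "w \<in> gamma_poles (\<alpha> - 1)"
      then obtain j :: nat where "w = - of_real (\<alpha> - 1) - of_nat j" by (auto simp: gamma_poles_def)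
      hence "Re w = 1 - \<alpha> - real j" by simp
      hence "\<bar>Re w - 1\<bar> = \<alpha> + real j" using assms by simp
      thus False using Re[OF that] by (simp add: r_def)
    qed
    thus "(\<lambda>s. - mellin_kernel \<alpha> lam s) holomorphic_on ball 1 r"
      by (intro holomorphic_intros holomorphic_mellin_kernel) auto
    show "zeta w = zeta_reg w * (w - 1) powi - 1" if "w \<in> ball 1 r - {1}" for w
      using that Re[of w] zeta_reg_eq[of w] by (auto simp: r_def power_int_minus field_simps)
  qed auto
  moreover have "mellin_kernel \<alpha> lam 1 = 1"
  proof -
    have "Gamma \<alpha> \<noteq> 0" using Gamma_real_pos[OF assms] by simp
    thus ?thesis by (simp add: mellin_kernel_def Gamma_complex_of_real)
  qed
  ultimately show ?thesis by simp
qed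

lemma mellin_kernel_residue_zeta_zero:
  assumes \<rho>: "zeta \<rho> = 0" "\<rho> \<noteq> 1" "\<rho> \<notin> gamma_poles (\<alpha> - 1)"
  shows "residue (\<lambda>s. deriv zeta s / zeta s * - mellin_kernel \<alpha> lam s) \<rho> =
           - (of_int (zorder zeta \<rho>) * mellin_kernel \<alpha> lam \<rho>)"
proof -
  have con: "connected (- {1 :: complex})" by (rule connected_punctured_universe) auto
  have op: "open (- {1 :: complex})" by auto
  have "zeta 3 \<noteq> 0" by (rule zeta_neq_0_right) auto
  hence "\<exists>w\<in>- {1}. zeta w \<noteq> 0" by (intro bexI[of _ 3]) auto
  from zorder_exist_zero[OF holomorphic_zeta op con _ this, of \<rho>] \<rho>
  obtain r where r: "zorder zeta \<rho> > 0" "r > 0" "zor_poly zeta \<rho> holomorphic_on cball \<rho> r"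
    "\<And>w. w \<in> cball \<rho> r \<Longrightarrow> zeta w = zor_poly zeta \<rho> w * (w - \<rho>) ^ nat (zorder zeta \<rho>) \<and> zor_poly zeta \<rho> w \<noteq> 0"
    by auto
  have "closed (gamma_poles (\<alpha> - 1))"
  proof -
    have "gamma_poles (\<alpha> - 1) = (\<lambda>s. s + of_real (\<alpha> - 1)) -` \<int>\<^sub>\<le>\<^sub>0" using gamma_poles_iff by blast
    thus ?thesis by (auto intro!: closed_vimage closed_nonpos_Ints continuous_intros)
  qed
  hence "open (- gamma_poles (\<alpha> - 1))" by (rule open_Compl)
  then obtain e where e: "e > 0" "ball \<rho> e \<subseteq> - gamma_poles (\<alpha> - 1)"
    using \<rho>(3) by (meson ComplI open_contains_ball)
  define d where "d = min r e"
  have d: "d > 0" "ball \<rho> d \<subseteq> cball \<rho> r" "ball \<rho> d \<subseteq> ball \<rho> e" using r e by (auto simp: d_def)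
  have "residue (\<lambda>s. deriv zeta s / zeta s * - mellin_kernel \<alpha> lam s) \<rho> =
          of_int (zorder zeta \<rho>) * - mellin_kernel \<alpha> lam \<rho>"
  proof (rule residue_log_deriv_times[OF d(1)])
    show "zor_poly zeta \<rho> holomorphic_on ball \<rho> d" using r(3) d(2) holomorphic_on_subset by blast
    show "zor_poly zeta \<rho> \<rho> \<noteq> 0" using r(4)[of \<rho>] r(2) by auto
    show "(\<lambda>s. - mellin_kernel \<alpha> lam s) holomorphic_on ball \<rho> d"
      using e d by (intro holomorphic_intros holomorphic_mellin_kernel) blast
    show "zeta w = zor_poly zeta \<rho> w * (w - \<rho>) powi zorder zeta \<rho>" if "w \<in> ball \<rho> d - {\<rho>}" for w
      using r(4)[of w] that d r(1) by (auto simp: power_int_def)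
  qed
  thus ?thesis by simp
qed

text \<open>The poles 1 - \<alpha> - j are real, below 1 and never integers. Negative ones could
  only be trivial zeros, which are integers; on (0, 1) zeta does not vanish.\<close>

lemma zeta_nonzero_at_gamma_pole:
  assumes "\<alpha> \<notin> \<int>" "\<alpha> > 0" "p \<in> gamma_poles (\<alpha> - 1)"
  shows "zeta p \<noteq> 0" "p \<noteq> 1" "Re p < 1"
proof -
  obtain j :: nat where p: "p = of_real (1 - \<alpha> - real j)"
    using assms(3) by (auto simp: gamma_poles_def)
  define x where "x = 1 - \<alpha> - real j"
  have x: "x < 1" "p = of_real x" using assms p by (auto simp: x_def)
  have xZ: "x \<notin> \<int>"
  proof
    assume "x \<in> \<int>"
    then obtain n where "x = of_int n" by (elim Ints_cases)
    hence "\<alpha> = of_int (1 - int j - n)" by (simp add: x_def)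
    thus False using assms(1) by (metis Ints_of_int)
  qed
  show "Re p < 1" "p \<noteq> 1" using x by (auto simp: complex_eq_iff)
  show "zeta p \<noteq> 0"
  proof (cases "x < 0")
    case True
    have "\<not> (\<exists>k::nat\<ge>1. p = - 2 * of_nat k)"
    proof
      assume "\<exists>k::nat\<ge>1. p = - 2 * of_nat k"
      then obtain k :: nat where "complex_of_real x = - 2 * of_nat k" using x by auto
      hence "x = Re (- 2 * of_nat k)" by (metis Re_complex_of_real)
      hence "x = of_int (- 2 * int k)" by simp
      thus False using xZ by (metis Ints_of_int)
    qed
    thus ?thesis using zeta_eq_0_iff_left[of p] sin_half_eq_0_iff_left[of p] True x by auto
  next
    case False
    moreover have "x \<noteq> 0" using xZ by auto
    ultimately have "0 < x" by simp
    hence "zeta p = zeta_right p" using x by (intro zeta_eq_right) (auto simp: complex_eq_iff)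
    thus ?thesis using zeta_right_real_neq_0[of x] \<open>0 < x\<close> x by simp
  qed
qed

lemma mellin_kernel_residue_gamma_pole:
  fixes \<alpha> lam :: real and j :: nat
  assumes "\<alpha> \<notin> \<int>" "\<alpha> > 0"
  defines "p \<equiv> - of_real (\<alpha> - 1) - of_nat j"
  shows "residue (\<lambda>s. deriv zeta s / zeta s * - mellin_kernel \<alpha> lam s) p =
     - (deriv zeta p / zeta p * exp ((p - 1) * of_real (ln lam)) / of_real (Gamma \<alpha>) * ((- 1) ^ j / fact j))"
proof -
  have "p \<in> gamma_poles (\<alpha> - 1)" by (auto simp: p_def gamma_poles_def)
  note p = zeta_nonzero_at_gamma_pole[OF assms(1,2) this]
  define A where "A = {s \<in> - {1}. zeta s \<in> - {0}}"
  have "open (- {1} \<inter> zeta -` (- {0}))"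
    by (intro continuous_open_preimage holomorphic_on_imp_continuous_on holomorphic_zeta) auto
  also have "- {1} \<inter> zeta -` (- {0}) = A" by (auto simp: A_def)
  finally have A: "open A" .
  define h where "h = (\<lambda>s. - (deriv zeta s / zeta s * exp ((s - 1) * of_real (ln lam)) / of_real (Gamma \<alpha>)))"
  have dz: "deriv zeta holomorphic_on - {1}" by (intro holomorphic_deriv holomorphic_zeta) auto
  have h: "h holomorphic_on A"
    unfolding h_def divide_inverse
    by (intro holomorphic_intros holomorphic_on_subset[OF dz]) (auto simp: A_def)
  have "residue (\<lambda>s. h s * Gamma (s + of_real (\<alpha> - 1))) p = h p * ((- 1) ^ j / fact j)"
    unfolding p_def by (rule residue_times_Gamma_shift[OF A _ h]) (use p in \<open>auto simp: A_def p_def\<close>)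
  also have "(\<lambda>s. h s * Gamma (s + of_real (\<alpha> - 1))) = (\<lambda>s. deriv zeta s / zeta s * - mellin_kernel \<alpha> lam s)"
    by (auto simp: h_def mellin_kernel_def)
  finally show ?thesis by (simp add: h_def)
qed

section \<open>The two series in R\<close>

lemma falling_factorial_Gamma:
  fixes \<alpha> :: real
  assumes "\<alpha> \<notin> \<int>"
  shows "falling_factorial (\<alpha> - 1) n * Gamma (\<alpha> - real n) = Gamma \<alpha>"
proof (induction n)
  case (Suc n)
  have "\<alpha> - real (Suc n) \<notin> \<int>\<^sub>\<le>\<^sub>0"
  proof
    assume "\<alpha> - real (Suc n) \<in> \<int>\<^sub>\<le>\<^sub>0"
    then obtain m where "\<alpha> - real (Suc n) = of_int m" by (elim nonpos_Ints_cases)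
    hence "\<alpha> = of_int (m + int (Suc n))" by simp
    thus False using assms by (metis Ints_of_int)
  qed
  from Gamma_plus1[OF this] have "Gamma (\<alpha> - real n) = (\<alpha> - real (Suc n)) * Gamma (\<alpha> - real (Suc n))"
    by (simp add: algebra_simps)
  moreover have "falling_factorial (\<alpha> - 1) (Suc n) = falling_factorial (\<alpha> - 1) n * (\<alpha> - real (Suc n))"
    by (simp add: falling_factorial_def algebra_simps)
  ultimately show ?case using Suc.IH by simp
qed (simp add: falling_factorial_def)

text \<open>This is where the falling factorials in R come from: at s = -2 k the Gamma quotient is
  Gamma (\<alpha> - n) / Gamma \<alpha> with n = 2 k + 1.\<close>

lemma mellin_kernel_trivial_zero:
  fixes \<alpha> lam :: real
  assumes "\<alpha> \<notin> \<int>" "\<alpha> > 0" "lam > 0" "\<mu> = \<alpha> * lam"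
  shows "mellin_kernel \<alpha> lam (- 2 * of_nat k) = of_real (R_falling_term \<mu> \<alpha> k)"
proof -
  define n where "n = 2 * k + 1"
  have G: "Gamma \<alpha> \<noteq> 0" using Gamma_real_pos[OF assms(2)] by simp
  have ff: "falling_factorial (\<alpha> - 1) n * Gamma (\<alpha> - real n) = Gamma \<alpha>"
    by (rule falling_factorial_Gamma[OF assms(1)])
  hence nz: "falling_factorial (\<alpha> - 1) n \<noteq> 0" using G by auto
  have "- 2 * of_nat k + complex_of_real (\<alpha> - 1) = of_real (\<alpha> - real n)" by (simp add: n_def)
  hence 1: "Gamma (- 2 * of_nat k + complex_of_real (\<alpha> - 1)) = of_real (Gamma (\<alpha> - real n))"
    by (simp only: Gamma_complex_of_real)
  have "(- 2 * of_nat k - 1) * complex_of_real (ln lam) = of_real (real n * (- ln lam))"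
    by (simp add: n_def algebra_simps)
  hence "exp ((- 2 * of_nat k - 1) * complex_of_real (ln lam)) = of_real (exp (real n * (- ln lam)))"
    by (simp only: exp_of_real)
  also have "exp (real n * (- ln lam)) = (\<alpha> / \<mu>) ^ n"
    using assms by (simp add: exp_of_nat_mult exp_minus inverse_eq_divide power_divide)
  finally have 2: "exp ((- 2 * of_nat k - 1) * complex_of_real (ln lam)) = of_real ((\<alpha> / \<mu>) ^ n)" .
  have "mellin_kernel \<alpha> lam (- 2 * of_nat k) = of_real ((\<alpha> / \<mu>) ^ n * Gamma (\<alpha> - real n) / Gamma \<alpha>)"
    unfolding mellin_kernel_def 1 2 by simp
  also have "(\<alpha> / \<mu>) ^ n * Gamma (\<alpha> - real n) / Gamma \<alpha> = (\<alpha> / \<mu>) ^ n / falling_factorial (\<alpha> - 1) n"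
    using G nz unfolding ff[symmetric] by auto
  finally show ?thesis by (simp add: R_falling_term_def n_def)
qed

text \<open>The terms are kernel values at the trivial zeros, so the decay of the kernel applies;
  the distance of \<alpha> to the nearest integer separates these points from the Gamma
  poles.\<close>

lemma R_falling_term_summable:
  fixes \<alpha> lam :: real
  assumes "\<alpha> \<notin> \<int>" "\<alpha> > 0" "lam > 0" "\<mu> = \<alpha> * lam"
  shows "summable (\<lambda>k. norm (R_falling_term \<mu> \<alpha> (Suc k)))"
proof -
  define d where "d = min (frac \<alpha>) (1 - frac \<alpha>)"
  have d: "d > 0" using assms(1) frac_gt_0_iff frac_lt_1 by (simp add: d_def)
  obtain C where C: "C > 0"
    "\<And>s. Re s \<le> 0 \<Longrightarrow> (\<And>n::nat. norm (s + of_real (\<alpha> - 1) + of_nat n) \<ge> d) \<Longrightarrow>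
       norm (mellin_kernel \<alpha> lam s) \<le> C / (1 + norm s) ^ 2"
    using mellin_kernel_decay[OF d] by blast
  show ?thesis
  proof (rule summable_comparison_test')
    show "summable (\<lambda>k. C * (1 / (real k + 1)\<^sup>2))"
      using inverse_squares_sums by (intro summable_mult) (simp add: sums_iff add_ac)
    fix k :: nat
    let ?s = "- 2 * of_nat (Suc k) :: complex"
    have "norm (R_falling_term \<mu> \<alpha> (Suc k)) = norm (mellin_kernel \<alpha> lam ?s)"
      by (subst mellin_kernel_trivial_zero[OF assms]) simp
    also have "\<dots> \<le> C / (1 + norm ?s) ^ 2"
    proof (rule C(2))
      fix n :: nat
      have "\<bar>Re ?s + (\<alpha> - 1) + real n\<bar> = \<bar>\<alpha> + of_int (int n - 1 - 2 * int (Suc k))\<bar>" by (simp add: algebra_simps)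
      also have "\<dots> \<ge> d" unfolding d_def by (rule frac_distance)
      finally show "norm (?s + of_real (\<alpha> - 1) + of_nat n) \<ge> d" by (intro norm_ge_if_Re)
    qed auto
    also have "\<dots> \<le> C / (real k + 1)\<^sup>2"
    proof (intro divide_left_mono power_mono mult_pos_pos zero_less_power)
      have "norm ?s = 2 * real (Suc k)" by (simp only: norm_mult norm_of_nat norm_minus_cancel norm_numeral)
      thus "real k + 1 \<le> 1 + norm ?s" by simp
    qed (use C(1) in \<open>auto intro: add_pos_nonneg\<close>)
    finally show "norm (norm (R_falling_term \<mu> \<alpha> (Suc k))) \<le> C * (1 / (real k + 1)\<^sup>2)" by simp
  qed
qed

text \<open>The growth of zeta'/zeta along 1 - \<alpha> - j is linear in j. Bounding it by a
  multiple of 2 ^ j leaves the exponential series with argument 2 y.\<close>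

lemma R_zeta_term_summable:
  fixes \<alpha> \<mu> :: real
  assumes "\<alpha> \<notin> \<int>"
  shows "summable (\<lambda>j. norm (R_zeta_term \<mu> \<alpha> j))"
proof -
  have "\<alpha> - 1 \<notin> \<int>" using assms by (metis Ints_1 Ints_add diff_add_cancel)
  from log_deriv_zeta_left_arithmetic[OF this] obtain C where C: "C > 0"
    "\<And>s k. Re s = - (real k + (\<alpha> - 1)) \<Longrightarrow> Re s \<le> -1/2 \<Longrightarrow>
       zeta s \<noteq> 0 \<and> norm (deriv zeta s / zeta s) \<le> C * (1 + norm s)" by blast
  define y where "y = \<bar>\<alpha> / \<mu>\<bar>"
  define B where "B = 2 + \<bar>1 - \<alpha>\<bar>"
  \<comment> \<open>From N on, 1 - \<alpha> - j \<le> -1, which is left of -1/2.\<close>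
  obtain N :: nat where N: "real N \<ge> 2 - \<alpha>" using real_arch_simple by blast
  show ?thesis
  proof (rule summable_comparison_test')
    show "summable (\<lambda>j. C * B * ((2 * y) ^ j / fact j))"
      using summable_exp[of "2 * y"] by (intro summable_mult) (simp add: divide_inverse mult.commute)
    fix j :: nat assume j: "j \<ge> N"
    let ?s = "complex_of_real (1 - \<alpha> - real j)"
    have ns: "norm ?s \<le> \<bar>1 - \<alpha>\<bar> + real j" unfolding norm_of_real by linarith
    have "norm (deriv zeta ?s / zeta ?s) \<le> C * (1 + norm ?s)"
      using C(2)[of ?s j] j N by simp
    also have "\<dots> \<le> C * (B * 2 ^ j)"
    proof (rule mult_left_mono)
      have j2: "real j + 1 \<le> 2 ^ j" using Bernoulli_inequality[of "1::real" j] by simp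
      have "1 + norm ?s \<le> B + real j" using ns by (simp add: B_def)
      also have "\<dots> \<le> B * (real j + 1)" by (simp add: B_def algebra_simps)
      also have "\<dots> \<le> B * 2 ^ j" using j2 by (intro mult_left_mono) (auto simp: B_def)
      finally show "1 + norm ?s \<le> B * 2 ^ j" .
    qed (use C(1) in auto)
    finally have b: "norm (deriv zeta ?s / zeta ?s) \<le> C * (B * 2 ^ j)" .
    have "norm (R_zeta_term \<mu> \<alpha> j) = y ^ j / fact j * norm (deriv zeta ?s / zeta ?s)"
      unfolding R_zeta_term_def norm_mult norm_divide norm_power y_def norm_of_real by simp
    also have "\<dots> \<le> y ^ j / fact j * (C * (B * 2 ^ j))"
      using b by (intro mult_left_mono) (auto simp: y_def)
    finally show "norm (norm (R_zeta_term \<mu> \<alpha> j)) \<le> C * B * ((2 * y) ^ j / fact j)"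
      by (simp add: power_mult_distrib mult_ac)
  qed
qed

section \<open>The weighted von Mangoldt sum as a line integral\<close>

text \<open>The right-hand side is the limit delivered by Mellin inversion at l = ln lam - ln n with
  \<beta> = \<alpha> - 1, times the constant split off in \<open>mellin_kernel_alt\<close>.\<close>

lemma gamma_weight_eq:
  assumes "lam > 0" "\<alpha> > 0"
  shows "gamma_weight \<alpha> lam (real (Suc n)) =
    exp (- ln lam) / Gamma \<alpha> * (exp (- (ln lam - ln (real (Suc n))) * (\<alpha> - 1)) * exp (- exp (- (ln lam - ln (real (Suc n))))))"
proof -
  define x where "x = real (Suc n)"
  have x: "x > 0" by (simp add: x_def)
  have "exp (- (ln lam - ln x)) = x / lam" using x assms by (simp add: exp_diff)
  moreover have "exp (- ln lam) * exp (- (ln lam - ln x) * (\<alpha> - 1)) = x powr (\<alpha> - 1) / lam powr \<alpha>"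
    using x assms unfolding powr_def by (simp add: exp_diff[symmetric] exp_add[symmetric] algebra_simps)
  ultimately show ?thesis
    unfolding x_def[symmetric] gamma_weight_def by (simp add: field_simps)
qed

lemma mellin_kernel_line_limit:
  fixes \<alpha> lam :: real
  assumes "\<alpha> \<notin> \<int>" "\<alpha> > 0" "lam > 0" and T: "\<And>k. real k \<le> T k \<and> T k \<le> real k + 1"
  shows "(\<lambda>k. 1 / (2 * of_real pi * \<i>) * contour_integral (linepath (Complex 2 (- T k)) (Complex 2 (T k)))
            (\<lambda>s. mangoldt (Suc n) * (of_nat (Suc n) powr (- s) * mellin_kernel \<alpha> lam s)))
         \<longlonglongrightarrow> of_real (mangoldt (Suc n) * gamma_weight \<alpha> lam (real (Suc n)))"
proof -
  define l where "l = ln lam - ln (real (Suc n))"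
  define a where "a = complex_of_real (mangoldt (Suc n) * (exp (- ln lam) / Gamma \<alpha>))"
  have p: "of_nat (Suc n) powr (- s) * mellin_kernel \<alpha> lam s =
     complex_of_real (exp (- ln lam) / Gamma \<alpha>) * (exp (of_real l * s) * Gamma (s + of_real (\<alpha> - 1)))" for s
  proof -
    have "complex_of_nat (Suc n) powr (- s) = exp (- s * of_real (ln (real (Suc n))))"
      using powr_of_real_exp[of "real (Suc n)" "- s"] by simp
    hence "of_nat (Suc n) powr (- s) * exp (of_real (ln lam) * s) = exp (complex_of_real l * s)"
      by (simp add: l_def exp_add[symmetric] algebra_simps del: of_nat_Suc)
    thus ?thesis by (simp add: mellin_kernel_alt mult_ac del: of_nat_Suc)
  qed
  have eq: "(\<lambda>s. mangoldt (Suc n) * (of_nat (Suc n) powr (- s) * mellin_kernel \<alpha> lam s)) =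
     (\<lambda>s. a * (exp (of_real l * s) * Gamma (s + of_real (\<alpha> - 1))))"
    unfolding p by (simp add: a_def mult_ac)
  note \<theta> = frac_half_distance[OF assms(1)]
  have "(\<lambda>k. 1 / (2 * of_real pi * \<i>) * contour_integral (linepath (Complex 2 (- T k)) (Complex 2 (T k)))
            (\<lambda>s. exp (of_real l * s) * Gamma (s + of_real (\<alpha> - 1))))
         \<longlonglongrightarrow> of_real (exp (- l * (\<alpha> - 1)) * exp (- exp (- l)))"
  proof (rule mellin_inversion_exp[OF T \<theta>(1)])
    fix k m :: nat
    have "- (real k + frac \<alpha> / 2) + (\<alpha> - 1) + real m = \<alpha> + of_int (int m - 1 - int k) - frac \<alpha> / 2" by simp
    thus "frac \<alpha> / 2 \<le> \<bar>- (real k + frac \<alpha> / 2) + (\<alpha> - 1) + real m\<bar>" using \<theta>(4) by metis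
  qed (use \<theta> assms in auto)
  hence "(\<lambda>k. a * (1 / (2 * of_real pi * \<i>) * contour_integral (linepath (Complex 2 (- T k)) (Complex 2 (T k)))
            (\<lambda>s. exp (of_real l * s) * Gamma (s + of_real (\<alpha> - 1)))))
         \<longlonglongrightarrow> a * of_real (exp (- l * (\<alpha> - 1)) * exp (- exp (- l)))"
    by (rule tendsto_mult_left)
  moreover have "a * of_real (exp (- l * (\<alpha> - 1)) * exp (- exp (- l))) =
      of_real (mangoldt (Suc n) * gamma_weight \<alpha> lam (real (Suc n)))"
    unfolding gamma_weight_eq[OF assms(3,2)] l_def[symmetric] a_def by (simp only: of_real_mult mult_ac)
  moreover have "contour_integral g (\<lambda>s. a * (exp (of_real l * s) * Gamma (s + of_real (\<alpha> - 1)))) =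
      a * contour_integral g (\<lambda>s. exp (of_real l * s) * Gamma (s + of_real (\<alpha> - 1)))"
    if "(\<lambda>s. exp (of_real l * s) * Gamma (s + of_real (\<alpha> - 1))) contour_integrable_on g" for g
    using that by (rule contour_integral_lmul)
  moreover have "(\<lambda>s. exp (of_real l * s) * Gamma (s + of_real (\<alpha> - 1))) contour_integrable_on
      linepath (Complex 2 (- T k)) (Complex 2 (T k))" for k
  proof (intro contour_integrable_continuous_linepath holomorphic_on_imp_continuous_on holomorphic_intros)
    fix z assume "z \<in> closed_segment (Complex 2 (- T k)) (Complex 2 (T k))"
    hence "Re z = 2" by (auto simp: closed_segment_same_Re)
    hence "Re (z + of_real (\<alpha> - 1)) > 0" using assms(2) by simp
    thus "z + of_real (\<alpha> - 1) \<notin> \<int>\<^sub>\<le>\<^sub>0"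
      by (auto elim!: nonpos_Ints_cases dest!: arg_cong[of _ _ Re] simp del: of_real_diff)
  qed
  ultimately show ?thesis unfolding eq by (simp add: mult_ac)
qed

text \<open>Two exchanges of limits. At a fixed height, the Dirichlet series converges uniformly on
  Re s = 2 after multiplication by the bounded kernel, so sum and integral commute. As the height
  grows, Tannery's theorem applies: \<open>norm_line_integral_le\<close> bounds the n-th integral
  independently of k by a summable sequence. The summability of the weighted sum is a
  by-product.\<close>

lemma mangoldt_weight_line_sum:
  fixes \<alpha> lam :: real
  assumes "\<alpha> \<notin> \<int>" "\<alpha> > 0" "lam > 0" and T: "\<And>k. real k \<le> T k \<and> T k \<le> real k + 1"
  shows "summable (\<lambda>n. mangoldt (Suc n) * gamma_weight \<alpha> lam (real (Suc n)))"
    and "(\<lambda>k. 1 / (2 * of_real pi * \<i>) * contour_integral (linepath (Complex 2 (- T k)) (Complex 2 (T k)))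
            (\<lambda>s. deriv zeta s / zeta s * - mellin_kernel \<alpha> lam s))
         \<longlonglongrightarrow> of_real (\<Sum>n. mangoldt (Suc n) * gamma_weight \<alpha> lam (real (Suc n)))"
proof -
  define g where "g = (\<lambda>k. linepath (Complex 2 (- T k)) (Complex 2 (T k)))"
  define t where "t = (\<lambda>n s. mangoldt (Suc n) * (of_nat (Suc n) powr (- s) * mellin_kernel \<alpha> lam s))"
  define a where "a = (\<lambda>n k. 1 / (2 * of_real pi * \<i>) * contour_integral (g k) (t n))"
  have T0: "T k \<ge> 0" for k using T[of k] by linarith
  \<comment> \<open>On Re s = 2 the real part of s + \<alpha> - 1 + n is at least \<alpha> +
    1.\<close>
  obtain C where C: "C > 0"
    "\<And>s. Re s \<le> 2 \<Longrightarrow> (\<And>n::nat. norm (s + of_real (\<alpha> - 1) + of_nat n) \<ge> \<alpha> + 1) \<Longrightarrow>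
       norm (mellin_kernel \<alpha> lam s) \<le> C / (1 + norm s) ^ 2"
    using mellin_kernel_decay[of "\<alpha> + 1"] assms(2) by (metis add_pos_pos zero_less_one)
  have ker: "norm (mellin_kernel \<alpha> lam s) \<le> C / (1 + norm s)\<^sup>2" if "Re s = 2" for s
    using that assms(2) by (intro C(2) norm_ge_if_Re) auto
  have kerC: "norm (mellin_kernel \<alpha> lam s) \<le> C" if "Re s = 2" for s
  proof -
    have "1 \<le> (1 + norm s)\<^sup>2" by (intro one_le_power) simp
    moreover from this have "0 < (1 + norm s)\<^sup>2 * 1" by linarith
    ultimately have "C / (1 + norm s)\<^sup>2 \<le> C / 1" using C(1) by (intro divide_left_mono) auto
    thus ?thesis using ker[OF that] by simp
  qed
  have hk: "mellin_kernel \<alpha> lam holomorphic_on {s. Re s > 1}"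
    by (rule holomorphic_mellin_kernel) (use assms(2) in \<open>auto simp: gamma_poles_def\<close>)
  have contk: "continuous_on {s. Re s = 2} (mellin_kernel \<alpha> lam)"
    by (rule continuous_on_subset[OF holomorphic_on_imp_continuous_on[OF hk]]) auto
  have contt: "continuous_on {s. Re s = 2} (t n)" for n
    unfolding t_def by (intro continuous_intros contk) (auto simp del: of_nat_Suc)
  have seg: "path_image (g k) \<subseteq> {s. Re s = 2}" for k
    by (auto simp: g_def closed_segment_same_Re)
  have intt: "t n contour_integrable_on g k" for n k
    unfolding g_def using seg[of k]
    by (intro contour_integrable_continuous_linepath continuous_on_subset[OF contt]) (auto simp: g_def)
  define M where "M = (\<lambda>n. mangoldt (Suc n) * real (Suc n) powr (- 2))"
  have M: "summable M" unfolding M_def by (rule mangoldt_powr_summable) simp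
  have M0: "M n \<ge> 0" for n unfolding M_def by (simp add: mangoldt_nonneg)
  have tn: "norm (t n s) = M n * norm (mellin_kernel \<alpha> lam s)" if "Re s = 2" for n s
    using that by (simp add: t_def M_def norm_mult norm_of_nat_powr mangoldt_nonneg del: of_nat_Suc)
  have bound: "norm (a n k) \<le> C * M n" for n k
  proof -
    have "norm (contour_integral (g k) (t n)) \<le> (M n * C) * pi"
      unfolding g_def
    proof (rule norm_line_integral_le[OF T0 _ contt])
      show "M n * C \<ge> 0" using M0 C(1) by simp
      fix x :: real
      have "norm (t n (Complex 2 x)) \<le> M n * (C / (1 + norm (Complex 2 x))\<^sup>2)"
        unfolding tn[of "Complex 2 x" n, simplified] using M0 by (intro mult_left_mono ker) auto
      also have "\<dots> \<le> M n * (C / (1 + x\<^sup>2))"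
      proof (intro mult_left_mono divide_left_mono)
        have "1 + x\<^sup>2 \<le> 1 + (norm (Complex 2 x))\<^sup>2" by (simp add: cmod_power2)
        also have "\<dots> \<le> (1 + norm (Complex 2 x))\<^sup>2" by (simp add: power2_eq_square algebra_simps)
        finally show "1 + x\<^sup>2 \<le> (1 + norm (Complex 2 x))\<^sup>2" .
        show "0 < (1 + norm (Complex 2 x))\<^sup>2 * (1 + x\<^sup>2)"
          by (intro mult_pos_pos zero_less_power add_pos_nonneg) auto
      qed (use M0 C(1) in auto)
      finally show "norm (t n (Complex 2 x)) \<le> M n * C / (1 + x\<^sup>2)" by simp
    qed
    hence "norm (a n k) \<le> 1 / (2 * pi) * ((M n * C) * pi)"
      unfolding a_def norm_mult by (intro mult_mono) (auto simp: norm_divide norm_mult)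
    also have "\<dots> = C * M n / 2" by simp
    also have "\<dots> \<le> C * M n" using M0[of n] C(1) by simp
    finally show ?thesis .
  qed
  have lim: "a n \<longlonglongrightarrow> of_real (mangoldt (Suc n) * gamma_weight \<alpha> lam (real (Suc n)))" for n
    unfolding a_def g_def t_def by (rule mellin_kernel_line_limit[OF assms])
  have tan: "summable (\<lambda>n. norm (complex_of_real (mangoldt (Suc n) * gamma_weight \<alpha> lam (real (Suc n))))) \<and>
     ((\<lambda>k. \<Sum>n. a n k) \<longlonglongrightarrow> (\<Sum>n. complex_of_real (mangoldt (Suc n) * gamma_weight \<alpha> lam (real (Suc n)))))"
    using tannerys_theorem[OF lim always_eventually summable_mult[OF M, of C]] bound
    by (auto simp: case_prod_unfold)
  hence "summable (\<lambda>n. norm (mangoldt (Suc n) * gamma_weight \<alpha> lam (real (Suc n))))"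
    by (simp only: norm_of_real real_norm_def)
  thus summ: "summable (\<lambda>n. mangoldt (Suc n) * gamma_weight \<alpha> lam (real (Suc n)))"
    by (rule summable_norm_cancel)
  have int_sum: "1 / (2 * of_real pi * \<i>) * contour_integral (g k) (\<lambda>s. deriv zeta s / zeta s * - mellin_kernel \<alpha> lam s) =
      (\<Sum>n. a n k)" for k
  proof -
    have U: "uniform_limit {s. Re s = 2} (\<lambda>N s. \<Sum>n<N. t n s) (\<lambda>s. \<Sum>n. t n s) sequentially"
    proof (rule Weierstrass_m_test[where M = "\<lambda>n. M n * C"])
      show "norm (t n s) \<le> M n * C" if "s \<in> {s. Re s = 2}" for n s
        using that kerC[of s] M0[of n] by (simp add: tn mult_left_mono)
      show "summable (\<lambda>n. M n * C)" using M by (rule summable_mult2)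
    qed
    have "(\<lambda>N. contour_integral (g k) (\<lambda>s. \<Sum>n<N. t n s)) \<longlonglongrightarrow> contour_integral (g k) (\<lambda>s. \<Sum>n. t n s)"
    proof (rule contour_integral_uniform_limit)
      show "eventually (\<lambda>N. (\<lambda>s. \<Sum>n<N. t n s) contour_integrable_on g k) sequentially"
        by (intro always_eventually allI contour_integrable_sum intt) auto
      show "uniform_limit (path_image (g k)) (\<lambda>N s. \<Sum>n<N. t n s) (\<lambda>s. \<Sum>n. t n s) sequentially"
        by (rule uniform_limit_on_subset[OF U seg])
      show "norm (vector_derivative (g k) (at x)) \<le> norm (Complex 2 (T k) - Complex 2 (- T k))" for x
        by (simp add: g_def)
    qed (auto simp: g_def)
    also have "(\<lambda>N. contour_integral (g k) (\<lambda>s. \<Sum>n<N. t n s)) = (\<lambda>N. \<Sum>n<N. contour_integral (g k) (t n))"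
      by (intro ext contour_integral_sum intt) auto
    finally have "(\<lambda>n. contour_integral (g k) (t n)) sums contour_integral (g k) (\<lambda>s. \<Sum>n. t n s)"
      by (simp add: sums_def)
    hence "(\<lambda>n. a n k) sums (1 / (2 * of_real pi * \<i>) * contour_integral (g k) (\<lambda>s. \<Sum>n. t n s))"
      unfolding a_def by (rule sums_mult)
    moreover have "contour_integral (g k) (\<lambda>s. \<Sum>n. t n s) =
        contour_integral (g k) (\<lambda>s. deriv zeta s / zeta s * - mellin_kernel \<alpha> lam s)"
    proof (rule contour_integral_eq)
      fix s assume "s \<in> path_image (g k)"
      hence s: "Re s = 2" using seg by auto
      have "(\<lambda>n. mangoldt (Suc n) * of_nat (Suc n) powr (- s)) sums mangoldt_series s"
        unfolding mangoldt_series_def using s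
        by (intro summable_sums summable_norm_cancel[OF mangoldt_series_summable]) auto
      hence "(\<lambda>n. mangoldt (Suc n) * of_nat (Suc n) powr (- s) * mellin_kernel \<alpha> lam s) sums
               (mangoldt_series s * mellin_kernel \<alpha> lam s)"
        by (rule sums_mult2)
      hence "(\<Sum>n. t n s) = mangoldt_series s * mellin_kernel \<alpha> lam s"
        by (simp add: t_def sums_iff mult.assoc)
      also have "mangoldt_series s = - (deriv zeta s / zeta s)"
        using s by (intro log_deriv_zeta_right[symmetric]) auto
      finally show "(\<Sum>n. t n s) = deriv zeta s / zeta s * - mellin_kernel \<alpha> lam s" by simp
    qed
    ultimately show ?thesis by (simp add: sums_iff)
  qed
  have "(\<Sum>n. complex_of_real (mangoldt (Suc n) * gamma_weight \<alpha> lam (real (Suc n)))) =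
      of_real (\<Sum>n. mangoldt (Suc n) * gamma_weight \<alpha> lam (real (Suc n)))"
    using summ by (rule suminf_of_real[symmetric])
  thus "(\<lambda>k. 1 / (2 * of_real pi * \<i>) * contour_integral (linepath (Complex 2 (- T k)) (Complex 2 (T k)))
            (\<lambda>s. deriv zeta s / zeta s * - mellin_kernel \<alpha> lam s))
         \<longlonglongrightarrow> of_real (\<Sum>n. mangoldt (Suc n) * gamma_weight \<alpha> lam (real (Suc n)))"
    using tan unfolding int_sum[unfolded g_def] by simp
qed

section \<open>Assembly of the explicit formula\<close>

text \<open>Kernel decay of order 4 against growth of order 2 of zeta'/zeta leaves the order 2
  required on the rectangles. The horizontal sides avoid the Gamma poles because these are real, the
  left sides by the choice of frac \<alpha> / 2.\<close>

lemma log_deriv_kernel_contour_bound: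
  fixes \<alpha> lam :: real
  assumes "\<alpha> \<notin> \<int>" "\<alpha> > 0"
  obtains C T where "\<And>k. real k \<le> T k \<and> T k \<le> real k + 1"
    "\<And>k s. k \<ge> 14 \<Longrightarrow> Re s \<le> 2 \<Longrightarrow> \<bar>Im s\<bar> = T k \<or> Re s = - (real k + frac \<alpha> / 2) \<Longrightarrow>
       s \<notin> {1} \<union> {\<rho>. zeta \<rho> = 0 \<and> \<rho> \<noteq> 1} \<union> gamma_poles (\<alpha> - 1) \<and>
       norm (deriv zeta s / zeta s * - mellin_kernel \<alpha> lam s) \<le> C / (1 + norm s)\<^sup>2"
proof -
  define \<theta> where "\<theta> = frac \<alpha> / 2"
  note \<theta> = frac_half_distance[OF assms(1), folded \<theta>_def]
  obtain C1 T where C1: "C1 > 0" and T: "\<And>k::nat. real k \<le> T k \<and> T k \<le> real k + 1"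
    and heights: "\<And>k s. k \<ge> 14 \<Longrightarrow> \<bar>Im s\<bar> = T k \<Longrightarrow> Re s \<le> 3 \<Longrightarrow>
       zeta s \<noteq> 0 \<and> norm (deriv zeta s / zeta s) \<le> C1 * (1 + norm s)\<^sup>2"
    using log_deriv_zeta_at_heights by blast
  obtain C2 where C2: "C2 > 0" "\<And>s k. Re s = - (real k + \<theta>) \<Longrightarrow> Re s \<le> -1/2 \<Longrightarrow>
       zeta s \<noteq> 0 \<and> norm (deriv zeta s / zeta s) \<le> C2 * (1 + norm s)"
    using log_deriv_zeta_left_arithmetic[OF \<theta>(3)] by blast
  obtain C3 where C3: "C3 > 0"
    "\<And>s. Re s \<le> 2 \<Longrightarrow> (\<And>n::nat. norm (s + of_real (\<alpha> - 1) + of_nat n) \<ge> \<theta>) \<Longrightarrow>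
       norm (mellin_kernel \<alpha> lam s) \<le> C3 / (1 + norm s) ^ 4"
    using mellin_kernel_decay[OF \<theta>(1)] by blast
  show ?thesis
  proof (rule that[OF T, of "(C1 + C2) * C3"])
    fix k :: nat and s assume k: "k \<ge> 14" and s: "Re s \<le> 2" "\<bar>Im s\<bar> = T k \<or> Re s = - (real k + frac \<alpha> / 2)"
    have n1: "1 + norm s \<ge> 1" by simp
    have z: "zeta s \<noteq> 0 \<and> norm (deriv zeta s / zeta s) \<le> (C1 + C2) * (1 + norm s)\<^sup>2 \<and> s \<noteq> 1 \<and>
         (\<forall>n::nat. norm (s + of_real (\<alpha> - 1) + of_nat n) \<ge> \<theta>)"
    proof (cases "\<bar>Im s\<bar> = T k")
      case True
      have Im: "\<bar>Im s\<bar> \<ge> 1" using True T[of k] k by linarith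
      have "zeta s \<noteq> 0 \<and> norm (deriv zeta s / zeta s) \<le> C1 * (1 + norm s)\<^sup>2"
        using heights[OF k True] s by simp
      moreover have "C1 * (1 + norm s)\<^sup>2 \<le> (C1 + C2) * (1 + norm s)\<^sup>2"
        using C2(1) by (intro mult_right_mono) auto
      moreover have "s \<noteq> 1" using Im by auto
      moreover have "norm (s + of_real (\<alpha> - 1) + of_nat n) \<ge> \<theta>" for n :: nat
        using norm_ge_if_Im[OF Im, of "\<alpha> - 1" n] \<theta> by simp
      ultimately show ?thesis by auto
    next
      case False
      hence Re: "Re s = - (real k + \<theta>)" using s by (simp add: \<theta>_def)
      have "real k \<ge> 14" using k by simp
      hence Re': "Re s \<le> -1/2" "s \<noteq> 1" using Re \<theta> by auto
      have "zeta s \<noteq> 0 \<and> norm (deriv zeta s / zeta s) \<le> C2 * (1 + norm s)"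
        by (rule C2(2)[OF Re Re'(1)])
      moreover have "C2 * (1 + norm s) \<le> (C1 + C2) * (1 + norm s)\<^sup>2"
        using C1 C2(1) n1 by (intro mult_mono self_le_power) auto
      moreover have "norm (s + of_real (\<alpha> - 1) + of_nat n) \<ge> \<theta>" for n :: nat
      proof (rule norm_ge_if_Re)
        have "Re s + (\<alpha> - 1) + real n = \<alpha> + of_int (int n - 1 - int k) - \<theta>" by (simp add: Re)
        thus "\<theta> \<le> \<bar>Re s + (\<alpha> - 1) + real n\<bar>" using \<theta>(4) by metis
      qed
      ultimately show ?thesis using Re'(2) by auto
    qed
    have "s \<notin> gamma_poles (\<alpha> - 1)" using z \<theta>(1) by (intro not_gamma_pole[where d = \<theta>]) auto
    moreover have "norm (deriv zeta s / zeta s * - mellin_kernel \<alpha> lam s) \<le> (C1 + C2) * C3 / (1 + norm s)\<^sup>2"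
    proof -
      have "norm (deriv zeta s / zeta s * - mellin_kernel \<alpha> lam s) \<le>
              ((C1 + C2) * (1 + norm s)\<^sup>2) * (C3 / (1 + norm s) ^ 4)"
        unfolding norm_mult norm_minus_cancel using z C3(2)[OF s(1)] C1 C2(1) by (intro mult_mono) auto
      also have "\<dots> = (C1 + C2) * C3 / (1 + norm s)\<^sup>2"
      proof -
        have "a * x\<^sup>2 * (b / x ^ 4) = a * b / x\<^sup>2" if "x \<noteq> 0" for a b x :: real
          using that by (simp add: field_simps power2_eq_square power4_eq_xxxx)
        thus ?thesis using n1 by (metis not_one_le_zero)
      qed
      finally show ?thesis .
    qed
    ultimately show "s \<notin> {1} \<union> {\<rho>. zeta \<rho> = 0 \<and> \<rho> \<noteq> 1} \<union> gamma_poles (\<alpha> - 1) \<and>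
       norm (deriv zeta s / zeta s * - mellin_kernel \<alpha> lam s) \<le> (C1 + C2) * C3 / (1 + norm s)\<^sup>2"
      using z by blast
  qed
qed

lemma zero_term_eq_mellin_kernel:
  assumes "\<alpha> > 0" "lam > 0" "\<mu> = \<alpha> * lam"
  shows "zero_term \<mu> \<alpha> \<rho> = of_int (zorder zeta \<rho>) * mellin_kernel \<alpha> lam \<rho>"
proof -
  have "\<mu> / \<alpha> = lam" using assms by simp
  moreover have "complex_of_real \<alpha> + \<rho> - 1 = \<rho> + of_real (\<alpha> - 1)" by simp
  moreover have "Gamma (complex_of_real \<alpha>) = of_real (Gamma \<alpha>)" by (rule Gamma_complex_of_real)
  ultimately show ?thesis
    using powr_of_real_exp[OF assms(2), of "\<rho> - 1"] by (simp only: zero_term_def mellin_kernel_def) simp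
qed

lemma zero_term_summable:
  assumes "\<alpha> > 0" "lam > 0" "\<mu> = \<alpha> * lam"
  shows "zero_term \<mu> \<alpha> summable_on nontrivial_zeros"
proof -
  obtain C where C: "C > 0"
    "\<And>s. Re s \<le> 1 \<Longrightarrow> (\<And>n::nat. norm (s + of_real (\<alpha> - 1) + of_nat n) \<ge> 1) \<Longrightarrow>
       norm (mellin_kernel \<alpha> lam s) \<le> C / (1 + norm s) ^ 3"
    using mellin_kernel_decay[of 1] by (metis zero_less_one)
  have "(\<lambda>\<rho>. of_int (zorder zeta \<rho>) * mellin_kernel \<alpha> lam \<rho>) summable_on nontrivial_zeros"
  proof (rule zero_sum_summable)
    fix \<rho> assume \<rho>: "\<rho> \<in> nontrivial_zeros" "\<bar>Im \<rho>\<bar> \<ge> 14"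
    have "norm (mellin_kernel \<alpha> lam \<rho>) \<le> C / (1 + norm \<rho>) ^ 3"
      using \<rho> by (intro C(2) norm_ge_if_Im) (auto simp: nontrivial_zeros_eq)
    also have "\<dots> \<le> C / (1 + \<bar>Im \<rho>\<bar>) ^ 3"
      using C(1) abs_Im_le_cmod[of \<rho>]
      by (intro divide_left_mono power_mono mult_pos_pos zero_less_power add_pos_nonneg) auto
    finally show "norm (mellin_kernel \<alpha> lam \<rho>) \<le> C / (1 + \<bar>Im \<rho>\<bar>) ^ 3" .
  qed
  thus ?thesis using zero_term_eq_mellin_kernel[OF assms] by (simp add: zero_term_eq_mellin_kernel[OF assms, abs_def])
qed

definition trivial_zeros :: "complex set" where
  "trivial_zeros = range (\<lambda>k::nat. - 2 * of_nat (Suc k))"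

lemma zeta_zeros_eq: "{\<rho>. zeta \<rho> = 0 \<and> \<rho> \<noteq> 1} = nontrivial_zeros \<union> trivial_zeros"
proof (intro equalityI subsetI)
  fix \<rho> assume \<rho>: "\<rho> \<in> {\<rho>. zeta \<rho> = 0 \<and> \<rho> \<noteq> 1}"
  show "\<rho> \<in> nontrivial_zeros \<union> trivial_zeros"
  proof (cases "\<rho> \<in> nontrivial_zeros")
    case False
    then obtain k :: nat where "k \<ge> 1" "\<rho> = - 2 * of_nat k" using \<rho> by (auto simp: nontrivial_zeros_def)
    hence "\<rho> = - 2 * of_nat (Suc (k - 1))" by simp
    thus ?thesis unfolding trivial_zeros_def by blast
  qed auto
next
  fix \<rho> assume "\<rho> \<in> nontrivial_zeros \<union> trivial_zeros"
  moreover have "zeta (- 2 * of_nat (Suc k)) = 0" for k by (rule deriv_zeta_trivial_zero) simp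
  moreover have "- 2 * complex_of_nat (Suc k) \<noteq> 1" for k
  proof
    assume "- 2 * complex_of_nat (Suc k) = 1"
    hence "Re (- 2 * complex_of_nat (Suc k)) = 1" by simp
    thus False by simp
  qed
  ultimately show "\<rho> \<in> {\<rho>. zeta \<rho> = 0 \<and> \<rho> \<noteq> 1}"
    by (auto simp: nontrivial_zeros_def trivial_zeros_def simp del: of_nat_Suc)
qed

lemma zorder_zeta_trivial_zero: "zorder zeta (- 2 * of_nat (Suc k)) = 1"
proof (rule zorder_zero_eqI[OF holomorphic_zeta])
  have "- 2 * of_nat (Suc k) \<in> trivial_zeros" by (auto simp: trivial_zeros_def)
  thus "- 2 * of_nat (Suc k) \<in> - {1 :: complex}" using zeta_zeros_eq by blast
qed (use deriv_zeta_trivial_zero[of "Suc k"] in auto)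

text \<open>Infinite sums are total operators here and have a value even without convergence; the
  four summability claims exclude that the equation holds only through such values.\<close>

theorem theorem1:
  fixes \<alpha> lam \<mu> :: real
  assumes "\<alpha> > 0" and "lam > 0" and "\<alpha> \<notin> \<nat>" and "\<mu> = \<alpha> * lam"
  shows "summable (\<lambda>n. mangoldt (Suc n) * gamma_weight \<alpha> (\<mu> / \<alpha>) (real (Suc n))) \<and>
         zero_term \<mu> \<alpha> summable_on nontrivial_zeros \<and>
         summable (\<lambda>j. R_falling_term \<mu> \<alpha> (Suc j)) \<and>
         summable (R_zeta_term \<mu> \<alpha>) \<and>
         complex_of_real (\<Sum>n. mangoldt (Suc n) * gamma_weight \<alpha> (\<mu> / \<alpha>) (real (Suc n))) =
           1 - (\<Sum>\<^sub>\<infinity>\<rho>\<in>nontrivial_zeros. zero_term \<mu> \<alpha> \<rho>) - R_remainder \<mu> \<alpha>"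
proof -
  have \<alpha>: "\<alpha> \<notin> \<int>"
  proof
    assume "\<alpha> \<in> \<int>"
    then obtain n where n: "\<alpha> = of_int n" by (elim Ints_cases)
    hence "\<alpha> = of_nat (nat n)" using assms(1) by simp
    thus False using assms(3) by (metis of_nat_in_Nats)
  qed
  have lam: "\<mu> / \<alpha> = lam" "\<alpha> / \<mu> = inverse lam" using assms by (auto simp: field_simps)
  note A = \<alpha> assms(1,2,4)
  define G where "G = (\<lambda>s. deriv zeta s / zeta s * - mellin_kernel \<alpha> lam s)"
  let ?p = "\<lambda>j::nat. - of_real (\<alpha> - 1) - (of_nat j :: complex)"
  let ?q = "\<lambda>k::nat. - 2 * (of_nat (Suc k) :: complex)"
  let ?P = "{1} \<union> {\<rho>. zeta \<rho> = 0 \<and> \<rho> \<noteq> 1} \<union> gamma_poles (\<alpha> - 1)"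
  obtain C T where T: "\<And>k. real k \<le> T k \<and> T k \<le> real k + 1"
    and bound: "\<And>k s. k \<ge> 14 \<Longrightarrow> Re s \<le> 2 \<Longrightarrow> \<bar>Im s\<bar> = T k \<or> Re s = - (real k + frac \<alpha> / 2) \<Longrightarrow>
       s \<notin> ?P \<and> norm (deriv zeta s / zeta s * - mellin_kernel \<alpha> lam s) \<le> C / (1 + norm s)\<^sup>2"
    by (rule log_deriv_kernel_contour_bound[OF \<alpha> assms(1), where lam = lam]) (rule that; assumption)
  note pole = zeta_nonzero_at_gamma_pole[OF \<alpha> assms(1)]

  have r1: "residue G 1 = 1"
    unfolding G_def by (rule mellin_kernel_residue_zeta_1[OF assms(1)])
  have rz: "residue G \<rho> = - (of_int (zorder zeta \<rho>) * mellin_kernel \<alpha> lam \<rho>)" if "zeta \<rho> = 0" "\<rho> \<noteq> 1" for \<rho>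
    unfolding G_def using that pole(1) by (intro mellin_kernel_residue_zeta_zero) auto
  have rN: "residue G \<rho> = - zero_term \<mu> \<alpha> \<rho>" if "\<rho> \<in> nontrivial_zeros" for \<rho>
    using rz that zero_term_eq_mellin_kernel[OF assms(1,2,4)] by (auto simp: nontrivial_zeros_def)
  have rT: "residue G (?q k) = - of_real (R_falling_term \<mu> \<alpha> (Suc k))" for k
  proof -
    have "?q k \<in> trivial_zeros" by (auto simp: trivial_zeros_def)
    hence "zeta (?q k) = 0" "?q k \<noteq> 1" using zeta_zeros_eq by blast+
    hence "residue G (?q k) = - mellin_kernel \<alpha> lam (?q k)"
      unfolding rz[OF \<open>zeta (?q k) = 0\<close> \<open>?q k \<noteq> 1\<close>] zorder_zeta_trivial_zero by simp
    thus ?thesis unfolding mellin_kernel_trivial_zero[OF A] .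
  qed
  define c where "c = complex_of_real ((\<alpha> / \<mu>) powr \<alpha> / Gamma \<alpha>)"
  have rP: "residue G (?p j) = - (c * R_zeta_term \<mu> \<alpha> j)" for j
  proof -
    have p: "?p j = of_real (1 - \<alpha> - real j)" by simp
    have "(?p j - 1) * of_real (ln lam) = complex_of_real (\<alpha> * (- ln lam) + real j * (- ln lam))"
      by (simp add: algebra_simps)
    hence "exp ((?p j - 1) * of_real (ln lam)) = of_real (exp (\<alpha> * (- ln lam) + real j * (- ln lam)))"
      by (simp only: exp_of_real)
    also have "exp (\<alpha> * (- ln lam) + real j * (- ln lam)) = (\<alpha> / \<mu>) powr \<alpha> * (\<alpha> / \<mu>) ^ j"
    proof -
      have "exp (real j * (- ln lam)) = (\<alpha> / \<mu>) ^ j"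
        using assms(2) by (simp add: lam exp_of_nat_mult exp_minus power_inverse)
      moreover have "exp (\<alpha> * (- ln lam)) = (\<alpha> / \<mu>) powr \<alpha>"
        using assms(2) by (simp add: lam powr_def ln_inverse)
      ultimately show ?thesis by (simp only: exp_add)
    qed
    finally have e: "exp ((?p j - 1) * of_real (ln lam)) = of_real ((\<alpha> / \<mu>) powr \<alpha> * (\<alpha> / \<mu>) ^ j)" .
    show ?thesis
      unfolding G_def mellin_kernel_residue_gamma_pole[OF \<alpha> assms(1)] e
      unfolding p R_zeta_term_def c_def by (simp add: field_simps)
  qed

  have sT: "summable (\<lambda>k. norm (R_falling_term \<mu> \<alpha> (Suc k)))"
    by (rule R_falling_term_summable[OF A])
  have sP: "summable (\<lambda>j. norm (R_zeta_term \<mu> \<alpha> j))"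
    by (rule R_zeta_term_summable[OF \<alpha>])
  have sN: "zero_term \<mu> \<alpha> summable_on nontrivial_zeros"
    by (rule zero_term_summable[OF assms(1,2,4)])
  have hN: "(residue G has_sum - (\<Sum>\<^sub>\<infinity>\<rho>\<in>nontrivial_zeros. zero_term \<mu> \<alpha> \<rho>)) nontrivial_zeros"
  proof -
    have "((\<lambda>\<rho>. - zero_term \<mu> \<alpha> \<rho>) has_sum - (\<Sum>\<^sub>\<infinity>\<rho>\<in>nontrivial_zeros. zero_term \<mu> \<alpha> \<rho>)) nontrivial_zeros"
      using sN by (intro has_sum_uminusI has_sum_infsum)
    thus ?thesis by (subst has_sum_cong[OF rN]) auto
  qed
  have hT: "(residue G has_sum - of_real (\<Sum>k. R_falling_term \<mu> \<alpha> (Suc k))) trivial_zeros"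
  proof -
    have "inj ?q" by (auto intro!: injI)
    moreover have "summable (\<lambda>k. norm (residue G (?q k)))" unfolding rT using sT by simp
    ultimately have "(residue G has_sum (\<Sum>k. residue G (?q k))) trivial_zeros"
      unfolding trivial_zeros_def by (rule has_sum_range_of_summable)
    also have "(\<Sum>k. residue G (?q k)) = - of_real (\<Sum>k. R_falling_term \<mu> \<alpha> (Suc k))"
      unfolding rT using summable_norm_cancel[OF sT] by (simp add: suminf_minus suminf_of_real summable_of_real)
    finally show ?thesis .
  qed
  have hP: "(residue G has_sum - (c * (\<Sum>j. R_zeta_term \<mu> \<alpha> j))) (gamma_poles (\<alpha> - 1))"
  proof -
    have "summable (\<lambda>j. norm (residue G (?p j)))" unfolding rP using sP by (simp add: norm_mult summable_mult)
    from has_sum_range_of_summable[OF inj_gamma_poles this]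
    have "(residue G has_sum (\<Sum>j. residue G (?p j))) (gamma_poles (\<alpha> - 1))" unfolding gamma_poles_def .
    also have "(\<Sum>j. residue G (?p j)) = - (c * (\<Sum>j. R_zeta_term \<mu> \<alpha> j))"
      unfolding rP using summable_norm_cancel[OF sP] by (simp add: suminf_minus suminf_mult summable_mult)
    finally show ?thesis .
  qed
  have h1: "(residue G has_sum 1) {1}" using has_sum_finite[of "{1}" "residue G"] r1 by simp
  have disj: "nontrivial_zeros \<inter> trivial_zeros = {}"
    by (auto simp: nontrivial_zeros_def trivial_zeros_def simp del: of_nat_Suc)
  define S where "S = 1 + (- (\<Sum>\<^sub>\<infinity>\<rho>\<in>nontrivial_zeros. zero_term \<mu> \<alpha> \<rho>) +
      - of_real (\<Sum>k. R_falling_term \<mu> \<alpha> (Suc k))) + - (c * (\<Sum>j. R_zeta_term \<mu> \<alpha> j))"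
  \<comment> \<open>The sums may be added because the families of poles are disjoint; for the Gamma
    poles this is the nonvanishing of zeta there.\<close>
  have "(residue G has_sum S) ?P"
    unfolding S_def
  proof (intro has_sum_Un_disjoint h1 hP)
    show "(residue G has_sum (- (\<Sum>\<^sub>\<infinity>\<rho>\<in>nontrivial_zeros. zero_term \<mu> \<alpha> \<rho>) +
      - of_real (\<Sum>k. R_falling_term \<mu> \<alpha> (Suc k)))) {\<rho>. zeta \<rho> = 0 \<and> \<rho> \<noteq> 1}"
      unfolding zeta_zeros_eq by (intro has_sum_Un_disjoint hN hT disj)
  qed (use pole in auto)

  have "(\<lambda>k. 1 / (2 * of_real pi * \<i>) * contour_integral (linepath (Complex 2 (- T k)) (Complex 2 (T k))) G)
           \<longlonglongrightarrow> infsum (residue G) ?P"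
  proof (rule rectangle_residue_sum[where X = "\<lambda>k. real k + frac \<alpha> / 2" and C = C and ?k0.0 = 14])
    have dz: "deriv zeta holomorphic_on - {1}" by (intro holomorphic_deriv holomorphic_zeta) auto
    show "G holomorphic_on - ?P"
      unfolding G_def
      by (intro holomorphic_on_mult holomorphic_on_divide holomorphic_on_minus holomorphic_on_subset[OF dz]
                holomorphic_zeta' holomorphic_mellin_kernel) auto
    show "finite {p \<in> ?P. norm p \<le> B}" for B
    proof -
      have "{p \<in> trivial_zeros. norm p \<le> B} \<subseteq> ?q ` {..nat \<lceil>B\<rceil>}"
      proof
        fix p assume "p \<in> {p \<in> trivial_zeros. norm p \<le> B}"
        then obtain k where k: "p = ?q k" "norm p \<le> B" by (auto simp: trivial_zeros_def)
        have "norm p = 2 * real (Suc k)" unfolding k(1) by (simp only: norm_mult norm_of_nat norm_minus_cancel norm_numeral)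
        hence "real k \<le> B" using k(2) by simp
        hence "k \<le> nat \<lceil>B\<rceil>" by linarith
        thus "p \<in> ?q ` {..nat \<lceil>B\<rceil>}" using k(1) by blast
      qed
      hence "finite {p \<in> trivial_zeros. norm p \<le> B}" by (rule finite_subset) auto
      moreover have "finite {p \<in> nontrivial_zeros. norm p \<le> B}"
        by (rule finite_subset[OF _ finite_nontrivial_zeros_bounded[of B]])
           (use abs_Im_le_cmod order_trans in blast)
      moreover have "{p \<in> ?P. norm p \<le> B} \<subseteq> {1} \<union> {p \<in> nontrivial_zeros. norm p \<le> B} \<union>
         {p \<in> trivial_zeros. norm p \<le> B} \<union> {p \<in> gamma_poles (\<alpha> - 1). norm p \<le> B}"
        unfolding zeta_zeros_eq by blast
      ultimately show ?thesis using finite_gamma_poles finite_subset by (meson finite.emptyI finite.insertI finite_UnI)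
    qed
    show "real k \<le> real k + frac \<alpha> / 2 \<and> real k + frac \<alpha> / 2 \<le> real k + 1" for k
      using frac_half_distance(1,2)[OF \<alpha>] by linarith
    show "Re p < 2" if "p \<in> ?P" for p
      using that pole(3)[of p] zeta_neq_0_right[of p] by force
    show "residue G summable_on ?P" using \<open>(residue G has_sum S) ?P\<close> by (rule has_sum_imp_summable)
    show "s \<notin> ?P \<and> norm (G s) \<le> C / (1 + norm s)\<^sup>2"
      if "k \<ge> 14" "Re s \<le> 2" "\<bar>Im s\<bar> = T k \<or> Re s = - (real k + frac \<alpha> / 2)" for k s
      unfolding G_def by (rule bound[OF that])
  qed (rule T)
  note L = this[unfolded infsumI[OF \<open>(residue G has_sum S) ?P\<close>], unfolded G_def]
  \<comment> \<open>The same truncated line integrals converge to both sides.\<close>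
  have "of_real (\<Sum>n. mangoldt (Suc n) * gamma_weight \<alpha> lam (real (Suc n))) = S"
    by (rule LIMSEQ_unique[OF mangoldt_weight_line_sum(2)[OF A(1-3) T] L])
  also have "S = 1 - (\<Sum>\<^sub>\<infinity>\<rho>\<in>nontrivial_zeros. zero_term \<mu> \<alpha> \<rho>) - R_remainder \<mu> \<alpha>"
    by (simp add: S_def R_remainder_def c_def)
  finally show ?thesis
    using mangoldt_weight_line_sum(1)[OF A(1-3) T] sN summable_norm_cancel[OF sT] summable_norm_cancel[OF sP]
    unfolding lam by blast
qed

end
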